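(* Let $L$ be a pseudo-Finsler metric defined on $A\subseteq\mathrm{T}M$, and let $Z\in\mathfrak{X}(M_A)$. If $\nabla$ is any symmetric $A$-anisotropic connection (i.e. with vanishing torsion) such that its underlying nonlinear connection is the metric nonlinear connection of $L$ and $\nabla_Z(d\mathrm{Vol})=0$, then $$\mathrm{div}(Z)=\mathrm{trace}(\nabla Z),$$ or in coordinates, $$\mathrm{div}(Z)=\frac{\delta Z^i}{\delta x^i}+\Gamma^i_{ik}Z^k,$$ where $\Gamma^i_{jk}$ are the Christoffel symbols of $\nabla$. In particular, this is true for the (Levi-Civita)--Chern anisotropic connection of $L$, so one can take the Christoffel symbols to be $$\Gamma^i_{jk}=\frac12 g^{il}\left(\frac{\delta g_{lj}}{\delta x^k}+\frac{\delta g_{lk}}{\delta x^j}-\frac{\delta g_{jk}}{\delta x^l}\right).$$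
   Context: $M$ is a connected oriented smooth manifold of dimension $n\ge2$, $\pi\colon\mathrm{T}M\to M$ is the projection, and $A\subseteq\mathrm{T}M\setminus\mathbf{0}$ is open with $\pi(A)=M$ and conic ($\lambda v\in A$ for $v\in A$, $\lambda>0$). Coordinates $x^i$ on $M$ induce coordinates $(x^i,y^i)$ on $\mathrm{T}M$; $\partial_i=\partial/\partial x^i$, $\dot\partial_i=\partial/\partial y^i$. An anisotropic tensor field $T\in\mathcal{T}^r_s(M_A)$ assigns smoothly to each $v\in A$ an $r$-contravariant $s$-covariant tensor $T_v$ on $\mathrm{T}_{\pi(v)}M$; $\mathfrak{X}(M_A)=\mathcal{T}^1_0(M_A)$, and $\Omega_s(M_A)$ denotes the alternating elements of $\mathcal{T}^0_s(M_A)$. A pseudo-Finsler metric on $A$ is a smooth positively $2$-homogeneous function $L\colon A\to\mathbb{R}$ whose fundamental tensor $g_{ij}=\frac12\dot\partial_i\dot\partial_jL$ (an anisotropic tensor) is nondegenerate at each $v\in A$. Let $C_{ijk}=\frac12\dot\partial_kg_{ij}$ be its Cartan tensor, indices being raised with $g$. The metric nonlinear connection of $L$ is the horizontal subbundle $\mathrm{H}A$ of $\mathrm{T}A$ spanned by $\delta_i=\frac{\delta}{\delta x^i}=\partial_i-N^j_i\dot\partial_j$ with $N^i_j=\gamma^i_{jk}y^k-C^i_{jk}\gamma^k_{ab}y^ay^b$, $\gamma^i_{jk}=\frac12g^{ic}(\partial_kg_{cj}+\partial_jg_{ck}-\partial_cg_{jk})$. The metric (anisotropic) volume form is $d\mathrm{Vol}=\sqrt{|\det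 g_{ab}(x,y)|}\,dx^1\wedge\dots\wedge dx^n\in\Omega_n(M_A)$ in positively oriented coordinates. An $A$-anisotropic connection is an operator $\nabla\colon\mathfrak{X}(M)\times\mathfrak{X}(M)\to\mathfrak{X}(M_A)$ satisfying the usual Koszul derivation properties, with Christoffel symbols $\Gamma^i_{jk}$ (functions of $(x,y)$), $\nabla_{\partial_j}\partial_k=\Gamma^i_{jk}\partial_i$. Its underlying nonlinear connection has coefficients $N^i_j:=\Gamma^i_{jk}y^k$, and its torsion has components $\Gamma^i_{jk}-\Gamma^i_{kj}$. It extends to anisotropic tensors by $\nabla_{k}T^{i_1\dots i_r}_{j_1\dots j_s}=\delta_{k}T^{i_1\dots i_r}_{j_1\dots j_s}+\sum_\mu\Gamma^{i_\mu}_{kl}T^{i_1\dots l\dots i_r}_{j_1\dots j_s}-\sum_\nu\Gamma^l_{kj_\nu}T^{i_1\dots i_r}_{j_1\dots l\dots j_s}$. The (Levi-Civita)--Chern anisotropic connection of $L$ is the one with the Christoffel symbols displayed in the claim ($\delta/\delta x^i$ being those of the metric nonlinear connection). The anisotropic Lie bracket with $Z\in\mathfrak{X}(M_A)$ with respect to $\mathrm{H}A$, $\mathfrak{l}^{\mathrm{H}}_Z$, is the unique tensor derivation of anisotropic tensors ($\mathbb{R}$-linear, type-preserving, Leibniz for tensor products, commuting with contractions) with $\mathfrak{l}^{\mathrm{H}}_Zf=Z^k\delta_kf$ for smooth functions $f$ on $A$ and $\mathfrak{l}^{\mathrm{H}}_ZX=(Z^j\delta_jX^i-X^j\delta_jZ^i)\partial_i$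 for $X\in\mathfrak{X}(M_A)$. The divergence of $Z\in\mathfrak{X}(M_A)$ with respect to $L$ is the function $\mathrm{div}(Z)$ on $A$ defined by $\mathfrak{l}^{\mathrm{H}}_Z(d\mathrm{Vol})=\mathrm{div}(Z)\,d\mathrm{Vol}$, with $\mathrm{H}A$ the metric nonlinear connection. *)

theory Defs
  imports "HOL-Analysis.Analysis"
begin

text \<open>Smooth maps on an open subset of a Euclidean space.\<close>

primrec Ck_on :: "nat \<Rightarrow> 'a::euclidean_space set \<Rightarrow> ('a \<Rightarrow> 'b::real_normed_vector) \<Rightarrow> bool" where
  "Ck_on 0 S f = continuous_on S f"
| "Ck_on (Suc k) S f = ((\<forall>x\<in>S. f differentiable (at x)) \<and>
     (\<forall>u. Ck_on k S (\<lambda>x. frechet_derivative f (at x) u)))"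

definition smooth_on :: "'a::euclidean_space set \<Rightarrow> ('a \<Rightarrow> 'b::real_normed_vector) \<Rightarrow> bool" where
  "smooth_on S f \<longleftrightarrow> (\<forall>k. Ck_on k S f)"


section \<open>Oriented smooth manifolds\<close>

text \<open>
  The manifold is the whole type \<open>'m\<close>; its dimension is \<open>CARD('n)\<close>. A chart is a pair of an open
  domain and a coordinate map. The smooth structure is given by a (not necessarily maximal) smooth
  atlas, and the orientation by a subset of charts which cover the manifold and whose coordinate
  changes have positive Jacobian determinant. The charts in \<open>atlas M\<close> may have either orientation.
\<close>

type_synonym ('m, 'n) chart = "'m set \<times> ('m \<Rightarrow> real^'n)"

abbreviation cdom :: "('m, 'n::finite) chart \<Rightarrow> 'm set" where "cdom \<equiv> fst"
abbreviation cmap :: "('m, 'n::finite) chart \<Rightarrow> 'm \<Rightarrow> real^'n" where "cmap \<equiv> snd"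

definition cinv :: "('m, 'n::finite) chart \<Rightarrow> real^'n \<Rightarrow> 'm" where
  "cinv c = inv_into (cdom c) (cmap c)"

definition transition :: "('m, 'n::finite) chart \<Rightarrow> ('m, 'n) chart \<Rightarrow> real^'n \<Rightarrow> real^'n" where
  "transition c c' = cmap c' \<circ> cinv c"

definition jacobian :: "('m, 'n::finite) chart \<Rightarrow> ('m, 'n) chart \<Rightarrow> 'm \<Rightarrow> real^'n \<Rightarrow> real^'n" where
  "jacobian c c' p = frechet_derivative (transition c c') (at (cmap c p))"

record ('m, 'n) mfd =
  atlas :: "('m, 'n) chart set"
  orientation :: "('m, 'n) chart set"

definition smooth_atlas :: "('m::topological_space, 'n::finite) chart set \<Rightarrow> bool" where
  "smooth_atlas C \<longleftrightarrow>
     (\<Union>c\<in>C. cdom c) = UNIV \<and>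
     (\<forall>c\<in>C. open (cdom c) \<and> open (cmap c ` cdom c) \<and>
        homeomorphism (cdom c) (cmap c ` cdom c) (cmap c) (cinv c)) \<and>
     (\<forall>c\<in>C. \<forall>c'\<in>C. smooth_on (cmap c ` (cdom c \<inter> cdom c')) (transition c c'))"

definition connected_oriented_manifold ::
  "('m::{t2_space,second_countable_topology}, 'n::finite) mfd \<Rightarrow> bool" where
  "connected_oriented_manifold M \<longleftrightarrow>
     smooth_atlas (atlas M) \<and>
     connected (UNIV :: 'm set) \<and>
     orientation M \<subseteq> atlas M \<and>
     (\<Union>c\<in>orientation M. cdom c) = UNIV \<and>
     (\<forall>c\<in>orientation M. \<forall>c'\<in>orientation M. \<forall>p\<in>cdom c \<inter> cdom c'. det (matrix (jacobian c c' p)) > 0)"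

definition charts_at :: "('m, 'n::finite) mfd \<Rightarrow> 'm \<Rightarrow> ('m, 'n) chart set" where
  "charts_at M p = {c \<in> atlas M. p \<in> cdom c}"


section \<open>Tangent bundle, functions and vector fields on the base\<close>

text \<open>
  A tangent vector at \<open>p\<close> is the family of its component vectors in all the charts around \<open>p\<close>,
  which are related by the Jacobians of the coordinate changes. It is \<open>0\<close> at all other charts, so
  that each tangent vector is represented by exactly one function.
\<close>

type_synonym ('m, 'n) tvec = "('m, 'n) chart \<Rightarrow> real^'n"
type_synonym ('m, 'n) covec = "('m, 'n) tvec \<Rightarrow> real"
type_synonym ('m, 'n) tm = "'m \<times> ('m, 'n) tvec"

definition tangent_space :: "('m, 'n::finite) mfd \<Rightarrow> 'm \<Rightarrow> ('m, 'n) tvec set" where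
  "tangent_space M p = {v.
     (\<forall>c\<in>charts_at M p. \<forall>c'\<in>charts_at M p. v c' = jacobian c c' p (v c)) \<and>
     (\<forall>c. c \<notin> charts_at M p \<longrightarrow> v c = 0)}"

definition tcomb :: "real \<Rightarrow> ('m, 'n::finite) tvec \<Rightarrow> real \<Rightarrow> ('m, 'n) tvec \<Rightarrow> ('m, 'n) tvec" where
  "tcomb a v b w = (\<lambda>c. a *\<^sub>R v c + b *\<^sub>R w c)"

text \<open>The cotangent space: linear forms on the tangent space, extended by \<open>0\<close>.\<close>

definition cotangent_space :: "('m, 'n::finite) mfd \<Rightarrow> 'm \<Rightarrow> ('m, 'n) covec set" where
  "cotangent_space M p = {\<omega>.
     (\<forall>v\<in>tangent_space M p. \<forall>w\<in>tangent_space M p. \<forall>a b. \<omega> (tcomb a v b w) = a * \<omega> v + b * \<omega> w) \<and>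
     (\<forall>v. v \<notin> tangent_space M p \<longrightarrow> \<omega> v = 0)}"

text \<open>The tangent vector at \<open>p\<close> whose component vector in the chart \<open>c\<close> is \<open>y\<close>.\<close>

definition tlift :: "('m, 'n::finite) mfd \<Rightarrow> ('m, 'n) chart \<Rightarrow> 'm \<Rightarrow> real^'n \<Rightarrow> ('m, 'n) tvec" where
  "tlift M c p y = (\<lambda>c'. if c' \<in> charts_at M p then jacobian c c' p y else 0)"

definition coord_vec :: "('m, 'n::finite) mfd \<Rightarrow> ('m, 'n) chart \<Rightarrow> 'n \<Rightarrow> 'm \<Rightarrow> ('m, 'n) tvec" where
  "coord_vec M c i p = tlift M c p (axis i 1)"

definition coord_covec :: "('m, 'n::finite) mfd \<Rightarrow> ('m, 'n) chart \<Rightarrow> 'n \<Rightarrow> 'm \<Rightarrow> ('m, 'n) covec" where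
  "coord_covec M c i p = (\<lambda>v. if v \<in> tangent_space M p then v c $ i else 0)"

definition tangent_bundle :: "('m, 'n::finite) mfd \<Rightarrow> ('m, 'n) tm set" where
  "tangent_bundle M = {(p, v). v \<in> tangent_space M p}"

definition smooth_functions :: "('m, 'n::finite) mfd \<Rightarrow> ('m \<Rightarrow> real) set" where
  "smooth_functions M = {f. \<forall>c\<in>atlas M. smooth_on (cmap c ` cdom c) (f \<circ> cinv c)}"

definition vector_fields :: "('m, 'n::finite) mfd \<Rightarrow> ('m \<Rightarrow> ('m, 'n) tvec) set" where
  "vector_fields M = {X. (\<forall>p. X p \<in> tangent_space M p) \<and>
     (\<forall>c\<in>atlas M. smooth_on (cmap c ` cdom c) (\<lambda>x. X (cinv c x) c))}"

definition vf_deriv ::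
  "('m, 'n::finite) mfd \<Rightarrow> ('m \<Rightarrow> ('m, 'n) tvec) \<Rightarrow> ('m \<Rightarrow> real) \<Rightarrow> 'm \<Rightarrow> real" where
  "vf_deriv M X f p = (let c = (SOME c. c \<in> charts_at M p)
     in frechet_derivative (f \<circ> cinv c) (at (cmap c p)) (X p c))"


section \<open>Coordinates on the tangent bundle, anisotropic tensor fields\<close>

text \<open>The coordinates \<open>(x, y)\<close> on the tangent bundle which are induced by a chart, their inverse, and
  the coordinate expression of a function on (a subset of) the tangent bundle.\<close>

definition tcoord :: "('m, 'n::finite) chart \<Rightarrow> ('m, 'n) tm \<Rightarrow> (real^'n) \<times> (real^'n)" where
  "tcoord c v = (cmap c (fst v), snd v c)"

definition tpoint ::
  "('m, 'n::finite) mfd \<Rightarrow> ('m, 'n) chart \<Rightarrow> (real^'n) \<times> (real^'n) \<Rightarrow> ('m, 'n) tm" where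
  "tpoint M c = (\<lambda>(x, y). (cinv c x, tlift M c (cinv c x) y))"

definition tdom ::
  "('m, 'n::finite) chart \<Rightarrow> ('m, 'n) tm set \<Rightarrow> ((real^'n) \<times> (real^'n)) set" where
  "tdom c A = tcoord c ` {v \<in> A. fst v \<in> cdom c}"

definition texpr :: "('m, 'n::finite) mfd \<Rightarrow> ('m, 'n) chart \<Rightarrow> (('m, 'n) tm \<Rightarrow> real)
    \<Rightarrow> (real^'n) \<times> (real^'n) \<Rightarrow> real" where
  "texpr M c f = f \<circ> tpoint M c"

definition conic_domain :: "('m, 'n::finite) mfd \<Rightarrow> ('m, 'n) tm set \<Rightarrow> bool" where
  "conic_domain M A \<longleftrightarrow>
     A \<subseteq> tangent_bundle M - {(p, v). v = (\<lambda>c. 0)} \<and>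
     (\<forall>c\<in>atlas M. open (tdom c A)) \<and>
     fst ` A = UNIV \<and>
     (\<forall>(p, v)\<in>A. \<forall>a>0. (p, \<lambda>c. a *\<^sub>R v c) \<in> A)"

definition aniso_smooth ::
  "('m, 'n::finite) mfd \<Rightarrow> ('m, 'n) tm set \<Rightarrow> (('m, 'n) tm \<Rightarrow> real) \<Rightarrow> bool" where
  "aniso_smooth M A f \<longleftrightarrow> (\<forall>c\<in>atlas M. smooth_on (tdom c A) (texpr M c f))"

text \<open>The coordinate derivatives \<open>\<partial>/\<partial>x\<^sup>k\<close> and \<open>\<partial>/\<partial>y\<^sup>k\<close>.\<close>

definition dx_partial :: "('m, 'n::finite) mfd \<Rightarrow> ('m, 'n) chart \<Rightarrow> 'n
    \<Rightarrow> (('m, 'n) tm \<Rightarrow> real) \<Rightarrow> ('m, 'n) tm \<Rightarrow> real" where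
  "dx_partial M c k f v = frechet_derivative (texpr M c f) (at (tcoord c v)) (axis k 1, 0)"

definition dy_partial :: "('m, 'n::finite) mfd \<Rightarrow> ('m, 'n) chart \<Rightarrow> 'n
    \<Rightarrow> (('m, 'n) tm \<Rightarrow> real) \<Rightarrow> ('m, 'n) tm \<Rightarrow> real" where
  "dy_partial M c k f v = frechet_derivative (texpr M c f) (at (tcoord c v)) (0, axis k 1)"

text \<open>
  A tensor takes a list of covectors and a list of vectors. Values at arguments of the wrong length
  or outside the (co)tangent space are \<open>0\<close>, and tensor fields are \<open>0\<close> outside \<open>A\<close>, so that equality of
  tensor fields is equality of functions.
\<close>

type_synonym ('m, 'n) tensor = "('m, 'n) covec list \<Rightarrow> ('m, 'n) tvec list \<Rightarrow> real"
type_synonym ('m, 'n) tfield = "('m, 'n) tm \<Rightarrow> ('m, 'n) tensor"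

definition targs :: "('m, 'n::finite) mfd \<Rightarrow> 'm \<Rightarrow> nat \<Rightarrow> nat
    \<Rightarrow> (('m, 'n) covec list \<times> ('m, 'n) tvec list) set" where
  "targs M p r s = {(ws, Xs). length ws = r \<and> set ws \<subseteq> cotangent_space M p \<and>
                              length Xs = s \<and> set Xs \<subseteq> tangent_space M p}"

definition tensors_at :: "('m, 'n::finite) mfd \<Rightarrow> 'm \<Rightarrow> nat \<Rightarrow> nat \<Rightarrow> ('m, 'n) tensor set" where
  "tensors_at M p r s = {t.
     (\<forall>ws Xs. (ws, Xs) \<notin> targs M p r s \<longrightarrow> t ws Xs = 0) \<and>
     (\<forall>(ws, Xs)\<in>targs M p r s.
        (\<forall>\<mu><r. \<forall>\<omega>\<in>cotangent_space M p. \<forall>\<eta>\<in>cotangent_space M p. \<forall>a b.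
           t (ws[\<mu> := (\<lambda>u. a * \<omega> u + b * \<eta> u)]) Xs = a * t (ws[\<mu> := \<omega>]) Xs + b * t (ws[\<mu> := \<eta>]) Xs) \<and>
        (\<forall>\<nu><s. \<forall>X\<in>tangent_space M p. \<forall>Y\<in>tangent_space M p. \<forall>a b.
           t ws (Xs[\<nu> := tcomb a X b Y]) = a * t ws (Xs[\<nu> := X]) + b * t ws (Xs[\<nu> := Y])))}"

text \<open>The component of \<open>T\<close> with upper indices \<open>is\<close> and lower indices \<open>js\<close>.\<close>

definition tcomp :: "('m, 'n::finite) mfd \<Rightarrow> ('m, 'n) chart \<Rightarrow> ('m, 'n) tfield
    \<Rightarrow> 'n list \<Rightarrow> 'n list \<Rightarrow> ('m, 'n) tm \<Rightarrow> real" where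
  "tcomp M c T is js v =
     T v (map (\<lambda>i. coord_covec M c i (fst v)) is) (map (\<lambda>j. coord_vec M c j (fst v)) js)"

definition aniso_tensors ::
  "('m, 'n::finite) mfd \<Rightarrow> ('m, 'n) tm set \<Rightarrow> nat \<Rightarrow> nat \<Rightarrow> ('m, 'n) tfield set" where
  "aniso_tensors M A r s = {T.
     (\<forall>v\<in>A. T v \<in> tensors_at M (fst v) r s) \<and>
     (\<forall>v. v \<notin> A \<longrightarrow> T v = (\<lambda>ws Xs. 0)) \<and>
     (\<forall>c\<in>atlas M. \<forall>is js. length is = r \<and> length js = s \<longrightarrow>
        smooth_on (tdom c A) (texpr M c (tcomp M c T is js)))}"

text \<open>Anisotropic vector fields are anisotropic tensor fields of type \<open>(1, 0)\<close>; the following are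
  their components.\<close>

abbreviation aniso_vector_fields ::
  "('m, 'n::finite) mfd \<Rightarrow> ('m, 'n) tm set \<Rightarrow> ('m, 'n) tfield set" where
  "aniso_vector_fields M A \<equiv> aniso_tensors M A 1 0"

abbreviation vcomp :: "('m, 'n::finite) mfd \<Rightarrow> ('m, 'n) chart \<Rightarrow> ('m, 'n) tfield
    \<Rightarrow> 'n \<Rightarrow> ('m, 'n) tm \<Rightarrow> real" where
  "vcomp M c Z i \<equiv> tcomp M c Z [i] []"

definition tens_lin ::
  "real \<Rightarrow> ('m, 'n::finite) tfield \<Rightarrow> real \<Rightarrow> ('m, 'n) tfield \<Rightarrow> ('m, 'n) tfield" where
  "tens_lin a T b S = (\<lambda>v ws Xs. a * T v ws Xs + b * S v ws Xs)"

text \<open>Tensor product with a first factor of type \<open>(r, s)\<close>.\<close>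

definition tens_prod ::
  "nat \<Rightarrow> nat \<Rightarrow> ('m, 'n::finite) tfield \<Rightarrow> ('m, 'n) tfield \<Rightarrow> ('m, 'n) tfield" where
  "tens_prod r s T S =
     (\<lambda>v ws Xs. T v (take r ws) (take s Xs) * S v (drop r ws) (drop s Xs))"

text \<open>Contraction of the contravariant slot \<open>a\<close> with the covariant slot \<open>b\<close> (counted from \<open>0\<close>); it
  does not depend on the chosen chart.\<close>

definition insert_at :: "nat \<Rightarrow> 'a \<Rightarrow> 'a list \<Rightarrow> 'a list" where
  "insert_at a x xs = take a xs @ x # drop a xs"

definition contract ::
  "('m, 'n::finite) mfd \<Rightarrow> nat \<Rightarrow> nat \<Rightarrow> ('m, 'n) tfield \<Rightarrow> ('m, 'n) tfield" where
  "contract M a b T = (\<lambda>v ws Xs. let c = (SOME c. c \<in> charts_at M (fst v)) in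
     \<Sum>i\<in>UNIV. T v (insert_at a (coord_covec M c i (fst v)) ws)
                   (insert_at b (coord_vec M c i (fst v)) Xs))"


section \<open>Pseudo-Finsler metrics\<close>

definition fund_tensor :: "('m, 'n::finite) mfd \<Rightarrow> (('m, 'n) tm \<Rightarrow> real) \<Rightarrow> ('m, 'n) chart
    \<Rightarrow> 'n \<Rightarrow> 'n \<Rightarrow> ('m, 'n) tm \<Rightarrow> real" where
  "fund_tensor M L c i j v = 1/2 * dy_partial M c i (dy_partial M c j L) v"

definition fund_matrix :: "('m, 'n::finite) mfd \<Rightarrow> (('m, 'n) tm \<Rightarrow> real) \<Rightarrow> ('m, 'n) chart
    \<Rightarrow> ('m, 'n) tm \<Rightarrow> real^'n^'n" where
  "fund_matrix M L c v = (\<chi> i j. fund_tensor M L c i j v)"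

definition fund_inv :: "('m, 'n::finite) mfd \<Rightarrow> (('m, 'n) tm \<Rightarrow> real) \<Rightarrow> ('m, 'n) chart
    \<Rightarrow> 'n \<Rightarrow> 'n \<Rightarrow> ('m, 'n) tm \<Rightarrow> real" where
  "fund_inv M L c i j v = matrix_inv (fund_matrix M L c v) $ i $ j"

definition pseudo_Finsler ::
  "('m, 'n::finite) mfd \<Rightarrow> ('m, 'n) tm set \<Rightarrow> (('m, 'n) tm \<Rightarrow> real) \<Rightarrow> bool" where
  "pseudo_Finsler M A L \<longleftrightarrow>
     aniso_smooth M A L \<and>
     (\<forall>(p, v)\<in>A. \<forall>a>0. L (p, \<lambda>c. a *\<^sub>R v c) = a\<^sup>2 * L (p, v)) \<and>
     (\<forall>v\<in>A. \<forall>c\<in>charts_at M (fst v). invertible (fund_matrix M L c v))"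

definition cartan :: "('m, 'n::finite) mfd \<Rightarrow> (('m, 'n) tm \<Rightarrow> real) \<Rightarrow> ('m, 'n) chart
    \<Rightarrow> 'n \<Rightarrow> 'n \<Rightarrow> 'n \<Rightarrow> ('m, 'n) tm \<Rightarrow> real" where
  "cartan M L c i j k v = 1/2 * dy_partial M c k (fund_tensor M L c i j) v"

text \<open>The formal Christoffel symbols \<open>\<gamma>\<^sup>i\<^sub>j\<^sub>k\<close> and the coefficients \<open>N\<^sup>i\<^sub>j\<close> of the metric nonlinear
  connection; upper indices come first.\<close>

definition formal_christoffel :: "('m, 'n::finite) mfd \<Rightarrow> (('m, 'n) tm \<Rightarrow> real) \<Rightarrow> ('m, 'n) chart
    \<Rightarrow> 'n \<Rightarrow> 'n \<Rightarrow> 'n \<Rightarrow> ('m, 'n) tm \<Rightarrow> real" where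
  "formal_christoffel M L c i j k v = 1/2 * (\<Sum>l\<in>UNIV. fund_inv M L c i l v *
     (dx_partial M c k (fund_tensor M L c l j) v + dx_partial M c j (fund_tensor M L c l k) v
      - dx_partial M c l (fund_tensor M L c j k) v))"

type_synonym ('m, 'n) nl_conn = "('m, 'n) chart \<Rightarrow> 'n \<Rightarrow> 'n \<Rightarrow> ('m, 'n) tm \<Rightarrow> real"

definition metric_nl_conn ::
  "('m, 'n::finite) mfd \<Rightarrow> (('m, 'n) tm \<Rightarrow> real) \<Rightarrow> ('m, 'n) nl_conn" where
  "metric_nl_conn M L c i j v =
     (\<Sum>k\<in>UNIV. formal_christoffel M L c i j k v * snd v c $ k)
     - (\<Sum>k\<in>UNIV. (\<Sum>l\<in>UNIV. fund_inv M L c i l v * cartan M L c l j k v) *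
         (\<Sum>a\<in>UNIV. \<Sum>b\<in>UNIV. formal_christoffel M L c k a b v * snd v c $ a * snd v c $ b))"

definition delta :: "('m, 'n::finite) mfd \<Rightarrow> ('m, 'n) nl_conn \<Rightarrow> ('m, 'n) chart \<Rightarrow> 'n
    \<Rightarrow> (('m, 'n) tm \<Rightarrow> real) \<Rightarrow> ('m, 'n) tm \<Rightarrow> real" where
  "delta M N c k f v = dx_partial M c k f v - (\<Sum>j\<in>UNIV. N c j k v * dy_partial M c j f v)"

text \<open>
  The metric volume form \<open>\<surd>|det g| dx\<^sup>1 \<and> \<dots> \<and> dx\<^sup>n\<close> in a positively oriented chart, where the
  coordinates are numbered by the fixed enumeration \<open>to_nat_on UNIV\<close> of the index type \<open>'n\<close>, that is,
  \<open>dx\<^sup>1 \<and> \<dots> \<and> dx\<^sup>n\<close> at the list \<open>X\<^sub>1, \<dots>, X\<^sub>n\<close> is \<open>det (dx\<^sup>i X\<^sub>j)\<close>.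
\<close>

definition vol_form :: "('m, 'n::finite) mfd \<Rightarrow> ('m, 'n) tm set \<Rightarrow> (('m, 'n) tm \<Rightarrow> real)
    \<Rightarrow> ('m, 'n) tfield" where
  "vol_form M A L v ws Xs =
     (if v \<in> A \<and> (ws, Xs) \<in> targs M (fst v) 0 CARD('n) then
        (let c = (SOME c. c \<in> orientation M \<and> fst v \<in> cdom c) in
           sqrt \<bar>det (fund_matrix M L c v)\<bar> *
           det (\<chi> i j. (Xs ! to_nat_on (UNIV :: 'n set) j) c $ i))
      else 0)"


section \<open>Anisotropic connections\<close>

type_synonym ('m, 'n) aconn =
  "('m \<Rightarrow> ('m, 'n) tvec) \<Rightarrow> ('m \<Rightarrow> ('m, 'n) tvec) \<Rightarrow> ('m, 'n) tfield"

definition aniso_connection ::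
  "('m, 'n::finite) mfd \<Rightarrow> ('m, 'n) tm set \<Rightarrow> ('m, 'n) aconn \<Rightarrow> bool" where
  "aniso_connection M A D \<longleftrightarrow>
     (\<forall>X\<in>vector_fields M. \<forall>Y\<in>vector_fields M. D X Y \<in> aniso_vector_fields M A) \<and>
     (\<forall>X\<in>vector_fields M. \<forall>X'\<in>vector_fields M. \<forall>Y\<in>vector_fields M.
        D (\<lambda>p. tcomb 1 (X p) 1 (X' p)) Y = tens_lin 1 (D X Y) 1 (D X' Y)) \<and>
     (\<forall>X\<in>vector_fields M. \<forall>Y\<in>vector_fields M. \<forall>Y'\<in>vector_fields M.
        D X (\<lambda>p. tcomb 1 (Y p) 1 (Y' p)) = tens_lin 1 (D X Y) 1 (D X Y')) \<and>
     (\<forall>f\<in>smooth_functions M. \<forall>X\<in>vector_fields M. \<forall>Y\<in>vector_fields M.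
        \<forall>v\<in>A. \<forall>\<omega>\<in>cotangent_space M (fst v).
        D (\<lambda>p c. f p *\<^sub>R X p c) Y v [\<omega>] [] = f (fst v) * D X Y v [\<omega>] [] \<and>
        D X (\<lambda>p c. f p *\<^sub>R Y p c) v [\<omega>] [] =
          vf_deriv M X f (fst v) * \<omega> (Y (fst v)) + f (fst v) * D X Y v [\<omega>] [])"

text \<open>
  The Christoffel symbol \<open>\<Gamma>\<^sup>i\<^sub>j\<^sub>k\<close> at \<open>v\<close> is the \<open>i\<close>-th component of \<open>\<nabla>\<close> applied to any global vector
  fields which coincide with the \<open>j\<close>-th and \<open>k\<close>-th coordinate fields near the base point of \<open>v\<close>;
  by locality of \<open>\<nabla>\<close> this does not depend on the choice of these extensions.
\<close>

definition christoffel :: "('m::topological_space, 'n::finite) mfd \<Rightarrow> ('m, 'n) aconn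
    \<Rightarrow> ('m, 'n) chart \<Rightarrow> 'n \<Rightarrow> 'n \<Rightarrow> 'n \<Rightarrow> ('m, 'n) tm \<Rightarrow> real" where
  "christoffel M D c i j k v = (THE a. \<forall>X\<in>vector_fields M. \<forall>Y\<in>vector_fields M.
     (\<forall>\<^sub>F p in nhds (fst v). X p = coord_vec M c j p \<and> Y p = coord_vec M c k p) \<longrightarrow>
     vcomp M c (D X Y) i v = a)"

definition underlying_nl_conn ::
  "('m::topological_space, 'n::finite) mfd \<Rightarrow> ('m, 'n) aconn \<Rightarrow> ('m, 'n) nl_conn" where
  "underlying_nl_conn M D c i j v = (\<Sum>k\<in>UNIV. christoffel M D c i j k v * snd v c $ k)"

definition torsion_free ::
  "('m::topological_space, 'n::finite) mfd \<Rightarrow> ('m, 'n) tm set \<Rightarrow> ('m, 'n) aconn \<Rightarrow> bool" where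
  "torsion_free M A D \<longleftrightarrow> (\<forall>v\<in>A. \<forall>c\<in>charts_at M (fst v). \<forall>i j k.
     christoffel M D c i j k v - christoffel M D c i k j v = 0)"

definition same_nl_conn :: "('m, 'n::finite) mfd \<Rightarrow> ('m, 'n) tm set
    \<Rightarrow> ('m, 'n) nl_conn \<Rightarrow> ('m, 'n) nl_conn \<Rightarrow> bool" where
  "same_nl_conn M A N N' \<longleftrightarrow>
     (\<forall>v\<in>A. \<forall>c\<in>charts_at M (fst v). \<forall>i j. N c i j v = N' c i j v)"

text \<open>The component of the covariant derivative \<open>\<nabla>\<^sub>k T\<close> with upper indices \<open>is\<close> and lower indices \<open>js\<close>.\<close>

definition nabla_comp :: "('m::topological_space, 'n::finite) mfd \<Rightarrow> ('m, 'n) aconn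
    \<Rightarrow> ('m, 'n) chart \<Rightarrow> 'n \<Rightarrow> ('m, 'n) tfield \<Rightarrow> 'n list \<Rightarrow> 'n list \<Rightarrow> ('m, 'n) tm \<Rightarrow> real" where
  "nabla_comp M D c k T is js v =
     delta M (underlying_nl_conn M D) c k (tcomp M c T is js) v
     + (\<Sum>\<mu><length is. \<Sum>l\<in>UNIV. christoffel M D c (is ! \<mu>) k l v * tcomp M c T (is[\<mu> := l]) js v)
     - (\<Sum>\<nu><length js. \<Sum>l\<in>UNIV. christoffel M D c l k (js ! \<nu>) v * tcomp M c T is (js[\<nu> := l]) v)"

definition nabla_along_vanishes :: "('m::topological_space, 'n::finite) mfd \<Rightarrow> ('m, 'n) tm set
    \<Rightarrow> ('m, 'n) aconn \<Rightarrow> ('m, 'n) tfield \<Rightarrow> nat \<Rightarrow> nat \<Rightarrow> ('m, 'n) tfield \<Rightarrow> bool" where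
  "nabla_along_vanishes M A D Z r s T \<longleftrightarrow>
     (\<forall>v\<in>A. \<forall>c\<in>charts_at M (fst v). \<forall>is js. length is = r \<and> length js = s \<longrightarrow>
        (\<Sum>k\<in>UNIV. vcomp M c Z k v * nabla_comp M D c k T is js v) = 0)"

definition trace_nabla :: "('m::topological_space, 'n::finite) mfd \<Rightarrow> ('m, 'n) aconn
    \<Rightarrow> ('m, 'n) tfield \<Rightarrow> ('m, 'n) tm \<Rightarrow> real" where
  "trace_nabla M D Z v = (let c = (SOME c. c \<in> charts_at M (fst v)) in
     \<Sum>i\<in>UNIV. nabla_comp M D c i Z [i] [] v)"

definition chern_symbol :: "('m, 'n::finite) mfd \<Rightarrow> (('m, 'n) tm \<Rightarrow> real)
    \<Rightarrow> ('m, 'n) chart \<Rightarrow> 'n \<Rightarrow> 'n \<Rightarrow> 'n \<Rightarrow> ('m, 'n) tm \<Rightarrow> real" where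
  "chern_symbol M L c i j k v = 1/2 * (\<Sum>l\<in>UNIV. fund_inv M L c i l v *
     (delta M (metric_nl_conn M L) c k (fund_tensor M L c l j) v
      + delta M (metric_nl_conn M L) c j (fund_tensor M L c l k) v
      - delta M (metric_nl_conn M L) c l (fund_tensor M L c j k) v))"

definition chern_connection :: "('m::topological_space, 'n::finite) mfd \<Rightarrow> ('m, 'n) tm set
    \<Rightarrow> (('m, 'n) tm \<Rightarrow> real) \<Rightarrow> ('m, 'n) aconn \<Rightarrow> bool" where
  "chern_connection M A L D \<longleftrightarrow> aniso_connection M A D \<and>
     (\<forall>v\<in>A. \<forall>c\<in>charts_at M (fst v). \<forall>i j k. christoffel M D c i j k v = chern_symbol M L c i j k v)"


section \<open>Anisotropic Lie bracket and divergence\<close>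

text \<open>A tensor derivation is a family of operators, indexed by the tensor type \<open>(r, s)\<close>.\<close>

type_synonym ('m, 'n) toper = "nat \<Rightarrow> nat \<Rightarrow> ('m, 'n) tfield \<Rightarrow> ('m, 'n) tfield"

definition tensor_derivation ::
  "('m, 'n::finite) mfd \<Rightarrow> ('m, 'n) tm set \<Rightarrow> ('m, 'n) toper \<Rightarrow> bool" where
  "tensor_derivation M A D \<longleftrightarrow>
     (\<forall>r s. \<forall>T\<in>aniso_tensors M A r s. D r s T \<in> aniso_tensors M A r s) \<and>
     (\<forall>r s a b. \<forall>T\<in>aniso_tensors M A r s. \<forall>S\<in>aniso_tensors M A r s.
        D r s (tens_lin a T b S) = tens_lin a (D r s T) b (D r s S)) \<and>
     (\<forall>r s r' s'. \<forall>T\<in>aniso_tensors M A r s. \<forall>S\<in>aniso_tensors M A r' s'.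
        D (r + r') (s + s') (tens_prod r s T S) =
          tens_lin 1 (tens_prod r s (D r s T) S) 1 (tens_prod r s T (D r' s' S))) \<and>
     (\<forall>r s a b. \<forall>T\<in>aniso_tensors M A (Suc r) (Suc s). a \<le> r \<and> b \<le> s \<longrightarrow>
        D r s (contract M a b T) = contract M a b (D (Suc r) (Suc s) T))"

text \<open>A smooth function on \<open>A\<close> is a tensor field of type \<open>(0, 0)\<close>, with single component
  \<open>tcomp M c f [] []\<close>, which is the same for all \<open>c\<close>.\<close>

definition aniso_lie_bracket :: "('m, 'n::finite) mfd \<Rightarrow> ('m, 'n) tm set \<Rightarrow> ('m, 'n) nl_conn
    \<Rightarrow> ('m, 'n) tfield \<Rightarrow> ('m, 'n) toper \<Rightarrow> bool" where
  "aniso_lie_bracket M A N Z lie \<longleftrightarrow>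
     tensor_derivation M A lie \<and>
     (\<forall>f\<in>aniso_tensors M A 0 0. \<forall>v\<in>A. \<forall>c\<in>charts_at M (fst v).
        tcomp M c (lie 0 0 f) [] [] v =
          (\<Sum>k\<in>UNIV. vcomp M c Z k v * delta M N c k (tcomp M c f [] []) v)) \<and>
     (\<forall>X\<in>aniso_vector_fields M A. \<forall>v\<in>A. \<forall>c\<in>charts_at M (fst v). \<forall>i.
        vcomp M c (lie 1 0 X) i v =
          (\<Sum>j\<in>UNIV. vcomp M c Z j v * delta M N c j (vcomp M c X i) v
                    - vcomp M c X j v * delta M N c j (vcomp M c Z i) v))"

text \<open>The divergence: the factor between the Lie bracket of the metric volume form and the volume form.\<close>

definition divergence :: "('m, 'n::finite) mfd \<Rightarrow> ('m, 'n) tm set \<Rightarrow> (('m, 'n) tm \<Rightarrow> real)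
    \<Rightarrow> ('m, 'n) toper \<Rightarrow> ('m, 'n) tm \<Rightarrow> real" where
  "divergence M A L lie v = (THE a. lie 0 CARD('n) (vol_form M A L) v =
     (\<lambda>ws Xs. a * vol_form M A L v ws Xs))"

end

(*
  In a chart c write F = sqrt |det g| for the density of the volume form; on the tangent vectors
  X_1, ..., X_n the form equals s F det(X_1, ..., X_n), where the sign s = +-1 compares c with the
  orientation and is locally constant. Since the Lie bracket is a tensor derivation, it can be
  evaluated on vector fields which have constant components near the given point (bump functions
  extend them to M). The bracket of such a field with Z has components -(delta_j Z^i) X^j, and the sum
  over k of det(X_1, ..., B X_k, ..., X_n) is tr(B) det(X_1, ..., X_n). Hence
     div(Z) = Z^k (delta_k F) / F + delta_i Z^i.
  In the same way the coefficient of nabla_k dVol is s (delta_k F - F Gamma^i_{ki}), so that the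
  hypothesis on Z and the symmetry of Gamma turn the first summand into Gamma^i_{ik} Z^k. For the Chern symbols
  delta_k F = F Gamma^i_{ki} is Jacobi's formula for the derivative of a determinant, and the
  identity Gamma^i_{jk} y^k = N^i_j follows from C_{ijk} y^k = 0, that is, from homogeneity.
*)

theory Submission
  imports Defs
begin

text \<open>The bracket is not given by a formula on n-forms. It is known on functions and on vector
  fields, together with its product and contraction laws, and these laws speak about smooth tensor
  fields on all of \<open>A\<close>. Hence dVol(X_1, ..., X_n) is built as an iterated contraction
  of tensor products of global fields, through which the derivation is pushed, and dVol itself has
  to be shown smooth in every chart, whatever its orientation. No locality of the bracket is
  derived: on the resulting function and on the extended fields it acts through the
  \<open>delta\<close> operators, which see only values near the point. Both the bracket and nabla
  change the determinant one column at a time, the former by the matrix -(delta_j Z^i), the latter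
  by Gamma^i_{kj} with k fixed, so that a single trace identity serves for both.\<close>

section \<open>Calculus of smooth maps\<close>

text \<open>No differentiability is assumed: \<open>frechet_derivative\<close> is a choice among all
  derivatives, so it suffices that f and g have the same derivatives at x.\<close>

lemma frechet_derivative_cong_open:
  assumes "open S" "x \<in> S" "\<And>y. y \<in> S \<Longrightarrow> f y = g y"
  shows "frechet_derivative f (at x) = frechet_derivative g (at x)"
proof -
  have "(f has_derivative D) (at x) = (g has_derivative D) (at x)" for D
    using has_derivative_transform_within_open[of f D x UNIV S g]
      has_derivative_transform_within_open[of g D x UNIV S f] assms by auto
  then show ?thesis
    by (simp add: frechet_derivative_def)
qed

lemma differentiable_cong_open:
  assumes "open S" "x \<in> S" "\<And>y. y \<in> S \<Longrightarrow> f y = g y"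
  shows "f differentiable (at x) \<longleftrightarrow> g differentiable (at x)"
proof -
  have "(f has_derivative D) (at x) = (g has_derivative D) (at x)" for D
    using has_derivative_transform_within_open[of f D x UNIV S g]
      has_derivative_transform_within_open[of g D x UNIV S f] assms by auto
  then show ?thesis
    by (simp add: differentiable_def)
qed

lemma Ck_on_cong:
  assumes "open S" "\<And>x. x \<in> S \<Longrightarrow> f x = g x"
  shows "Ck_on k S f = Ck_on k S g"
  using assms(2)
proof (induction k arbitrary: f g)
  case 0
  then show ?case by (simp cong: continuous_on_cong)
next
  case (Suc k)
  have "Ck_on k S (\<lambda>x. frechet_derivative f (at x) u) = Ck_on k S (\<lambda>x. frechet_derivative g (at x) u)" for u
    using Suc.prems by (intro Suc.IH fun_cong[OF frechet_derivative_cong_open[OF assms(1)]])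
  moreover have "(\<forall>x\<in>S. f differentiable (at x)) = (\<forall>x\<in>S. g differentiable (at x))"
    using Suc.prems by (intro ball_cong differentiable_cong_open[OF assms(1)]) auto
  ultimately show ?case by simp
qed

lemma smooth_on_cong:
  assumes "open S" "\<And>x. x \<in> S \<Longrightarrow> f x = g x"
  shows "smooth_on S f = smooth_on S g"
  unfolding smooth_on_def using Ck_on_cong[OF assms] by simp

text \<open>Lets an induction on the order work with a derivative in explicit form, without the
  choice inside \<open>frechet_derivative\<close>.\<close>

lemma Ck_on_SucI:
  assumes "open S" "\<And>x. x \<in> S \<Longrightarrow> (f has_derivative D x) (at x)" "\<And>u. Ck_on k S (\<lambda>x. D x u)"
  shows "Ck_on (Suc k) S f"
proof -
  have "D x = frechet_derivative f (at x)" if "x \<in> S" for x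
    using assms(2)[OF that] by (rule frechet_derivative_at)
  then have "Ck_on k S (\<lambda>x. frechet_derivative f (at x) u)" for u
    using assms(3)[of u] Ck_on_cong[OF assms(1), of "\<lambda>x. D x u" "\<lambda>x. frechet_derivative f (at x) u" k] by simp
  then show ?thesis
    using assms(2) by (auto simp: differentiable_def)
qed

lemma Ck_on_SucD:
  assumes "Ck_on (Suc k) S f"
  shows "Ck_on k S f"
  using assms
proof (induction k arbitrary: f)
  case 0
  then show ?case
    by (auto intro!: continuous_at_imp_continuous_on differentiable_imp_continuous_within)
qed auto

lemma Ck_on_subset: "Ck_on k S f \<Longrightarrow> T \<subseteq> S \<Longrightarrow> Ck_on k T f"
  by (induction k arbitrary: f) (auto intro: continuous_on_subset)

lemma smooth_on_subset: "smooth_on S f \<Longrightarrow> T \<subseteq> S \<Longrightarrow> smooth_on T f"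
  unfolding smooth_on_def using Ck_on_subset by blast

lemma Ck_on_local:
  assumes "\<And>x. x \<in> S \<Longrightarrow> \<exists>U. open U \<and> x \<in> U \<and> Ck_on k U f"
  shows "Ck_on k S f"
  using assms
proof (induction k arbitrary: f)
  case 0
  then show ?case
    by (metis Ck_on.simps(1) continuous_at_imp_continuous_on continuous_on_eq_continuous_at)
next
  case (Suc k)
  show ?case
    unfolding Ck_on.simps
  proof (intro conjI ballI allI)
    show "f differentiable at x" if "x \<in> S" for x
      using Suc.prems[OF that] by auto
    show "Ck_on k S (\<lambda>x. frechet_derivative f (at x) u)" for u
      by (rule Suc.IH) (metis Suc.prems Ck_on.simps(2))
  qed
qed

text \<open>Used for functions given by different formulas on different open sets, such as a field
  extended by zero or a form that carries a locally constant sign.\<close>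

lemma smooth_on_local:
  assumes "\<And>x. x \<in> S \<Longrightarrow> \<exists>U. open U \<and> x \<in> U \<and> smooth_on U f"
  shows "smooth_on S f"
  using assms Ck_on_local unfolding smooth_on_def by metis

lemma smooth_on_Suc:
  "smooth_on S f \<longleftrightarrow> (\<forall>x\<in>S. f differentiable (at x)) \<and> (\<forall>u. smooth_on S (\<lambda>x. frechet_derivative f (at x) u))"
  unfolding smooth_on_def by (metis Ck_on.simps(2) Ck_on_SucD)

lemma smooth_on_differentiable: "smooth_on S f \<Longrightarrow> x \<in> S \<Longrightarrow> f differentiable (at x)"
  using smooth_on_Suc by blast

lemma smooth_on_frechet_derivative: "smooth_on S f \<Longrightarrow> smooth_on S (\<lambda>x. frechet_derivative f (at x) u)"
  using smooth_on_Suc by blast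

lemma smooth_on_continuous_on: "smooth_on S f \<Longrightarrow> continuous_on S f"
  unfolding smooth_on_def using Ck_on.simps(1) by blast

lemma Ck_on_const: "Ck_on k S (\<lambda>x. c)"
  by (induction k arbitrary: c) auto

lemma smooth_on_const: "smooth_on S (\<lambda>x. c)"
  by (simp add: smooth_on_def Ck_on_const)

lemma Ck_on_bounded_linear_compose:
  assumes "bounded_linear h" "open S" "Ck_on k S f"
  shows "Ck_on k S (\<lambda>x. h (f x))"
  using assms(3)
proof (induction k arbitrary: f)
  case 0
  then show ?case
    using assms(1) by (auto intro: bounded_linear.continuous_on)
next
  case (Suc k)
  have D: "((\<lambda>x. h (f x)) has_derivative (\<lambda>u. h (frechet_derivative f (at x) u))) (at x)" if "x \<in> S" for x
    using Suc.prems that by (auto intro!: bounded_linear.has_derivative[OF assms(1)]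
        simp: frechet_derivative_works[symmetric])
  have "Ck_on k S (\<lambda>x. h (frechet_derivative f (at x) u))" for u
    using Suc by simp
  then show ?case
    using Ck_on_SucI[OF \<open>open S\<close> D] by blast
qed

lemma smooth_on_bounded_linear_compose:
  "bounded_linear h \<Longrightarrow> open S \<Longrightarrow> smooth_on S f \<Longrightarrow> smooth_on S (\<lambda>x. h (f x))"
  unfolding smooth_on_def using Ck_on_bounded_linear_compose by blast

lemma smooth_on_bounded_linear:
  assumes "bounded_linear h" shows "smooth_on S h"
proof -
  have "frechet_derivative h (at x) = h" for x
    using assms bounded_linear_imp_has_derivative frechet_derivative_at by metis
  then show ?thesis
    unfolding smooth_on_Suc[of S h] using assms
    by (auto simp: smooth_on_const intro: bounded_linear_imp_differentiable)
qed

lemma Ck_on_add: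
  assumes "open S" "Ck_on k S f" "Ck_on k S g"
  shows "Ck_on k S (\<lambda>x. f x + g x)"
  using assms(2,3)
proof (induction k arbitrary: f g)
  case 0
  then show ?case by (auto intro: continuous_on_add)
next
  case (Suc k)
  have D: "((\<lambda>x. f x + g x) has_derivative
      (\<lambda>u. frechet_derivative f (at x) u + frechet_derivative g (at x) u)) (at x)" if "x \<in> S" for x
    using Suc.prems that by (auto intro!: has_derivative_add simp: frechet_derivative_works[symmetric])
  have "Ck_on k S (\<lambda>x. frechet_derivative f (at x) u + frechet_derivative g (at x) u)" for u
    using Suc by simp
  then show ?case
    using Ck_on_SucI[OF \<open>open S\<close> D] by blast
qed

lemma Ck_on_scaleR:
  fixes f :: "'a::euclidean_space \<Rightarrow> real"
  assumes "open S" "Ck_on k S f" "Ck_on k S g"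
  shows "Ck_on k S (\<lambda>x. f x *\<^sub>R g x)"
  using assms(2,3)
proof (induction k arbitrary: f g)
  case 0
  then show ?case by (auto intro: continuous_on_scaleR)
next
  case (Suc k)
  have D: "((\<lambda>x. f x *\<^sub>R g x) has_derivative
      (\<lambda>u. f x *\<^sub>R frechet_derivative g (at x) u + frechet_derivative f (at x) u *\<^sub>R g x)) (at x)" if "x \<in> S" for x
    using Suc.prems that by (auto intro!: has_derivative_scaleR simp: frechet_derivative_works[symmetric])
  have "Ck_on k S (\<lambda>x. f x *\<^sub>R frechet_derivative g (at x) u + frechet_derivative f (at x) u *\<^sub>R g x)" for u
    \<comment> \<open>The product rule contains f and g themselves next to their derivatives, so
      they are lowered from order k + 1 to order k.\<close>
    using Suc.prems Suc.prems[THEN Ck_on_SucD] by (intro Ck_on_add assms Suc.IH) simp_all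
  then show ?case
    using Ck_on_SucI[OF \<open>open S\<close> D] by blast
qed

lemma smooth_on_add: "open S \<Longrightarrow> smooth_on S f \<Longrightarrow> smooth_on S g \<Longrightarrow> smooth_on S (\<lambda>x. f x + g x)"
  by (simp add: smooth_on_def Ck_on_add)

lemma smooth_on_scaleR:
  "open S \<Longrightarrow> smooth_on S f \<Longrightarrow> smooth_on S g \<Longrightarrow> smooth_on S (\<lambda>x. f x *\<^sub>R g x)"
  by (simp add: smooth_on_def Ck_on_scaleR)

lemma smooth_on_mult:
  fixes f g :: "'a::euclidean_space \<Rightarrow> real"
  shows "open S \<Longrightarrow> smooth_on S f \<Longrightarrow> smooth_on S g \<Longrightarrow> smooth_on S (\<lambda>x. f x * g x)"
  using smooth_on_scaleR[of S f g] by simp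

lemma smooth_on_minus:
  "open S \<Longrightarrow> smooth_on S f \<Longrightarrow> smooth_on S (\<lambda>x. - f x)"
  by (rule smooth_on_bounded_linear_compose[OF bounded_linear_minus[OF bounded_linear_ident]])

lemma smooth_on_diff: "open S \<Longrightarrow> smooth_on S f \<Longrightarrow> smooth_on S g \<Longrightarrow> smooth_on S (\<lambda>x. f x - g x)"
  using smooth_on_add[of S f "\<lambda>x. - g x"] smooth_on_minus by auto

lemma smooth_on_sum:
  "open S \<Longrightarrow> (\<And>i. i \<in> I \<Longrightarrow> smooth_on S (f i)) \<Longrightarrow> smooth_on S (\<lambda>x. \<Sum>i\<in>I. f i x)"
  by (induction I rule: infinite_finite_induct) (auto simp: smooth_on_const smooth_on_add)

lemma smooth_on_prod:
  fixes f :: "'i \<Rightarrow> 'a::euclidean_space \<Rightarrow> real"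
  shows "open S \<Longrightarrow> (\<And>i. i \<in> I \<Longrightarrow> smooth_on S (f i)) \<Longrightarrow> smooth_on S (\<lambda>x. \<Prod>i\<in>I. f i x)"
  by (induction I rule: infinite_finite_induct) (auto simp: smooth_on_const smooth_on_mult)

lemma smooth_on_det:
  fixes f :: "'a::euclidean_space \<Rightarrow> real^'n^'n"
  assumes "open S" "\<And>i j. smooth_on S (\<lambda>x. f x $ i $ j)"
  shows "smooth_on S (\<lambda>x. det (f x))"
  unfolding det_def using assms
  by (intro smooth_on_sum smooth_on_mult smooth_on_prod) (auto simp: smooth_on_const)

lemma Ck_on_sum:
  "open S \<Longrightarrow> (\<And>i. i \<in> I \<Longrightarrow> Ck_on k S (f i)) \<Longrightarrow> Ck_on k S (\<lambda>x. \<Sum>i\<in>I. f i x)"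
  by (induction I rule: infinite_finite_induct) (auto simp: Ck_on_const Ck_on_add)

text \<open>The chain rule yields the derivative of g in a direction that moves with x, whereas
  \<open>Ck_on\<close> controls derivatives in fixed directions. Expanding the direction in
  \<open>Basis\<close> turns it into a finite sum of products that the induction covers.\<close>

lemma Ck_on_compose:
  fixes f :: "'a::euclidean_space \<Rightarrow> 'b::euclidean_space"
  assumes "open S" "open T" "f ` S \<subseteq> T" "Ck_on k S f" "Ck_on k T g"
  shows "Ck_on k S (\<lambda>x. g (f x))"
  using assms(3-)
proof (induction k arbitrary: f g)
  case 0
  then show ?case
    using continuous_on_compose2[of T g S f] by auto
next
  case (Suc k)
  let ?f = "\<lambda>x. frechet_derivative f (at x)" and ?g = "\<lambda>x. frechet_derivative g (at x)"
  have D: "((\<lambda>x. g (f x)) has_derivative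
      (\<lambda>u. \<Sum>b\<in>Basis. (?f x u \<bullet> b) *\<^sub>R ?g (f x) b)) (at x)" if "x \<in> S" for x
  proof -
    have f: "(f has_derivative ?f x) (at x)" and g: "(g has_derivative ?g (f x)) (at (f x))"
      using Suc.prems that by (auto simp: frechet_derivative_works[symmetric])
    have "?g (f x) (?f x u) = (\<Sum>b\<in>Basis. (?f x u \<bullet> b) *\<^sub>R ?g (f x) b)" for u
    proof -
      interpret linear "?g (f x)" by (rule has_derivative_linear[OF g])
      have "?g (f x) (?f x u) = ?g (f x) (\<Sum>b\<in>Basis. (?f x u \<bullet> b) *\<^sub>R b)"
        by (subst euclidean_representation) (rule refl)
      then show ?thesis by (simp only: sum scale)
    qed
    then show ?thesis
      using diff_chain_at[OF f g] by (simp add: o_def)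
  qed
  have "Ck_on k S (\<lambda>x. \<Sum>b\<in>Basis. (?f x u \<bullet> b) *\<^sub>R ?g (f x) b)" for u
    using Suc.prems(1,3) Suc.prems(2,3)[THEN Ck_on_SucD] Suc.prems(2) assms(1)
    by (intro Ck_on_sum Ck_on_scaleR Suc.IH Ck_on_bounded_linear_compose[OF bounded_linear_inner_left])
      simp_all
  then show ?case
    using Ck_on_SucI[OF \<open>open S\<close> D] by blast
qed

lemma smooth_on_compose:
  fixes f :: "'a::euclidean_space \<Rightarrow> 'b::euclidean_space"
  shows "open S \<Longrightarrow> open T \<Longrightarrow> f ` S \<subseteq> T \<Longrightarrow> smooth_on S f \<Longrightarrow> smooth_on T g \<Longrightarrow> smooth_on S (\<lambda>x. g (f x))"
  unfolding smooth_on_def using Ck_on_compose by blast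

lemma Ck_on_Suc_real:
  fixes f :: "real \<Rightarrow> real"
  assumes "open S" "\<And>x. x \<in> S \<Longrightarrow> (f has_real_derivative f' x) (at x)" "Ck_on k S f'"
  shows "Ck_on (Suc k) S f"
proof -
  have "Ck_on k S (\<lambda>x. f' x * u)" for u
    using Ck_on_scaleR[OF assms(1,3) Ck_on_const[of k S u]] by simp
  then show ?thesis
    using assms(1,2) by (intro Ck_on_SucI[where D = "\<lambda>x u. f' x * u"]) (auto simp: has_field_derivative_def)
qed

text \<open>The derivative -(1/x)^2 is a polynomial in the function itself, so each order of
  regularity yields the next.\<close>

lemma smooth_on_inverse_real: "smooth_on (- {0::real}) inverse"
  unfolding smooth_on_def
proof
  fix k show "Ck_on k (- {0::real}) inverse"
  proof (induction k)
    case (Suc k)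
    have "Ck_on k (- {0::real}) (\<lambda>x. (-1) *\<^sub>R (inverse x *\<^sub>R inverse x))"
      by (intro Ck_on_scaleR Suc Ck_on_const) auto
    then show ?case
      by (intro Ck_on_Suc_real[where f' = "\<lambda>x. (-1) *\<^sub>R (inverse x *\<^sub>R inverse x)"])
        (auto intro!: derivative_eq_intros)
  qed (auto intro!: continuous_intros)
qed

lemma smooth_on_inverse:
  fixes f :: "'a::euclidean_space \<Rightarrow> real"
  assumes "open S" "smooth_on S f" "\<And>x. x \<in> S \<Longrightarrow> f x \<noteq> 0"
  shows "smooth_on S (\<lambda>x. inverse (f x))"
  by (rule smooth_on_compose[OF assms(1) _ _ assms(2) smooth_on_inverse_real]) (use assms(3) in auto)

lemma smooth_on_sqrt_real: "smooth_on {0<..} sqrt"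
  unfolding smooth_on_def
proof
  fix k show "Ck_on k {0<..} sqrt"
  proof (induction k)
    case (Suc k)
    have "Ck_on k {0<..} (\<lambda>x. inverse (sqrt x))"
      by (rule Ck_on_compose[OF _ _ _ Suc smooth_on_inverse_real[unfolded smooth_on_def, rule_format]]) auto
    then have "Ck_on k {0<..} (\<lambda>x. (1/2) *\<^sub>R inverse (sqrt x))"
      by (intro Ck_on_scaleR Ck_on_const) auto
    then show ?case
      by (intro Ck_on_Suc_real[where f' = "\<lambda>x. (1/2) *\<^sub>R inverse (sqrt x)"])
        (auto intro!: derivative_eq_intros)
  qed (auto intro!: continuous_intros)
qed

text \<open>Writing sqrt |f| as the fourth root of f^2 keeps the arguments of both roots positive
  and avoids a split by the sign of f.\<close>

lemma smooth_on_sqrt_abs: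
  fixes f :: "'a::euclidean_space \<Rightarrow> real"
  assumes "open S" "smooth_on S f" "\<And>x. x \<in> S \<Longrightarrow> f x \<noteq> 0"
  shows "smooth_on S (\<lambda>x. sqrt \<bar>f x\<bar>)"
proof -
  have pos: "0 < f x * f x" if "x \<in> S" for x
    using assms(3)[OF that] not_real_square_gt_zero by blast
  have sq: "smooth_on S (\<lambda>x. sqrt (f x * f x))"
    by (rule smooth_on_compose[OF assms(1) _ _ smooth_on_mult[OF assms(1,2,2)] smooth_on_sqrt_real])
      (use pos in auto)
  have "smooth_on S (\<lambda>x. sqrt (sqrt (f x * f x)))"
    by (rule smooth_on_compose[OF assms(1) _ _ sq smooth_on_sqrt_real]) (use pos assms(3) in auto)
  then show ?thesis
    by simp
qed

section \<open>Second derivatives, determinants and bump functions\<close>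

text \<open>The mean value theorem is applied twice, first along u and then along w. The left side
  is symmetric in u and w while the right side is a mixed derivative in a definite order, which is
  the source of the symmetry of second derivatives.\<close>

lemma second_difference_mean_value:
  fixes f :: "'a::euclidean_space \<Rightarrow> real"
  assumes S: "\<And>s t. 0 \<le> s \<Longrightarrow> s \<le> h \<Longrightarrow> 0 \<le> t \<Longrightarrow> t \<le> h \<Longrightarrow> x + s *\<^sub>R u + t *\<^sub>R w \<in> S"
    and f: "\<And>y. y \<in> S \<Longrightarrow> f differentiable (at y)"
    and f': "\<And>y. y \<in> S \<Longrightarrow> (\<lambda>z. frechet_derivative f (at z) u) differentiable (at y)"
    and h: "0 < h"
  shows "\<exists>s t. 0 \<le> s \<and> s \<le> h \<and> 0 \<le> t \<and> t \<le> h \<and>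
    f (x + h *\<^sub>R u + h *\<^sub>R w) - f (x + h *\<^sub>R u) - f (x + h *\<^sub>R w) + f x =
    h * h * frechet_derivative (\<lambda>z. frechet_derivative f (at z) u) (at (x + s *\<^sub>R u + t *\<^sub>R w)) w"
proof -
  define D where "D y = frechet_derivative f (at y)" for y
  define E where "E y = frechet_derivative (\<lambda>z. D z u) (at y)" for y
  have D: "(f has_derivative D y) (at y)" if "y \<in> S" for y
    using f[OF that] unfolding D_def frechet_derivative_works .
  have E: "((\<lambda>z. D z u) has_derivative E y) (at y)" if "y \<in> S" for y
    using f'[OF that] unfolding D_def[symmetric] E_def frechet_derivative_works .
  \<comment> \<open>The second difference is the increment over [0, h] of the first difference in
    direction w, regarded as a function of the displacement along u.\<close>
  define q where "q s = f (x + s *\<^sub>R u + h *\<^sub>R w) - f (x + s *\<^sub>R u)" for s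
  have q: "(q has_real_derivative (D (x + s *\<^sub>R u + h *\<^sub>R w) u - D (x + s *\<^sub>R u) u)) (at s)"
    if s: "0 \<le> s" "s \<le> h" for s
  proof -
    have 1: "(f has_derivative D (x + s *\<^sub>R u + h *\<^sub>R w)) (at (x + s *\<^sub>R u + h *\<^sub>R w))"
      "(f has_derivative D (x + s *\<^sub>R u)) (at (x + s *\<^sub>R u))"
      using S[OF s, of h] S[OF s, of 0] h by (auto intro: D)
    have 2: "((\<lambda>s. x + s *\<^sub>R u + h *\<^sub>R w) has_derivative (\<lambda>r. r *\<^sub>R u)) (at s)"
      "((\<lambda>s. x + s *\<^sub>R u) has_derivative (\<lambda>r. r *\<^sub>R u)) (at s)"
      by (auto intro!: derivative_eq_intros)
    have "(q has_derivative (\<lambda>r. D (x + s *\<^sub>R u + h *\<^sub>R w) (r *\<^sub>R u) - D (x + s *\<^sub>R u) (r *\<^sub>R u))) (at s)"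
      unfolding q_def
      using has_derivative_diff[OF has_derivative_compose[OF 2(1) 1(1)] has_derivative_compose[OF 2(2) 1(2)]] .
    moreover have "D y (r *\<^sub>R u) = r * D y u" if "y \<in> S" for y r
      using linear_scale[OF has_derivative_linear[OF D[OF that]]] by simp
    ultimately have "(q has_derivative (\<lambda>r. r * D (x + s *\<^sub>R u + h *\<^sub>R w) u - r * D (x + s *\<^sub>R u) u)) (at s)"
      using S[OF s, of h] S[OF s, of 0] h by simp
    moreover have "(\<lambda>r. r * a - r * b) = (*) (a - b)" for a b :: real
      by (simp add: fun_eq_iff algebra_simps)
    ultimately show ?thesis
      by (simp add: has_field_derivative_def)
  qed
  obtain s where s: "0 < s" "s < h" "q h - q 0 = h * (D (x + s *\<^sub>R u + h *\<^sub>R w) u - D (x + s *\<^sub>R u) u)"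
    using MVT2[OF h q] by auto
  define p where "p t = D (x + s *\<^sub>R u + t *\<^sub>R w) u" for t
  have p: "(p has_real_derivative E (x + s *\<^sub>R u + t *\<^sub>R w) w) (at t)" if t: "0 \<le> t" "t \<le> h" for t
  proof -
    have y: "x + s *\<^sub>R u + t *\<^sub>R w \<in> S"
      using S s(1,2) t by simp
    have 2: "((\<lambda>t. x + s *\<^sub>R u + t *\<^sub>R w) has_derivative (\<lambda>r. r *\<^sub>R w)) (at t)"
      by (auto intro!: derivative_eq_intros)
    have "(p has_derivative (\<lambda>r. E (x + s *\<^sub>R u + t *\<^sub>R w) (r *\<^sub>R w))) (at t)"
      unfolding p_def using has_derivative_compose[OF 2 E[OF y]] .
    moreover have "E (x + s *\<^sub>R u + t *\<^sub>R w) (r *\<^sub>R w) = r * E (x + s *\<^sub>R u + t *\<^sub>R w) w" for r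
      using linear_scale[OF has_derivative_linear[OF E[OF y]]] by simp
    moreover have "(\<lambda>r. r * a) = (*) a" for a :: real
      by (simp add: fun_eq_iff mult.commute)
    ultimately show ?thesis
      by (simp add: has_field_derivative_def)
  qed
  obtain t where t: "0 < t" "t < h" "p h - p 0 = h * E (x + s *\<^sub>R u + t *\<^sub>R w) w"
    using MVT2[OF h p] by auto
  have "f (x + h *\<^sub>R u + h *\<^sub>R w) - f (x + h *\<^sub>R u) - f (x + h *\<^sub>R w) + f x = q h - q 0"
    by (simp add: q_def)
  also have "\<dots> = h * h * E (x + s *\<^sub>R u + t *\<^sub>R w) w"
    unfolding s(3) using t(3) by (simp add: p_def)
  finally show ?thesis
    using s t unfolding E_def D_def by (intro exI[of _ s] exI[of _ t]) auto
qed

text \<open>If the mixed derivatives differed at x, continuity would keep each of them, on a small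
  ball, within half the gap of its value at x. But the second difference over a small parallelogram
  is h^2 times either of them at suitable points of that ball.\<close>

lemma frechet_derivative_commute:
  fixes f :: "'a::euclidean_space \<Rightarrow> real"
  assumes S: "open S" "x \<in> S" and f: "smooth_on S f"
  shows "frechet_derivative (\<lambda>z. frechet_derivative f (at z) u) (at x) w =
    frechet_derivative (\<lambda>z. frechet_derivative f (at z) w) (at x) u" (is "?a = ?b")
proof (rule ccontr)
  assume ne: "?a \<noteq> ?b"
  define E where "E u w y = frechet_derivative (\<lambda>z. frechet_derivative f (at z) u) (at y) w" for u w y
  have sm: "smooth_on S (E u w)" for u w
    unfolding E_def by (intro smooth_on_frechet_derivative f)
  then have cont: "isCont (E u w) x" for u w
    using S smooth_on_continuous_on continuous_on_eq_continuous_at by blast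
  define e where "e = \<bar>?a - ?b\<bar> / 2"
  have e: "0 < e" using ne by (simp add: e_def)
  obtain d1 where d1: "0 < d1" "\<And>y. dist y x < d1 \<Longrightarrow> dist (E u w y) (E u w x) < e"
    using cont[of u w] e unfolding continuous_at_eps_delta by (metis dist_norm)
  obtain d2 where d2: "0 < d2" "\<And>y. dist y x < d2 \<Longrightarrow> dist (E w u y) (E w u x) < e"
    using cont[of w u] e unfolding continuous_at_eps_delta by (metis dist_norm)
  obtain d3 where d3: "0 < d3" "\<And>y. dist y x < d3 \<Longrightarrow> y \<in> S"
    using S unfolding open_dist by blast
  define d where "d = min d1 (min d2 d3)"
  \<comment> \<open>The parallelogram spanned by h u and h w then stays within distance d / 2 of x;
    the summand 1 guards against u = w = 0.\<close>
  define h where "h = d / (2 * (norm u + norm w + 1))"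
  have d: "0 < d" using d1 d2 d3 by (simp add: d_def)
  have pos: "0 < norm u + norm w + 1"
    by (simp add: add_nonneg_pos)
  then have h: "0 < h" using d by (simp add: h_def)
  have near: "dist (x + s *\<^sub>R u + t *\<^sub>R w) x < d" if "0 \<le> s" "s \<le> h" "0 \<le> t" "t \<le> h" for s t
  proof -
    have "dist (x + s *\<^sub>R u + t *\<^sub>R w) x = norm (s *\<^sub>R u + t *\<^sub>R w)"
      by (simp add: dist_norm)
    also have "\<dots> \<le> s * norm u + t * norm w"
      using norm_triangle_ineq[of "s *\<^sub>R u" "t *\<^sub>R w"] that by simp
    also have "\<dots> \<le> h * norm u + h * norm w"
      using that by (intro add_mono mult_right_mono) auto
    also have "\<dots> \<le> h * (norm u + norm w + 1)"
      using h by (simp add: algebra_simps)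
    also have "\<dots> = d / 2"
      using pos by (simp add: h_def field_simps)
    also have "\<dots> < d" using d by simp
    finally show ?thesis .
  qed
  have near': "dist (x + s *\<^sub>R w + t *\<^sub>R u) x < d" if "0 \<le> s" "s \<le> h" "0 \<le> t" "t \<le> h" for s t
    using near[of t s] that by (simp add: algebra_simps)
  obtain s t where 1: "0 \<le> s" "s \<le> h" "0 \<le> t" "t \<le> h"
    "f (x + h *\<^sub>R u + h *\<^sub>R w) - f (x + h *\<^sub>R u) - f (x + h *\<^sub>R w) + f x = h * h * E u w (x + s *\<^sub>R u + t *\<^sub>R w)"
    using second_difference_mean_value[of h x u w S f] near d3 h f
    by (auto simp: d_def E_def intro: smooth_on_differentiable smooth_on_frechet_derivative)
  obtain s' t' where 2: "0 \<le> s'" "s' \<le> h" "0 \<le> t'" "t' \<le> h"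
    "f (x + h *\<^sub>R w + h *\<^sub>R u) - f (x + h *\<^sub>R w) - f (x + h *\<^sub>R u) + f x = h * h * E w u (x + s' *\<^sub>R w + t' *\<^sub>R u)"
    using second_difference_mean_value[of h x w u S f] near' d3 h f
    by (auto simp: d_def E_def intro: smooth_on_differentiable smooth_on_frechet_derivative)
  have "h * h * E u w (x + s *\<^sub>R u + t *\<^sub>R w) = h * h * E w u (x + s' *\<^sub>R w + t' *\<^sub>R u)"
    using 1(5) 2(5) by (simp add: algebra_simps)
  then have "E u w (x + s *\<^sub>R u + t *\<^sub>R w) = E w u (x + s' *\<^sub>R w + t' *\<^sub>R u)"
    using h by simp
  moreover have "dist (E u w (x + s *\<^sub>R u + t *\<^sub>R w)) ?a < e"
    using d1(2)[OF less_le_trans[OF near[OF 1(1-4)]]] by (simp add: E_def d_def)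
  moreover have "dist (E w u (x + s' *\<^sub>R w + t' *\<^sub>R u)) ?b < e"
    using d2(2)[OF less_le_trans[OF near'[OF 2(1-4)]]] by (simp add: E_def d_def)
  ultimately have "\<bar>?a - ?b\<bar> < e + e"
    by (simp add: dist_real_def)
  then show False by (simp add: e_def)
qed

section \<open>Determinants: replacing columns, and Jacobi's formula\<close>

definition replace_col :: "real^'n^'n \<Rightarrow> 'n \<Rightarrow> (real^'n) \<Rightarrow> real^'n^'n" where
  "replace_col A k w = (\<chi> i j. if j = k then w $ i else A $ i $ j)"

text \<open>The Leibniz expansion is taken of the transpose, with the product running over columns:
  then w enters each summand through exactly one factor, and linearity in w is visible.\<close>

lemma det_replace_col:
  "det (replace_col A k w) =
    (\<Sum>p | p permutes (UNIV :: 'n::finite set). of_int (sign p) * (w $ p k * (\<Prod>j\<in>UNIV - {k}. A $ p j $ j)))"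
proof -
  have "det (replace_col A k w) = (\<Sum>p | p permutes UNIV. of_int (sign p) * (\<Prod>j\<in>UNIV. replace_col A k w $ p j $ j))"
    using det_transpose[of "replace_col A k w"] by (simp add: det_def transpose_def)
  also have "\<dots> = (\<Sum>p | p permutes UNIV. of_int (sign p) * (w $ p k * (\<Prod>j\<in>UNIV - {k}. A $ p j $ j)))"
  proof (rule sum.cong[OF refl])
    fix p :: "'n \<Rightarrow> 'n"
    have "(\<Prod>j\<in>UNIV. replace_col A k w $ p j $ j) = w $ p k * (\<Prod>j\<in>UNIV - {k}. replace_col A k w $ p j $ j)"
      by (subst prod.remove[of _ k]) (auto simp: replace_col_def)
    also have "(\<Prod>j\<in>UNIV - {k}. replace_col A k w $ p j $ j) = (\<Prod>j\<in>UNIV - {k}. A $ p j $ j)"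
      by (rule prod.cong) (auto simp: replace_col_def)
    finally show "of_int (sign p) * (\<Prod>j\<in>UNIV. replace_col A k w $ p j $ j) =
        of_int (sign p) * (w $ p k * (\<Prod>j\<in>UNIV - {k}. A $ p j $ j))" by simp
  qed
  finally show ?thesis .
qed

lemma linear_det_replace_col: "linear (\<lambda>w. det (replace_col A k w))"
  by (rule linearI) (simp_all add: det_replace_col algebra_simps sum.distrib sum_distrib_left)

text \<open>The product rule in the Leibniz expansion differentiates one column at a time;
  exchanging the sums over permutations and columns collects each column into a determinant.\<close>

lemma has_derivative_det:
  fixes f :: "'a::real_normed_vector \<Rightarrow> real^'n^'n"
  assumes f: "\<And>i j. ((\<lambda>x. f x $ i $ j) has_derivative (\<lambda>u. f' u $ i $ j)) (at x)"
  shows "((\<lambda>x. det (f x)) has_derivative (\<lambda>u. \<Sum>k\<in>UNIV. det (replace_col (f x) k (column k (f' u))))) (at x)"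
proof -
  let ?P = "{p. p permutes (UNIV :: 'n set)}"
  have t: "det A = (\<Sum>p\<in>?P. of_int (sign p) * (\<Prod>j\<in>UNIV. A $ p j $ j))" for A :: "real^'n^'n"
    using det_transpose[of A] by (simp add: det_def transpose_def)
  have "((\<lambda>x. det (f x)) has_derivative
     (\<lambda>u. \<Sum>p\<in>?P. of_int (sign p) * (\<Sum>k\<in>UNIV. f' u $ p k $ k * (\<Prod>j\<in>UNIV - {k}. f x $ p j $ j)))) (at x)"
    unfolding t by (intro has_derivative_sum has_derivative_mult_right has_derivative_prod f)
  also have "(\<lambda>u. \<Sum>p\<in>?P. of_int (sign p) * (\<Sum>k\<in>UNIV. f' u $ p k $ k * (\<Prod>j\<in>UNIV - {k}. f x $ p j $ j)))
    = (\<lambda>u. \<Sum>k\<in>UNIV. det (replace_col (f x) k (column k (f' u))))"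
  proof
    fix u
    have "det (replace_col (f x) k (column k (f' u))) =
       (\<Sum>p\<in>?P. of_int (sign p) * (f' u $ p k $ k * (\<Prod>j\<in>UNIV - {k}. f x $ p j $ j)))" for k
      by (simp add: det_replace_col column_def)
    then have "(\<Sum>k\<in>UNIV. det (replace_col (f x) k (column k (f' u)))) =
      (\<Sum>k\<in>UNIV. \<Sum>p\<in>?P. of_int (sign p) * (f' u $ p k $ k * (\<Prod>j\<in>UNIV - {k}. f x $ p j $ j)))"
      by simp
    also have "\<dots> = (\<Sum>p\<in>?P. \<Sum>k\<in>UNIV. of_int (sign p) * (f' u $ p k $ k * (\<Prod>j\<in>UNIV - {k}. f x $ p j $ j)))"
      by (rule sum.swap)
    finally show "(\<Sum>p\<in>?P. of_int (sign p) * (\<Sum>k\<in>UNIV. f' u $ p k $ k * (\<Prod>j\<in>UNIV - {k}. f x $ p j $ j))) =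
      (\<Sum>k\<in>UNIV. det (replace_col (f x) k (column k (f' u))))"
      by (simp add: sum_distrib_left)
  qed
  finally show ?thesis .
qed

lemma column_matrix_mult:
  fixes A B :: "real^'n^'n"
  shows "column k (B ** A) = B *v column k A"
  by (simp add: vec_eq_iff column_def matrix_matrix_mult_def matrix_vector_mult_def)

text \<open>Both sides are the derivative of \<open>det ((1 + t B) A) = det (1 + t B) det A\<close> at \<open>t = 0\<close>.\<close>

lemma sum_det_replace_col:
  fixes A B :: "real^'n^'n"
  shows "(\<Sum>k\<in>UNIV. det (replace_col A k (B *v column k A))) = trace B * det A"
proof -
  have d: "((\<lambda>t. det (C + t *\<^sub>R D)) has_derivative
      (\<lambda>u. \<Sum>k\<in>UNIV. det (replace_col C k (column k (u *\<^sub>R D))))) (at 0)" for C D :: "real^'n^'n"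
  proof -
    have "((\<lambda>t. (C + t *\<^sub>R D) $ i $ j) has_derivative (\<lambda>u. (u *\<^sub>R D) $ i $ j)) (at 0)" for i j
      by (auto intro!: derivative_eq_intros)
    from has_derivative_det[OF this] show ?thesis by simp
  qed
  have "det (A + t *\<^sub>R (B ** A)) = det (mat 1 + t *\<^sub>R B) * det A" for t
  proof -
    have "(mat 1 + t *\<^sub>R B) ** A = A + t *\<^sub>R (B ** A)"
      by (simp add: vec_eq_iff matrix_matrix_mult_def mat_def distrib_right sum.distrib sum_distrib_left
          mult.assoc if_distrib[of "\<lambda>x. x * _"] cong: if_cong)
    then show ?thesis
      by (metis det_mul)
  qed
  then have "((\<lambda>t. det (A + t *\<^sub>R (B ** A))) has_derivative
      (\<lambda>u. (\<Sum>k\<in>UNIV. det (replace_col (mat 1) k (column k (u *\<^sub>R B)))) * det A)) (at 0)"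
    using has_derivative_mult_left[OF d[of "mat 1" B], of "det A"] by simp
  from has_derivative_unique[OF this d]
  have "(\<Sum>k\<in>UNIV. det (replace_col (mat 1) k (column k B))) * det A =
    (\<Sum>k\<in>UNIV. det (replace_col A k (column k (B ** A))))"
    by (auto dest: fun_cong[of _ _ 1])
  \<comment> \<open>Cramer's rule for the identity matrix, where the solution is the column itself;
    the sum over k then becomes the trace.\<close>
  moreover have "det (replace_col (mat 1) k (column k B)) = B $ k $ k" for k
    using cramer_lemma[of k "mat 1" "column k B"]
    unfolding matrix_vector_mul_lid replace_col_def by (simp add: column_def)
  ultimately show ?thesis
    by (simp add: trace_def column_matrix_mult)
qed

lemma invertible_matrix_inv:
  assumes "invertible A"
  shows "A ** matrix_inv A = mat 1" "matrix_inv A ** A = mat 1"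
  using someI_ex[OF assms[unfolded invertible_def]] by (simp_all add: matrix_inv_def)

text \<open>Since f x is invertible, f' u factors as (f' u (f x)^-1) f x. Its columns are thus one
  matrix applied to the columns of f x, which is the form required by
  \<open>sum_det_replace_col\<close>.\<close>

lemma has_derivative_det_trace:
  fixes f :: "'a::real_normed_vector \<Rightarrow> real^'n^'n"
  assumes f: "\<And>i j. ((\<lambda>x. f x $ i $ j) has_derivative (\<lambda>u. f' u $ i $ j)) (at x)"
    and inv: "invertible (f x)"
  shows "((\<lambda>x. det (f x)) has_derivative (\<lambda>u. trace (f' u ** matrix_inv (f x)) * det (f x))) (at x)"
proof -
  have "(\<Sum>k\<in>UNIV. det (replace_col (f x) k (column k (f' u)))) = trace (f' u ** matrix_inv (f x)) * det (f x)" for u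
  proof -
    have "f' u = (f' u ** matrix_inv (f x)) ** f x"
      using inv by (simp add: matrix_mul_assoc[symmetric] invertible_matrix_inv)
    then have "column k (f' u) = (f' u ** matrix_inv (f x)) *v column k (f x)" for k
      by (metis column_matrix_mult)
    then show ?thesis
      by (simp add: sum_det_replace_col)
  qed
  then show ?thesis
    using has_derivative_det[OF f] by simp
qed

text \<open>The square root halves the logarithmic derivative of the determinant d, and the sign
  cancels because the product of sgn d and d is |d|; one formula therefore serves metrics of every
  signature.\<close>

lemma has_derivative_sqrt_abs_det:
  fixes f :: "'a::real_normed_vector \<Rightarrow> real^'n^'n"
  assumes f: "\<And>i j. ((\<lambda>x. f x $ i $ j) has_derivative (\<lambda>u. f' u $ i $ j)) (at x)"
    and inv: "invertible (f x)"
  shows "((\<lambda>x. sqrt \<bar>det (f x)\<bar>) has_derivative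
    (\<lambda>u. trace (f' u ** matrix_inv (f x)) / 2 * sqrt \<bar>det (f x)\<bar>)) (at x)"
proof -
  have nz: "det (f x) \<noteq> 0"
    using inv invertible_det_nz by blast
  have "((\<lambda>d::real. sqrt \<bar>d\<bar>) has_real_derivative (sgn (det (f x)) * inverse (sqrt \<bar>det (f x)\<bar>) / 2)) (at (det (f x)))"
  proof -
    have "(abs has_real_derivative sgn (det (f x))) (at (det (f x)))"
      using has_derivative_norm[OF nz]
      by (simp add: has_field_derivative_def inner_real_def real_norm_def[abs_def] mult.commute[of _ "sgn _"])
    then show ?thesis
      using nz by (auto intro!: derivative_eq_intros simp: field_simps)
  qed
  then have "((\<lambda>x. sqrt \<bar>det (f x)\<bar>) has_derivative
    (\<lambda>u. (sgn (det (f x)) * inverse (sqrt \<bar>det (f x)\<bar>) / 2) * (trace (f' u ** matrix_inv (f x)) * det (f x)))) (at x)"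
    using has_derivative_compose[OF has_derivative_det_trace[OF f inv]] unfolding has_field_derivative_def by blast
  moreover have eq: "(sgn d * inverse (sqrt \<bar>d\<bar>) / 2) * (c * d) = c / 2 * sqrt \<bar>d\<bar>" if "d \<noteq> 0" for c d :: real
  proof -
    have "sgn d * d = sqrt \<bar>d\<bar> * sqrt \<bar>d\<bar>"
      by (auto simp: sgn_if)
    moreover have "(sgn d * inverse (sqrt \<bar>d\<bar>) / 2) * (c * d) = c / 2 * (inverse (sqrt \<bar>d\<bar>) * (sgn d * d))"
      by (simp add: mult_ac)
    moreover have "inverse (sqrt \<bar>d\<bar>) * (sqrt \<bar>d\<bar> * sqrt \<bar>d\<bar>) = sqrt \<bar>d\<bar>"
      using that by (simp add: mult.assoc[symmetric] del: real_sqrt_mult_self)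
    ultimately show ?thesis
      by metis
  qed
  ultimately show ?thesis
    by (simp only: eq[OF nz])
qed

section \<open>A flat function on the line, and smooth bump functions\<close>

definition flat :: "nat \<Rightarrow> real \<Rightarrow> real" where
  "flat n x = (if 0 < x then inverse x ^ n * exp (- inverse x) else 0)"

text \<open>A single term of the exponential series, that of order n + 2, is below exp (1/x), so
  x^-(n+2) exp (-1/x) is at most (n+2)!. Two powers are split off so that the bound still tends to 0
  after division by x.\<close>

lemma abs_flat_le: "\<bar>flat n x\<bar> \<le> fact (n + 2) * x\<^sup>2"
proof (cases "0 < x")
  case True
  have le: "inverse x ^ (n + 2) / fact (n + 2) \<le> exp (inverse x)"
  proof -
    have "(\<lambda>k. inverse x ^ k /\<^sub>R fact k) sums exp (inverse x)"
      by (rule exp_converges)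
    then have "sum (\<lambda>k. inverse x ^ k /\<^sub>R fact k) {n + 2} \<le> exp (inverse x)"
      using True by (intro sum_le_suminf[of "\<lambda>k. inverse x ^ k /\<^sub>R fact k", THEN order_trans])
        (auto simp: sums_iff)
    then show ?thesis
      by (simp add: divide_inverse mult.commute)
  qed
  have "flat n x = inverse x ^ (n + 2) * x\<^sup>2 / exp (inverse x)"
    using True by (simp add: flat_def exp_minus field_simps power_add power2_eq_square)
  also have "\<dots> \<le> fact (n + 2) * x\<^sup>2"
  proof -
    have "inverse x ^ (n + 2) / exp (inverse x) \<le> fact (n + 2)"
      using le by (simp only: pos_divide_le_eq[OF fact_gt_zero] pos_divide_le_eq[OF exp_gt_zero] mult.commute)
    from mult_right_mono[OF this, of "x\<^sup>2"] show ?thesis by simp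
  qed
  finally show ?thesis
    using True by (simp add: flat_def)
qed (simp add: flat_def)

text \<open>The powers of 1/x belong to \<open>flat\<close> in order to make the family closed under
  differentiation; smoothness of all members then follows by one induction on the order, for all n
  at once. At 0 the quadratic bound forces the difference quotient to 0.\<close>

lemma DERIV_flat: "(flat n has_real_derivative flat (n + 2) x - real n * flat (n + 1) x) (at x)"
proof -
  consider "0 < x" | "x < 0" | "x = 0" by linarith
  then show ?thesis
  proof cases
    case 1
    have "((\<lambda>x. inverse x ^ n * exp (- inverse x)) has_real_derivative
      flat (n + 2) x - real n * flat (n + 1) x) (at x)"
    proof -
      have n: "real n * inverse x ^ (n - Suc 0) * inverse x = real n * inverse x ^ n"
        by (cases n) auto
      have "((\<lambda>x. inverse x ^ n) has_real_derivative - (real n * inverse x ^ (n - Suc 0) * inverse x) * inverse x) (at x)"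
        using 1 by (auto intro!: derivative_eq_intros)
      then have d: "((\<lambda>x. inverse x ^ n) has_real_derivative - real n * inverse x ^ (n + 1)) (at x)"
        unfolding n by (simp add: mult_ac)
      have "((\<lambda>x. exp (- inverse x)) has_real_derivative inverse x ^ 2 * exp (- inverse x)) (at x)"
        using 1 by (auto intro!: derivative_eq_intros simp: power2_eq_square)
      from DERIV_mult[OF d this] show ?thesis
        using 1 by (simp add: flat_def algebra_simps power2_eq_square)
    qed
    then show ?thesis
      by (rule has_field_derivative_transform_within_open[where S = "{0<..}"]) (use 1 in \<open>auto simp: flat_def\<close>)
  next
    case 2
    have "((\<lambda>x. 0) has_real_derivative flat (n + 2) x - real n * flat (n + 1) x) (at x)"
      using 2 by (simp add: flat_def)
    then show ?thesis
      by (rule has_field_derivative_transform_within_open[where S = "{..<0}"]) (use 2 in \<open>auto simp: flat_def\<close>)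
  next
    case 3
    have "((\<lambda>h. flat n h / h) \<longlongrightarrow> 0) (at 0)"
    proof (rule Lim_null_comparison)
      show "\<forall>\<^sub>F h in at 0. norm (flat n h / h) \<le> fact (n + 2) * \<bar>h\<bar>"
        using abs_flat_le[of n]
        by (intro eventuallyI) (simp add: abs_divide divide_le_eq power2_eq_square mult.assoc split: if_splits)
      show "((\<lambda>h::real. fact (n + 2) * \<bar>h\<bar>) \<longlongrightarrow> 0) (at 0)"
        by (auto intro!: tendsto_eq_intros)
    qed
    then show ?thesis
      using 3 by (simp add: DERIV_def flat_def)
  qed
qed

lemma smooth_on_flat: "smooth_on UNIV (flat n)"
  unfolding smooth_on_def
proof
  fix k show "Ck_on k UNIV (flat n)"
  proof (induction k arbitrary: n)
    case 0
    show ?case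
      using DERIV_flat by (auto intro!: DERIV_isCont continuous_at_imp_continuous_on)
  next
    case (Suc k)
    have "Ck_on k UNIV (\<lambda>x. flat (n + 2) x + (- real n) *\<^sub>R flat (n + 1) x)"
      by (intro Ck_on_add Ck_on_scaleR Ck_on_const Suc open_UNIV)
    then show ?case
      using DERIV_flat by (intro Ck_on_Suc_real) auto
  qed
qed

text \<open>The function is p1 / (p1 + p2), where p1 vanishes from radius r on and p2 vanishes up to
  radius r / 2; their regions of positivity cover the space, so the denominator is positive. A
  compact K is asked for because its image in a Hausdorff manifold is closed, as an extension by
  zero requires.\<close>

lemma smooth_bump_exists:
  fixes a :: "'a::euclidean_space"
  assumes "open U" "a \<in> U"
  obtains \<beta> :: "'a \<Rightarrow> real" and K V where "smooth_on UNIV \<beta>" "compact K" "K \<subseteq> U" "\<And>x. x \<notin> K \<Longrightarrow> \<beta> x = 0"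
    "open V" "a \<in> V" "\<And>x. x \<in> V \<Longrightarrow> \<beta> x = 1"
proof -
  obtain r where r: "0 < r" "cball a r \<subseteq> U"
    using assms open_contains_cball by blast
  define q where "q x = (x - a) \<bullet> (x - a)" for x
  define p1 p2 where "p1 x = flat 0 (r\<^sup>2 - q x)" and "p2 x = flat 0 (q x - r\<^sup>2 / 4)" for x
  have coord: "smooth_on UNIV (\<lambda>x. (x - a) \<bullet> b)" for b
    using smooth_on_diff[OF open_UNIV smooth_on_bounded_linear[OF bounded_linear_inner_left] smooth_on_const, of b "a \<bullet> b"]
    by (simp add: inner_diff_left)
  have q: "smooth_on UNIV q"
    unfolding q_def euclidean_inner[of "x - a" "x - a" for x]
    by (intro smooth_on_sum smooth_on_mult coord open_UNIV)
  have p1: "smooth_on UNIV p1" and p2: "smooth_on UNIV p2"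
    unfolding p1_def p2_def
    by (rule smooth_on_compose[OF open_UNIV open_UNIV subset_UNIV _ smooth_on_flat];
        intro smooth_on_diff smooth_on_const q open_UNIV)+
  have nonneg: "0 \<le> flat 0 t" and pos: "0 < flat 0 t \<longleftrightarrow> 0 < t" for t
    by (auto simp: flat_def)
  have sum_pos: "0 < p1 x + p2 x" for x
  proof -
    have "0 < r\<^sup>2" using r by simp
    then have "0 < r\<^sup>2 - q x \<or> 0 < q x - r\<^sup>2 / 4" by linarith
    then show ?thesis
      unfolding p1_def p2_def using nonneg pos by (meson add_nonneg_pos add_pos_nonneg)
  qed
  define \<beta> where "\<beta> x = p1 x * inverse (p1 x + p2 x)" for x
  have norm: "q x = (dist x a)\<^sup>2" for x
    by (simp add: q_def dist_norm dot_square_norm)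
  show thesis
  proof
    show "smooth_on UNIV \<beta>"
      unfolding \<beta>_def using sum_pos
      by (intro smooth_on_mult smooth_on_inverse smooth_on_add p1 p2 open_UNIV) (metis less_irrefl)
    show "compact (cball a r)" "cball a r \<subseteq> U"
      using r by auto
    show "\<beta> x = 0" if "x \<notin> cball a r" for x
    proof -
      have "r\<^sup>2 < q x"
        using that r by (simp add: norm dist_commute power_strict_mono)
      then show ?thesis
        by (simp add: \<beta>_def p1_def flat_def)
    qed
    show "open (ball a (r / 2))" "a \<in> ball a (r / 2)"
      using r by auto
    show "\<beta> x = 1" if "x \<in> ball a (r / 2)" for x
    proof -
      have "q x < (r / 2)\<^sup>2"
        using that r by (simp add: norm dist_commute power_strict_mono)
      then have "p2 x = 0"
        by (simp add: p2_def flat_def power_divide)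
      then show ?thesis
        using sum_pos[of x] by (simp add: \<beta>_def)
    qed
  qed
qed

section \<open>Charts and tangent vectors\<close>

locale oriented_manifold =
  fixes M :: "('m::{t2_space,second_countable_topology}, 'n::finite) mfd"
  assumes manifold: "connected_oriented_manifold M"
begin

lemma in_charts_at: "c \<in> charts_at M p \<longleftrightarrow> c \<in> atlas M \<and> p \<in> cdom c"
  by (simp add: charts_at_def)

lemma charts_at_nonempty: "\<exists>c. c \<in> charts_at M p"
proof -
  have "p \<in> (\<Union>c\<in>atlas M. cdom c)"
    using manifold unfolding connected_oriented_manifold_def smooth_atlas_def by auto
  then show ?thesis
    by (auto simp: in_charts_at)
qed

lemma some_chart: "(SOME c. c \<in> charts_at M p) \<in> charts_at M p"
  by (rule someI_ex[OF charts_at_nonempty])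

lemma oriented_chart_exists: "\<exists>c. c \<in> orientation M \<and> p \<in> cdom c"
proof -
  have "p \<in> (\<Union>c\<in>orientation M. cdom c)"
    using manifold unfolding connected_oriented_manifold_def by auto
  then show ?thesis
    by auto
qed

lemma orientation_atlas: "c \<in> orientation M \<Longrightarrow> c \<in> atlas M"
  using manifold unfolding connected_oriented_manifold_def by auto

lemma jacobian_orientation:
  "c \<in> orientation M \<Longrightarrow> c' \<in> orientation M \<Longrightarrow> p \<in> cdom c \<Longrightarrow> p \<in> cdom c' \<Longrightarrow> 0 < det (matrix (jacobian c c' p))"
  using manifold unfolding connected_oriented_manifold_def by auto

lemma
  assumes "c \<in> atlas M"
  shows open_cdom: "open (cdom c)" and open_cmap: "open (cmap c ` cdom c)"
    and chart_homeomorphism: "homeomorphism (cdom c) (cmap c ` cdom c) (cmap c) (cinv c)"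
  using manifold assms unfolding connected_oriented_manifold_def smooth_atlas_def by auto

lemma transition_smooth:
  "c \<in> atlas M \<Longrightarrow> c' \<in> atlas M \<Longrightarrow> smooth_on (cmap c ` (cdom c \<inter> cdom c')) (transition c c')"
  using manifold unfolding connected_oriented_manifold_def smooth_atlas_def by auto

lemma cinv_cmap: "c \<in> atlas M \<Longrightarrow> p \<in> cdom c \<Longrightarrow> cinv c (cmap c p) = p"
  using chart_homeomorphism homeomorphism_apply1 by blast

lemma cinv_cdom: "c \<in> atlas M \<Longrightarrow> x \<in> cmap c ` cdom c \<Longrightarrow> cinv c x \<in> cdom c"
  by (auto simp: cinv_cmap)

lemma open_overlap:
  assumes "c \<in> atlas M" "open U"
  shows "open (cmap c ` (cdom c \<inter> U))"
proof -
  have "openin (top_of_set (cdom c)) (cdom c \<inter> U)"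
    using assms(2) by (rule openin_open_Int)
  then have "openin (top_of_set (cmap c ` cdom c)) (cmap c ` (cdom c \<inter> U))"
    by (rule homeomorphism_imp_open_map[OF chart_homeomorphism[OF assms(1)]])
  then show ?thesis
    by (rule openin_open_trans[OF _ open_cmap[OF assms(1)]])
qed

lemma transition_cmap: "c \<in> atlas M \<Longrightarrow> p \<in> cdom c \<Longrightarrow> transition c c' (cmap c p) = cmap c' p"
  by (simp add: transition_def cinv_cmap)

lemma transition_has_derivative:
  assumes "c \<in> charts_at M p" "c' \<in> charts_at M p"
  shows "(transition c c' has_derivative jacobian c c' p) (at (cmap c p))"
  unfolding jacobian_def frechet_derivative_works[symmetric]
  by (rule smooth_on_differentiable[OF transition_smooth]) (use assms in \<open>auto simp: in_charts_at\<close>)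

lemma jacobian_linear:
  assumes "c \<in> charts_at M p" "c' \<in> charts_at M p"
  shows "linear (jacobian c c' p)"
  by (rule has_derivative_linear[OF transition_has_derivative[OF assms]])

lemma jacobian_self:
  assumes "c \<in> charts_at M p"
  shows "jacobian c c p y = y"
proof -
  have c: "c \<in> atlas M" "p \<in> cdom c"
    using assms by (auto simp: in_charts_at)
  have "frechet_derivative (transition c c) (at (cmap c p)) = frechet_derivative (\<lambda>x. x) (at (cmap c p))"
    by (rule frechet_derivative_cong_open[OF open_cmap[OF c(1)]]) (use c in \<open>auto simp: transition_cmap\<close>)
  then show ?thesis
    by (simp add: jacobian_def)
qed

lemma jacobian_trans:
  assumes c: "c \<in> charts_at M p" "c' \<in> charts_at M p" "c'' \<in> charts_at M p"
  shows "jacobian c' c'' p (jacobian c c' p y) = jacobian c c'' p y"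
proof -
  have d: "c \<in> atlas M" "p \<in> cdom c" "c' \<in> atlas M" "p \<in> cdom c'"
    using c by (auto simp: in_charts_at)
  have "(transition c' c'' has_derivative jacobian c' c'' p) (at (transition c c' (cmap c p)))"
    using transition_has_derivative[OF c(2,3)] d by (simp add: transition_cmap)
  from has_derivative_compose[OF transition_has_derivative[OF c(1,2)] this]
  have "((\<lambda>x. transition c' c'' (transition c c' x)) has_derivative
      (\<lambda>y. jacobian c' c'' p (jacobian c c' p y))) (at (cmap c p))" .
  then have "(transition c c'' has_derivative (\<lambda>y. jacobian c' c'' p (jacobian c c' p y))) (at (cmap c p))"
    by (rule has_derivative_transform_within_open[OF _ open_overlap[OF d(1) open_cdom[OF d(3)]]])
      (use d in \<open>auto simp: transition_cmap\<close>)
  from has_derivative_unique[OF this transition_has_derivative[OF c(1,3)]] show ?thesis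
    by (rule fun_cong)
qed

lemma tlift_apply: "c' \<in> charts_at M p \<Longrightarrow> tlift M c p y c' = jacobian c c' p y"
  by (simp add: tlift_def)

lemma tlift_self: "c \<in> charts_at M p \<Longrightarrow> tlift M c p y c = y"
  by (simp add: tlift_def jacobian_self)

lemma tlift_tangent:
  assumes "c \<in> charts_at M p"
  shows "tlift M c p y \<in> tangent_space M p"
  unfolding tangent_space_def
proof (intro CollectI conjI ballI allI impI)
  show "tlift M c p y c'' = jacobian c' c'' p (tlift M c p y c')"
    if "c' \<in> charts_at M p" "c'' \<in> charts_at M p" for c' c''
    using that by (simp only: tlift_apply jacobian_trans[OF assms])
  show "tlift M c p y c' = 0" if "c' \<notin> charts_at M p" for c'
    using that by (simp only: tlift_def if_False)
qed

lemma tangent_jacobian: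
  "v \<in> tangent_space M p \<Longrightarrow> c \<in> charts_at M p \<Longrightarrow> c' \<in> charts_at M p \<Longrightarrow> v c' = jacobian c c' p (v c)"
  unfolding tangent_space_def by blast

text \<open>The Jacobians fix the components in the other charts around p, and the convention of
  value 0 fixes them in the remaining charts, so one chart determines the whole family.\<close>

lemma tlift_tangent_eq:
  assumes "v \<in> tangent_space M p" "c \<in> charts_at M p"
  shows "tlift M c p (v c) = v"
proof
  fix c'
  show "tlift M c p (v c) c' = v c'"
  proof (cases "c' \<in> charts_at M p")
    case True
    then show ?thesis
      using tangent_jacobian[OF assms True] by (simp add: tlift_def)
  next
    case False
    then have "v c' = 0"
      using assms(1) unfolding tangent_space_def by blast
    then show ?thesis
      using False by (simp add: tlift_def)
  qed
qed

lemma tangent_eqI: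
  "v \<in> tangent_space M p \<Longrightarrow> w \<in> tangent_space M p \<Longrightarrow> c \<in> charts_at M p \<Longrightarrow> v c = w c \<Longrightarrow> v = w"
  using tlift_tangent_eq by metis

lemma tlift_change:
  assumes "c \<in> charts_at M p" "c' \<in> charts_at M p"
  shows "tlift M c' p (jacobian c c' p y) = tlift M c p y"
  using tlift_tangent_eq[OF tlift_tangent[OF assms(1)] assms(2), of y] by (simp add: tlift_apply assms)

lemma tcomb_tangent:
  assumes "v \<in> tangent_space M p" "w \<in> tangent_space M p"
  shows "tcomb a v b w \<in> tangent_space M p"
proof -
  have "tcomb a v b w c' = jacobian c c' p (tcomb a v b w c)" if "c \<in> charts_at M p" "c' \<in> charts_at M p" for c c'
  proof -
    note J = jacobian_linear[OF that]
    show ?thesis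
      by (simp only: tcomb_def tangent_jacobian[OF assms(1) that] tangent_jacobian[OF assms(2) that]
          linear_add[OF J] linear_scale[OF J])
  qed
  moreover have "tcomb a v b w c = 0" if "c \<notin> charts_at M p" for c
  proof -
    have "v c = 0" "w c = 0"
      using assms that unfolding tangent_space_def by blast+
    then show ?thesis
      by (simp add: tcomb_def)
  qed
  ultimately show ?thesis
    unfolding tangent_space_def by blast
qed

lemma tlift_lincomb:
  assumes "c \<in> charts_at M p"
  shows "tlift M c p (a *\<^sub>R y + b *\<^sub>R z) = tcomb a (tlift M c p y) b (tlift M c p z)"
proof (rule tangent_eqI[OF _ _ assms])
  show "tcomb a (tlift M c p y) b (tlift M c p z) \<in> tangent_space M p"
    by (intro tcomb_tangent tlift_tangent assms)
qed (simp_all add: assms tlift_tangent tlift_self tcomb_def)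

lemma coord_vec_tangent: "c \<in> charts_at M p \<Longrightarrow> coord_vec M c i p \<in> tangent_space M p"
  by (simp add: coord_vec_def tlift_tangent)

lemma coord_vec_self: "c \<in> charts_at M p \<Longrightarrow> coord_vec M c i p c = axis i 1"
  by (simp add: coord_vec_def tlift_self)

lemma cotangent_tcomb:
  "\<omega> \<in> cotangent_space M p \<Longrightarrow> v \<in> tangent_space M p \<Longrightarrow> w \<in> tangent_space M p \<Longrightarrow>
    \<omega> (tcomb a v b w) = a * \<omega> v + b * \<omega> w"
  unfolding cotangent_space_def by blast

lemma cotangent_outside: "\<omega> \<in> cotangent_space M p \<Longrightarrow> v \<notin> tangent_space M p \<Longrightarrow> \<omega> v = 0"
  unfolding cotangent_space_def by blast

lemma cotangentI:
  assumes "\<And>v w a b. v \<in> tangent_space M p \<Longrightarrow> w \<in> tangent_space M p \<Longrightarrow> \<omega> (tcomb a v b w) = a * \<omega> v + b * \<omega> w"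
    and "\<And>v. v \<notin> tangent_space M p \<Longrightarrow> \<omega> v = 0"
  shows "\<omega> \<in> cotangent_space M p"
  using assms unfolding cotangent_space_def by blast

lemma coord_covec_cotangent: "c \<in> charts_at M p \<Longrightarrow> coord_covec M c i p \<in> cotangent_space M p"
  by (rule cotangentI) (simp_all add: coord_covec_def tcomb_tangent, simp add: tcomb_def)

lemma coord_covec_apply: "v \<in> tangent_space M p \<Longrightarrow> coord_covec M c i p v = v c $ i"
  by (simp add: coord_covec_def)

lemma cotangent_lincomb:
  assumes "\<omega> \<in> cotangent_space M p" "\<eta> \<in> cotangent_space M p"
  shows "(\<lambda>u. a * \<omega> u + b * \<eta> u) \<in> cotangent_space M p"
  by (rule cotangentI)
    (simp_all add: cotangent_tcomb[OF assms(1)] cotangent_tcomb[OF assms(2)] cotangent_outside[OF assms(1)]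
      cotangent_outside[OF assms(2)] algebra_simps)

lemma cotangent_tlift_sum:
  assumes \<omega>: "\<omega> \<in> cotangent_space M p" and c: "c \<in> charts_at M p"
  shows "\<omega> (tlift M c p y) = (\<Sum>i\<in>UNIV. y $ i * \<omega> (coord_vec M c i p))"
proof -
  have lin: "linear (\<lambda>y. \<omega> (tlift M c p y))"
  proof (rule linearI)
    have *: "\<omega> (tlift M c p (a *\<^sub>R y + b *\<^sub>R z)) = a * \<omega> (tlift M c p y) + b * \<omega> (tlift M c p z)" for a b y z
      unfolding tlift_lincomb[OF c] by (rule cotangent_tcomb[OF \<omega> tlift_tangent[OF c] tlift_tangent[OF c]])
    show "\<omega> (tlift M c p (y + z)) = \<omega> (tlift M c p y) + \<omega> (tlift M c p z)" for y z
      using *[of 1 y 1 z] by simp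
    show "\<omega> (tlift M c p (a *\<^sub>R y)) = a *\<^sub>R \<omega> (tlift M c p y)" for a y
      using *[of a y 0 y] by simp
  qed
  have "\<omega> (tlift M c p y) = \<omega> (tlift M c p (\<Sum>i\<in>UNIV. y $ i *\<^sub>R axis i 1))"
    using basis_expansion[of y] by (simp add: scalar_mult_eq_scaleR)
  also have "\<dots> = (\<Sum>i\<in>UNIV. y $ i * \<omega> (coord_vec M c i p))"
    by (simp add: linear_sum[OF lin] linear_scale[OF lin] coord_vec_def)
  finally show ?thesis .
qed

lemma cotangent_expand:
  assumes \<omega>: "\<omega> \<in> cotangent_space M p" and c: "c \<in> charts_at M p"
  shows "\<omega> = (\<lambda>u. \<Sum>i\<in>UNIV. \<omega> (coord_vec M c i p) * coord_covec M c i p u)"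
proof
  fix u
  show "\<omega> u = (\<Sum>i\<in>UNIV. \<omega> (coord_vec M c i p) * coord_covec M c i p u)"
  proof (cases "u \<in> tangent_space M p")
    case True
    then show ?thesis
      using cotangent_tlift_sum[OF assms, of "u c"] tlift_tangent_eq[OF True c]
      by (simp add: coord_covec_apply mult.commute)
  next
    case False
    then show ?thesis
      by (simp add: cotangent_outside[OF \<omega>] coord_covec_def)
  qed
qed

end

locale conic_manifold = oriented_manifold M for M :: "('m::{t2_space,second_countable_topology}, 'n::finite) mfd" +
  fixes A :: "('m, 'n) tm set"
  assumes conic: "conic_domain M A"
begin

lemma A_tangent: "v \<in> A \<Longrightarrow> snd v \<in> tangent_space M (fst v)"
  using conic unfolding conic_domain_def tangent_bundle_def by auto

lemma A_scale: "(p, v) \<in> A \<Longrightarrow> 0 < a \<Longrightarrow> (p, \<lambda>c. a *\<^sub>R v c) \<in> A"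
  using conic unfolding conic_domain_def by blast

lemma open_tdom: "c \<in> atlas M \<Longrightarrow> open (tdom c A)"
  using conic unfolding conic_domain_def by blast

lemma tcoord_tdom: "v \<in> A \<Longrightarrow> c \<in> charts_at M (fst v) \<Longrightarrow> tcoord c v \<in> tdom c A"
  by (auto simp: tdom_def in_charts_at)

lemma tpoint_tcoord: "v \<in> A \<Longrightarrow> c \<in> charts_at M (fst v) \<Longrightarrow> tpoint M c (tcoord c v) = v"
  using tlift_tangent_eq[OF A_tangent, of v c]
  by (cases v) (simp add: tpoint_def tcoord_def cinv_cmap in_charts_at)

lemma texpr_tcoord: "v \<in> A \<Longrightarrow> c \<in> charts_at M (fst v) \<Longrightarrow> texpr M c f (tcoord c v) = f v"
  by (simp add: texpr_def tpoint_tcoord)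

text \<open>Moves from points of the open coordinate set to vectors of \<open>A\<close>: smoothness
  lives in coordinates, identities are checked at vectors.\<close>

lemma tdomE:
  assumes "c \<in> atlas M" "z \<in> tdom c A"
  obtains v where "v \<in> A" "c \<in> charts_at M (fst v)" "z = tcoord c v" "tpoint M c z = v"
  using assms unfolding tdom_def by (auto simp: in_charts_at tpoint_tcoord)

end

section \<open>Derivatives along the fibres\<close>

context conic_manifold
begin

abbreviation smooth_in :: "('m, 'n) chart \<Rightarrow> (('m, 'n) tm \<Rightarrow> real) \<Rightarrow> bool" where
  "smooth_in c f \<equiv> smooth_on (tdom c A) (texpr M c f)"

lemma smooth_in_cong:
  assumes "c \<in> atlas M" "\<And>v. v \<in> A \<Longrightarrow> c \<in> charts_at M (fst v) \<Longrightarrow> f v = g v"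
  shows "smooth_in c f = smooth_in c g"
proof (rule smooth_on_cong[OF open_tdom[OF assms(1)]])
  fix z assume "z \<in> tdom c A"
  then show "texpr M c f z = texpr M c g z"
    by (rule tdomE[OF assms(1)]) (simp add: texpr_def assms(2))
qed

lemma smooth_in_sum:
  assumes "c \<in> atlas M" "\<And>i. i \<in> I \<Longrightarrow> smooth_in c (f i)"
  shows "smooth_in c (\<lambda>v. \<Sum>i\<in>I. f i v)"
  using smooth_on_sum[OF open_tdom[OF assms(1)] assms(2)] by (simp add: texpr_def o_def)

lemma smooth_in_mult:
  assumes "c \<in> atlas M" "smooth_in c f" "smooth_in c g"
  shows "smooth_in c (\<lambda>v. f v * g v)"
  using smooth_on_mult[OF open_tdom[OF assms(1)] assms(2,3)] by (simp add: texpr_def o_def)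

lemma smooth_in_const: "smooth_in c (\<lambda>v. a)"
  using smooth_on_const[of "tdom c A" a] by (simp add: texpr_def o_def)

lemma texpr_has_derivative:
  assumes "smooth_in c f" "v \<in> A" "c \<in> charts_at M (fst v)"
  shows "(texpr M c f has_derivative frechet_derivative (texpr M c f) (at (tcoord c v))) (at (tcoord c v))"
  using smooth_on_differentiable[OF assms(1) tcoord_tdom[OF assms(2,3)]] by (simp add: frechet_derivative_works)

lemma texpr_dy_partial:
  assumes "c \<in> atlas M" "z \<in> tdom c A"
  shows "texpr M c (dy_partial M c k f) z = frechet_derivative (texpr M c f) (at z) (0, axis k 1)"
  using assms(2) by (rule tdomE[OF assms(1)]) (simp add: texpr_tcoord dy_partial_def)

lemma smooth_in_dy_partial:
  assumes "c \<in> atlas M" "smooth_in c f"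
  shows "smooth_in c (dy_partial M c k f)"
proof -
  have "smooth_in c (dy_partial M c k f) =
      smooth_on (tdom c A) (\<lambda>z. frechet_derivative (texpr M c f) (at z) (0, axis k 1))"
    by (rule smooth_on_cong[OF open_tdom[OF assms(1)] texpr_dy_partial[OF assms(1)]])
  then show ?thesis
    using smooth_on_frechet_derivative[OF assms(2)] by blast
qed

text \<open>Agreement is asked for only above a neighbourhood S of the base point, since extended
  fields and orientation signs are under control only there; S restricts x and leaves y
  free.\<close>

lemma frechet_derivative_texpr_cong:
  assumes c: "c \<in> charts_at M (fst v)" and v: "v \<in> A" and S: "open S" "cmap c (fst v) \<in> S"
    and fg: "\<And>u. u \<in> A \<Longrightarrow> c \<in> charts_at M (fst u) \<Longrightarrow> cmap c (fst u) \<in> S \<Longrightarrow> f u = g u"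
  shows "frechet_derivative (texpr M c f) (at (tcoord c v)) = frechet_derivative (texpr M c g) (at (tcoord c v))"
proof (rule frechet_derivative_cong_open)
  have at: "c \<in> atlas M"
    using c by (simp add: in_charts_at)
  show "open (tdom c A \<inter> fst -` S)"
    by (intro open_Int open_tdom[OF at] open_vimage[OF S(1)] continuous_on_fst continuous_on_id)
  show "tcoord c v \<in> tdom c A \<inter> fst -` S"
    using tcoord_tdom[OF v c] S(2) by (simp add: tcoord_def)
  fix z assume z: "z \<in> tdom c A \<inter> fst -` S"
  then have "z \<in> tdom c A" by blast
  then obtain u where u: "u \<in> A" "c \<in> charts_at M (fst u)" "z = tcoord c u"
    by (rule tdomE[OF at])
  then have "cmap c (fst u) \<in> S"
    using z by (simp add: tcoord_def)
  then show "texpr M c f z = texpr M c g z"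
    unfolding u(3) texpr_tcoord[OF u(1,2)] by (rule fg[OF u(1,2)])
qed

lemma dy_partial_cong:
  assumes "c \<in> charts_at M (fst v)" "v \<in> A"
    and "\<And>u. u \<in> A \<Longrightarrow> c \<in> charts_at M (fst u) \<Longrightarrow> f u = g u"
  shows "dy_partial M c k f v = dy_partial M c k g v"
  unfolding dy_partial_def using frechet_derivative_texpr_cong[OF assms(1,2) open_UNIV UNIV_I assms(3)] by simp

lemma delta_local_cong:
  assumes "c \<in> charts_at M (fst v)" "v \<in> A" "open S" "cmap c (fst v) \<in> S"
    and "\<And>u. u \<in> A \<Longrightarrow> c \<in> charts_at M (fst u) \<Longrightarrow> cmap c (fst u) \<in> S \<Longrightarrow> f u = g u"
  shows "delta M N c k f v = delta M N c k g v"
  unfolding delta_def dx_partial_def dy_partial_def using frechet_derivative_texpr_cong[OF assms] by simp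

lemma delta_cong:
  assumes "c \<in> charts_at M (fst v)" "v \<in> A"
    and "\<And>u. u \<in> A \<Longrightarrow> c \<in> charts_at M (fst u) \<Longrightarrow> f u = g u"
  shows "delta M N c k f v = delta M N c k g v"
  by (rule delta_local_cong[OF assms(1,2) open_UNIV UNIV_I assms(3)])

lemma dy_partial_commute:
  assumes "c \<in> charts_at M (fst v)" "v \<in> A" "smooth_in c f"
  shows "dy_partial M c i (dy_partial M c j f) v = dy_partial M c j (dy_partial M c i f) v"
proof -
  have c: "c \<in> atlas M"
    using assms(1) by (simp add: in_charts_at)
  have "dy_partial M c i (dy_partial M c j f) v =
    frechet_derivative (\<lambda>z. frechet_derivative (texpr M c f) (at z) (0, axis j 1)) (at (tcoord c v)) (0, axis i 1)" for i j
    using frechet_derivative_cong_open[OF open_tdom[OF c] tcoord_tdom[OF assms(2,1)] texpr_dy_partial[OF c, of _ j f]]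
    by (simp add: dy_partial_def[of M c i])
  then show ?thesis
    using frechet_derivative_commute[OF open_tdom[OF c] tcoord_tdom[OF assms(2,1)] assms(3)] by simp
qed

lemma frechet_derivative_partials:
  assumes "c \<in> charts_at M (fst v)" "v \<in> A" "smooth_in c f"
  shows "frechet_derivative (texpr M c f) (at (tcoord c v)) (a, w) =
    (\<Sum>k\<in>UNIV. a $ k * dx_partial M c k f v) + (\<Sum>k\<in>UNIV. w $ k * dy_partial M c k f v)"
proof -
  let ?D = "frechet_derivative (texpr M c f) (at (tcoord c v))"
  have lin: "linear ?D"
    by (rule has_derivative_linear[OF texpr_has_derivative[OF assms(3,2,1)]])
  have "(a, w) = (\<Sum>k\<in>UNIV. a $ k *\<^sub>R (axis k 1, 0)) + (\<Sum>k\<in>UNIV. w $ k *\<^sub>R (0, axis k 1))"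
    using basis_expansion[of a] basis_expansion[of w]
    by (simp add: prod_eq_iff fst_sum snd_sum scalar_mult_eq_scaleR)
  then have "?D (a, w) = ?D ((\<Sum>k\<in>UNIV. a $ k *\<^sub>R (axis k 1, 0)) + (\<Sum>k\<in>UNIV. w $ k *\<^sub>R (0, axis k 1)))"
    by (rule arg_cong)
  also have "\<dots> = (\<Sum>k\<in>UNIV. a $ k * dx_partial M c k f v) + (\<Sum>k\<in>UNIV. w $ k * dy_partial M c k f v)"
    by (simp only: linear_add[OF lin] linear_sum[OF lin] linear_scale[OF lin] dx_partial_def dy_partial_def
        real_scaleR_def)
  finally show ?thesis .
qed

text \<open>Exhibits delta_k as one directional derivative, along the horizontal lift (e_k, -N_k) of
  the coordinate field, so that a rule such as Jacobi's formula applies to it at once.\<close>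

lemma delta_frechet_derivative:
  assumes "c \<in> charts_at M (fst v)" "v \<in> A" "smooth_in c f"
  shows "delta M N c k f v =
    frechet_derivative (texpr M c f) (at (tcoord c v)) (axis k 1, - (\<chi> j. N c j k v))"
proof -
  have "(\<Sum>l\<in>UNIV. axis k 1 $ l * dx_partial M c l f v) = dx_partial M c k f v"
    by (simp add: axis_def if_distrib[of "\<lambda>x. x * _"] cong: if_cong)
  then show ?thesis
    by (simp add: frechet_derivative_partials[OF assms] delta_def sum_negf)
qed

lemma delta_cmult:
  assumes c: "c \<in> charts_at M (fst v)" and v: "v \<in> A" and f: "smooth_in c f"
  shows "delta M N c k (\<lambda>u. a * f u) v = a * delta M N c k f v"
proof -
  have "(texpr M c (\<lambda>u. a * f u) has_derivative (\<lambda>w. a * frechet_derivative (texpr M c f) (at (tcoord c v)) w))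
      (at (tcoord c v))"
    using has_derivative_mult_right[OF texpr_has_derivative[OF f v c], of a] by (simp add: texpr_def o_def)
  then have "frechet_derivative (texpr M c (\<lambda>u. a * f u)) (at (tcoord c v)) =
      (\<lambda>w. a * frechet_derivative (texpr M c f) (at (tcoord c v)) w)"
    by (rule frechet_derivative_at[symmetric])
  then show ?thesis
    by (simp add: delta_def dx_partial_def dy_partial_def algebra_simps sum_distrib_left)
qed

lemma delta_const: "delta M N c k (\<lambda>u. a) v = 0"
  by (simp add: delta_def dx_partial_def dy_partial_def texpr_def o_def)

text \<open>Restriction to a single fibre, where a change of charts is a linear map and homogeneity
  can be differentiated; only the y-derivatives survive.\<close>

lemma fibre_has_derivative:
  assumes c: "c \<in> charts_at M (fst v)" and v: "v \<in> A" and f: "smooth_in c f"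
  shows "((\<lambda>y. f (fst v, tlift M c (fst v) y)) has_derivative (\<lambda>w. \<Sum>k\<in>UNIV. w $ k * dy_partial M c k f v))
    (at (snd v c))"
proof -
  have c': "c \<in> atlas M" "fst v \<in> cdom c"
    using c by (auto simp: in_charts_at)
  have "((\<lambda>y. (cmap c (fst v), y)) has_derivative (\<lambda>w. (0, w))) (at (snd v c))"
    by (auto intro!: derivative_eq_intros)
  moreover have "(texpr M c f has_derivative frechet_derivative (texpr M c f) (at (tcoord c v)))
      (at (cmap c (fst v), snd v c))"
    using texpr_has_derivative[OF f v c] by (simp add: tcoord_def)
  ultimately have "((\<lambda>y. texpr M c f (cmap c (fst v), y)) has_derivative
      (\<lambda>w. frechet_derivative (texpr M c f) (at (tcoord c v)) (0, w))) (at (snd v c))"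
    by (rule has_derivative_compose)
  then show ?thesis
    unfolding frechet_derivative_partials[OF c v f]
    by (simp add: texpr_def tpoint_def cinv_cmap c')
qed

lemma fibre_in_A:
  assumes "c \<in> charts_at M (fst v)" "v \<in> A"
  obtains S where "open S" "snd v c \<in> S" "\<And>y. y \<in> S \<Longrightarrow> (fst v, tlift M c (fst v) y) \<in> A"
proof
  have c: "c \<in> atlas M" "fst v \<in> cdom c"
    using assms by (auto simp: in_charts_at)
  let ?S = "(\<lambda>y. (cmap c (fst v), y)) -` tdom c A"
  show "open ?S"
    by (rule open_vimage[OF open_tdom[OF c(1)]]) (intro continuous_intros)
  show "snd v c \<in> ?S"
    using tcoord_tdom[OF assms(2,1)] by (simp add: tcoord_def)
  show "(fst v, tlift M c (fst v) y) \<in> A" if "y \<in> ?S" for y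
  proof -
    have "tpoint M c (cmap c (fst v), y) \<in> A"
      using that by (auto elim!: tdomE[OF c(1)])
    then show ?thesis
      by (simp add: tpoint_def cinv_cmap c)
  qed
qed

text \<open>On a fibre the change of coordinates is the linear map J, so y-derivatives transform by
  J alone. The coefficients \<open>r a\<close> are constant along the fibre: this is the shape of a
  first derivative of L written in the other chart, and it allows the rule to be applied once more
  for the Hessian.\<close>

lemma dy_partial_change:
  assumes c: "c \<in> charts_at M (fst v)" "c' \<in> charts_at M (fst v)" and v: "v \<in> A"
    and f: "smooth_in c f" "\<And>a. a \<in> I \<Longrightarrow> smooth_in c' (g a)"
    and fg: "\<And>u. u \<in> A \<Longrightarrow> fst u = fst v \<Longrightarrow> f u = (\<Sum>a\<in>I. r a * g a u)"
  shows "dy_partial M c k f v =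
    (\<Sum>a\<in>I. r a * (\<Sum>l\<in>UNIV. matrix (jacobian c c' (fst v)) $ l $ k * dy_partial M c' l (g a) v))"
proof -
  let ?p = "fst v" let ?J = "jacobian c c' ?p"
  obtain S where S: "open S" "snd v c \<in> S" "\<And>y. y \<in> S \<Longrightarrow> (?p, tlift M c ?p y) \<in> A"
    using fibre_in_A[OF c(1) v] by blast
  have lin: "linear ?J"
    by (rule jacobian_linear[OF c])
  then have J: "(?J has_derivative ?J) (at (snd v c))"
    by (intro bounded_linear_imp_has_derivative linear_conv_bounded_linear[THEN iffD1])
  have Jv: "?J (snd v c) = snd v c'"
    using tangent_jacobian[OF A_tangent[OF v] c] by simp
  have g: "((\<lambda>y. g a (?p, tlift M c' ?p y)) has_derivative (\<lambda>w. \<Sum>l\<in>UNIV. w $ l * dy_partial M c' l (g a) v))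
      (at (?J (snd v c)))" if "a \<in> I" for a
    unfolding Jv by (rule fibre_has_derivative[OF c(2) v f(2)[OF that]])
  have "((\<lambda>y. \<Sum>a\<in>I. r a * g a (?p, tlift M c' ?p (?J y))) has_derivative
      (\<lambda>w. \<Sum>a\<in>I. r a * (\<Sum>l\<in>UNIV. ?J w $ l * dy_partial M c' l (g a) v))) (at (snd v c))"
    by (intro has_derivative_sum has_derivative_mult_right has_derivative_compose[OF J g])
  then have "((\<lambda>y. f (?p, tlift M c ?p y)) has_derivative
      (\<lambda>w. \<Sum>a\<in>I. r a * (\<Sum>l\<in>UNIV. ?J w $ l * dy_partial M c' l (g a) v))) (at (snd v c))"
    by (rule has_derivative_transform_within_open[OF _ S(1,2)]) (simp add: fg[OF S(3)] tlift_change[OF c])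
  from has_derivative_unique[OF fibre_has_derivative[OF c(1) v f(1)] this]
  have "(\<Sum>l\<in>UNIV. axis k 1 $ l * dy_partial M c l f v) =
      (\<Sum>a\<in>I. r a * (\<Sum>l\<in>UNIV. ?J (axis k 1) $ l * dy_partial M c' l (g a) v))"
    by (rule fun_cong)
  moreover have "(\<Sum>l\<in>UNIV. axis k 1 $ l * dy_partial M c l f v) = dy_partial M c k f v"
    by (simp add: axis_def if_distrib[of "\<lambda>x. x * _"] cong: if_cong)
  ultimately show ?thesis
    by (simp add: matrix_def)
qed

text \<open>Differentiating f(a y) = a^(m+1) f(y) in y puts a factor a on the left; cancelling it
  lowers the degree by one.\<close>

lemma dy_partial_homogeneous:
  assumes c: "c \<in> charts_at M p" and f: "smooth_in c f" and v: "(p, v) \<in> A" and a: "0 < a"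
    and hom: "\<And>u. (p, u) \<in> A \<Longrightarrow> f (p, \<lambda>c. a *\<^sub>R u c) = a ^ Suc m * f (p, u)"
  shows "dy_partial M c k f (p, \<lambda>c. a *\<^sub>R v c) = a ^ m * dy_partial M c k f (p, v)"
proof -
  have c': "c \<in> charts_at M (fst (p, v))" "c \<in> charts_at M (fst (p, \<lambda>c. a *\<^sub>R v c))"
    using c by simp_all
  obtain S where S: "open S" "v c \<in> S" "\<And>y. y \<in> S \<Longrightarrow> (p, tlift M c p y) \<in> A"
    using fibre_in_A[OF c'(1) v] by auto
  have lift: "tlift M c p (a *\<^sub>R y) = (\<lambda>c'. a *\<^sub>R tlift M c p y c')" for y
    using tlift_lincomb[OF c, of a y 0 y] by (simp add: tcomb_def)
  have "((\<lambda>y. a *\<^sub>R y) has_derivative (\<lambda>w. a *\<^sub>R w)) (at (v c))"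
    by (auto intro!: derivative_eq_intros)
  moreover have "((\<lambda>y. f (p, tlift M c p y)) has_derivative
      (\<lambda>w. \<Sum>l\<in>UNIV. w $ l * dy_partial M c l f (p, \<lambda>c. a *\<^sub>R v c))) (at (a *\<^sub>R v c))"
    using fibre_has_derivative[OF c'(2) A_scale[OF v a] f] by simp
  ultimately have "((\<lambda>y. f (p, tlift M c p (a *\<^sub>R y))) has_derivative
      (\<lambda>w. \<Sum>l\<in>UNIV. (a *\<^sub>R w) $ l * dy_partial M c l f (p, \<lambda>c. a *\<^sub>R v c))) (at (v c))"
    by (rule has_derivative_compose)
  then have 1: "((\<lambda>y. a ^ Suc m * f (p, tlift M c p y)) has_derivative
      (\<lambda>w. \<Sum>l\<in>UNIV. (a *\<^sub>R w) $ l * dy_partial M c l f (p, \<lambda>c. a *\<^sub>R v c))) (at (v c))"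
    by (rule has_derivative_transform_within_open[OF _ S(1,2)]) (simp add: lift hom[OF S(3)])
  have "((\<lambda>y. f (p, tlift M c p y)) has_derivative (\<lambda>w. \<Sum>l\<in>UNIV. w $ l * dy_partial M c l f (p, v))) (at (v c))"
    using fibre_has_derivative[OF c'(1) v f] by simp
  then have 2: "((\<lambda>y. a ^ Suc m * f (p, tlift M c p y)) has_derivative
      (\<lambda>w. a ^ Suc m * (\<Sum>l\<in>UNIV. w $ l * dy_partial M c l f (p, v)))) (at (v c))"
    by (rule has_derivative_mult_right)
  have ax: "(\<Sum>l\<in>UNIV. (b *\<^sub>R axis k 1) $ l * h l) = b * h k" for b :: real and h :: "'n \<Rightarrow> real"
    by (simp add: axis_def if_distrib[of "\<lambda>x. _ * x"] if_distrib[of "\<lambda>x. x * _"] cong: if_cong)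
  have "a * dy_partial M c k f (p, \<lambda>c. a *\<^sub>R v c) = a ^ Suc m * dy_partial M c k f (p, v)"
    using fun_cong[OF has_derivative_unique[OF 1 2], of "axis k 1"]
      ax[of a "\<lambda>l. dy_partial M c l f (p, \<lambda>c. a *\<^sub>R v c)"] ax[of 1 "\<lambda>l. dy_partial M c l f (p, v)"] by auto
  then show ?thesis
    using a by simp
qed

text \<open>Euler's relation in degree 0: along the ray through v the function is constant for
  positive factors, and its derivative at the factor 1 is the sum on the left.\<close>

lemma euler_homogeneous_zero:
  assumes c: "c \<in> charts_at M p" and f: "smooth_in c f" and v: "(p, v) \<in> A"
    and hom: "\<And>a. 0 < a \<Longrightarrow> f (p, \<lambda>c. a *\<^sub>R v c) = f (p, v)"
  shows "(\<Sum>k\<in>UNIV. v c $ k * dy_partial M c k f (p, v)) = 0"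
proof -
  have c': "c \<in> charts_at M (fst (p, v))"
    using c by simp
  have vt: "tlift M c p (v c) = v"
    using tlift_tangent_eq[OF _ c] A_tangent[OF v] by simp
  have lift: "tlift M c p (a *\<^sub>R v c) = (\<lambda>c. a *\<^sub>R v c)" for a
    using tlift_lincomb[OF c, of a "v c" 0 "v c"] by (simp add: tcomb_def vt)
  have "((\<lambda>a. a *\<^sub>R v c) has_derivative (\<lambda>a. a *\<^sub>R v c)) (at 1)"
    by (auto intro!: derivative_eq_intros)
  moreover have "((\<lambda>y. f (p, tlift M c p y)) has_derivative
      (\<lambda>w. \<Sum>l\<in>UNIV. w $ l * dy_partial M c l f (p, v))) (at (1 *\<^sub>R v c))"
    using fibre_has_derivative[OF c' v f] by simp
  ultimately have "((\<lambda>a. f (p, tlift M c p (a *\<^sub>R v c))) has_derivative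
      (\<lambda>a. \<Sum>l\<in>UNIV. (a *\<^sub>R v c) $ l * dy_partial M c l f (p, v))) (at 1)"
    by (rule has_derivative_compose)
  then have "((\<lambda>a. f (p, v)) has_derivative
      (\<lambda>a. \<Sum>l\<in>UNIV. (a *\<^sub>R v c) $ l * dy_partial M c l f (p, v))) (at (1::real))"
    by (rule has_derivative_transform_within_open[OF _ open_greaterThan[of 0]]) (auto simp: lift hom)
  from fun_cong[OF has_derivative_unique[OF this has_derivative_const], of 1] show ?thesis
    by simp
qed

end

section \<open>The fundamental tensor and the volume density\<close>

lemma sum_enumeration:
  fixes h :: "nat \<Rightarrow> real"
  shows "(\<Sum>\<nu><CARD('n::finite). h \<nu>) = (\<Sum>k\<in>UNIV. h (to_nat_on (UNIV :: 'n::finite set) k))"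
  using sum.reindex_bij_betw[OF to_nat_on_finite[of "UNIV :: 'n set"], of h] by simp

lemma enumeration_less: "to_nat_on (UNIV :: 'n::finite set) k < CARD('n::finite)"
  using to_nat_on_finite[of "UNIV :: 'n set"] by (auto simp: bij_betw_def)

lemma enumerationE:
  assumes "\<nu> < CARD('n::finite)"
  obtains k :: "'n::finite" where "\<nu> = to_nat_on (UNIV :: 'n::finite set) k"
proof -
  have "\<nu> \<in> range (to_nat_on (UNIV :: 'n set))"
    using assms to_nat_on_finite[of "UNIV :: 'n set"] by (simp add: bij_betw_def)
  then show thesis
    using that by blast
qed

lemma enumeration_eq_iff: "to_nat_on (UNIV :: 'n::finite set) j = to_nat_on UNIV k \<longleftrightarrow> j = k"
  using to_nat_on_finite[of "UNIV :: 'n set"] by (auto simp: bij_betw_def inj_on_def)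

text \<open>Read as indices, this list gives the coordinate frame in the order in which the volume
  form takes its arguments, so that the frame matrix is the identity.\<close>

lemma enumeration_list: "\<exists>js :: 'n::finite list. length js = CARD('n::finite) \<and> (\<forall>j. js ! to_nat_on UNIV j = j)"
proof (intro exI conjI allI)
  let ?js = "map (inv_into UNIV (to_nat_on (UNIV :: 'n set))) [0..<CARD('n)]"
  show "length ?js = CARD('n)" by simp
  show "?js ! to_nat_on UNIV j = j" for j
    using enumeration_less[of j] inj_on_to_nat_on[of "UNIV :: 'n set"] by simp
qed

definition frame_matrix :: "('m, 'n::finite) chart \<Rightarrow> ('m, 'n) tvec list \<Rightarrow> real^'n^'n" where
  "frame_matrix c Xs = (\<chi> i j. (Xs ! to_nat_on (UNIV :: 'n set) j) c $ i)"

lemma frame_matrix_update: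
  fixes Xs :: "('m, 'n::finite) tvec list"
  assumes "length Xs = CARD('n)"
  shows "frame_matrix c (Xs[to_nat_on (UNIV :: 'n set) k := Y]) = replace_col (frame_matrix c Xs) k (Y c)"
  using assms enumeration_less[of k]
  by (simp add: frame_matrix_def replace_col_def vec_eq_iff nth_list_update enumeration_eq_iff)

locale finsler_manifold = conic_manifold M A
  for M :: "('m::{t2_space,second_countable_topology}, 'n::finite) mfd" and A :: "('m, 'n) tm set" +
  fixes L :: "('m, 'n) tm \<Rightarrow> real"
  assumes finsler: "pseudo_Finsler M A L"
begin

lemma L_smooth: "c \<in> atlas M \<Longrightarrow> smooth_in c L"
  using finsler by (simp add: pseudo_Finsler_def aniso_smooth_def)

lemma fund_matrix_invertible: "v \<in> A \<Longrightarrow> c \<in> charts_at M (fst v) \<Longrightarrow> invertible (fund_matrix M L c v)"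
  using finsler by (simp add: pseudo_Finsler_def)

lemma L_homogeneous: "(p, v) \<in> A \<Longrightarrow> 0 < a \<Longrightarrow> L (p, \<lambda>c. a *\<^sub>R v c) = a\<^sup>2 * L (p, v)"
  using finsler unfolding pseudo_Finsler_def by blast

lemma fund_tensor_smooth:
  assumes "c \<in> atlas M"
  shows "smooth_in c (fund_tensor M L c i j)"
  unfolding fund_tensor_def
  by (intro smooth_in_mult smooth_in_const smooth_in_dy_partial L_smooth assms)

lemma fund_tensor_sym:
  assumes "v \<in> A" "c \<in> charts_at M (fst v)"
  shows "fund_tensor M L c i j v = fund_tensor M L c j i v"
  using dy_partial_commute[OF assms(2,1), of L] L_smooth[of c] assms(2) by (simp add: fund_tensor_def in_charts_at)

lemma fund_inv_sym:
  assumes "v \<in> A" "c \<in> charts_at M (fst v)"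
  shows "fund_inv M L c i j v = fund_inv M L c j i v"
proof -
  let ?G = "fund_matrix M L c v"
  note inv = fund_matrix_invertible[OF assms]
  have sym: "transpose ?G = ?G"
    by (simp add: vec_eq_iff transpose_def fund_matrix_def fund_tensor_sym[OF assms])
  have "transpose (matrix_inv ?G) ** ?G = mat 1"
    using matrix_transpose_mul[of ?G "matrix_inv ?G"] by (simp add: invertible_matrix_inv[OF inv] sym)
  then have "transpose (matrix_inv ?G) = matrix_inv ?G"
    using invertible_matrix_inv[OF inv] by (metis matrix_mul_assoc matrix_mul_lid matrix_mul_rid)
  then have "transpose (matrix_inv ?G) $ j $ i = matrix_inv ?G $ j $ i"
    by (rule arg_cong)
  then show ?thesis
    by (simp add: fund_inv_def transpose_def)
qed

text \<open>Up to the factor 1/4 the Cartan tensor is a third y-derivative of L; with the derivative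
  in direction i placed innermost, the outer two can be exchanged.\<close>

lemma cartan_sym:
  assumes "v \<in> A" "c \<in> charts_at M (fst v)"
  shows "cartan M L c i j k v = cartan M L c i k j v"
proof -
  have c: "c \<in> atlas M"
    using assms by (simp add: in_charts_at)
  have half: "cartan M L c i j k v = 1/4 * dy_partial M c k (dy_partial M c j (dy_partial M c i L)) v" for j k
  proof -
    have "dy_partial M c k (fund_tensor M L c i j) v =
        dy_partial M c k (\<lambda>u. \<Sum>a\<in>{0::nat}. 1/2 * dy_partial M c j (dy_partial M c i L) u) v"
      by (rule dy_partial_cong[OF assms(2,1)])
        (simp add: fund_tensor_def dy_partial_commute[of c _ L i j] L_smooth c)
    \<comment> \<open>\<open>dy_partial_change\<close> from c to itself, over a one-element index
      set, serves as the rule for pulling out the factor 1/2.\<close>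
    also have "\<dots> = (\<Sum>a\<in>{0::nat}. 1/2 * (\<Sum>l\<in>UNIV. matrix (jacobian c c (fst v)) $ l $ k *
        dy_partial M c l (dy_partial M c j (dy_partial M c i L)) v))"
      by (rule dy_partial_change[OF assms(2,2,1)])
        (intro smooth_in_sum smooth_in_mult smooth_in_const smooth_in_dy_partial L_smooth c refl)+
    also have "\<dots> = 1/2 * dy_partial M c k (dy_partial M c j (dy_partial M c i L)) v"
      by (simp add: matrix_def jacobian_self[OF assms(2)] axis_def if_distrib[of "\<lambda>x. x * _"] cong: if_cong)
    finally show ?thesis
      by (simp add: cartan_def)
  qed
  show ?thesis
    unfolding half
    using dy_partial_commute[OF assms(2,1), of "dy_partial M c i L"] smooth_in_dy_partial[OF c L_smooth[OF c]] by simp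
qed

text \<open>The degree of homogeneity drops from 2 for L to 1 for its first y-derivatives and to 0
  for the fundamental tensor, to which Euler's relation applies.\<close>

lemma cartan_contract:
  assumes "v \<in> A" "c \<in> charts_at M (fst v)"
  shows "(\<Sum>k\<in>UNIV. cartan M L c i j k v * snd v c $ k) = 0"
proof -
  obtain p w where v: "v = (p, w)" by (cases v)
  have pw: "(p, w) \<in> A" "c \<in> charts_at M p" and c: "c \<in> atlas M"
    using assms by (simp_all add: v in_charts_at)
  have 1: "dy_partial M c j L (p, \<lambda>c. a *\<^sub>R u c) = a ^ 1 * dy_partial M c j L (p, u)"
    if "(p, u) \<in> A" "0 < a" for u a j
    by (rule dy_partial_homogeneous[OF pw(2) L_smooth[OF c] that])
      (simp add: L_homogeneous that(2) power2_eq_square)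
  have 2: "dy_partial M c i (dy_partial M c j L) (p, \<lambda>c. a *\<^sub>R w c) = a ^ 0 * dy_partial M c i (dy_partial M c j L) (p, w)"
    if "0 < a" for a
    by (rule dy_partial_homogeneous[OF pw(2) smooth_in_dy_partial[OF c L_smooth[OF c]] pw(1) that])
      (simp add: 1[OF _ that])
  have "(\<Sum>k\<in>UNIV. w c $ k * dy_partial M c k (fund_tensor M L c i j) (p, w)) = 0"
    by (rule euler_homogeneous_zero[OF pw(2) fund_tensor_smooth[OF c] pw(1)]) (simp add: fund_tensor_def 2)
  then show ?thesis
    by (simp add: v cartan_def mult.commute sum_distrib_left[symmetric] sum_divide_distrib[symmetric])
qed

section \<open>Volume density and orientation sign of a chart\<close>

definition vol_density :: "('m, 'n) chart \<Rightarrow> ('m, 'n) tm \<Rightarrow> real" where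
  "vol_density c v = sqrt \<bar>det (fund_matrix M L c v)\<bar>"

lemma fund_matrix_smooth: "c \<in> atlas M \<Longrightarrow> smooth_on (tdom c A) (\<lambda>z. fund_matrix M L c (tpoint M c z) $ i $ j)"
  using fund_tensor_smooth[of c i j] by (simp add: fund_matrix_def texpr_def o_def)

lemma vol_density_smooth:
  assumes c: "c \<in> atlas M"
  shows "smooth_in c (vol_density c)"
proof -
  have "smooth_on (tdom c A) (\<lambda>z. sqrt \<bar>det (fund_matrix M L c (tpoint M c z))\<bar>)"
  proof (rule smooth_on_sqrt_abs[OF open_tdom[OF c]])
    show "smooth_on (tdom c A) (\<lambda>z. det (fund_matrix M L c (tpoint M c z)))"
      by (rule smooth_on_det[OF open_tdom[OF c] fund_matrix_smooth[OF c]])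
    show "det (fund_matrix M L c (tpoint M c z)) \<noteq> 0" if "z \<in> tdom c A" for z
      using that by (rule tdomE[OF c]) (use fund_matrix_invertible invertible_det_nz in fastforce)
  qed
  then show ?thesis
    by (simp add: texpr_def o_def vol_density_def)
qed

lemma vol_density_pos: "v \<in> A \<Longrightarrow> c \<in> charts_at M (fst v) \<Longrightarrow> 0 < vol_density c v"
  using fund_matrix_invertible[of v c] by (simp add: vol_density_def invertible_det_nz)

text \<open>The fundamental matrices are related by G = J^T G' J, hence their determinants by (det
  J)^2; the square root leaves the absolute value.\<close>

lemma vol_density_change:
  assumes v: "v \<in> A" and c: "c \<in> charts_at M (fst v)" "c' \<in> charts_at M (fst v)"
  shows "vol_density c v = \<bar>det (matrix (jacobian c c' (fst v)))\<bar> * vol_density c' v"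
proof -
  let ?J = "matrix (jacobian c c' (fst v))"
  have at: "c \<in> atlas M" "c' \<in> atlas M"
    using c by (auto simp: in_charts_at)
  \<comment> \<open>Proved at every u of the fibre, because the next step differentiates it once
    more along the fibre.\<close>
  have first: "dy_partial M c j L u = (\<Sum>b\<in>UNIV. ?J $ b $ j * dy_partial M c' b L u)"
    if "u \<in> A" "fst u = fst v" for u j
    using dy_partial_change[of c u c' L "{0::nat}" "\<lambda>a. L" "\<lambda>a. 1" j] c that by (simp add: L_smooth at)
  have hess: "dy_partial M c i (dy_partial M c j L) v =
      (\<Sum>b\<in>UNIV. ?J $ b $ j * (\<Sum>a\<in>UNIV. ?J $ a $ i * dy_partial M c' a (dy_partial M c' b L) v))" for i j
    by (rule dy_partial_change[OF c v]) (intro smooth_in_dy_partial L_smooth at first)+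
  have "fund_tensor M L c i j v =
      (\<Sum>b\<in>UNIV. ?J $ b $ j * (\<Sum>a\<in>UNIV. ?J $ a $ i * fund_tensor M L c' a b v))" for i j
    unfolding fund_tensor_def hess sum_distrib_left by (simp only: mult_ac)
  moreover have "(\<Sum>b\<in>UNIV. ?J $ b $ j * (\<Sum>a\<in>UNIV. ?J $ a $ i * h a b)) =
      (\<Sum>a\<in>UNIV. ?J $ a $ i * (\<Sum>b\<in>UNIV. h a b * ?J $ b $ j))" for i j h
    unfolding sum_distrib_left by (subst sum.swap) (simp only: mult_ac)
  ultimately have "fund_matrix M L c v = transpose ?J ** (fund_matrix M L c' v ** ?J)"
    by (simp add: vec_eq_iff fund_matrix_def matrix_matrix_mult_def transpose_def)
  then have "det (fund_matrix M L c v) = (det ?J)\<^sup>2 * det (fund_matrix M L c' v)"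
    by (simp add: det_mul power2_eq_square)
  then show ?thesis
    by (simp add: vol_density_def abs_mult real_sqrt_mult)
qed

text \<open>A chart of the atlas may reverse the orientation, while \<open>vol_form\<close> is
  evaluated in an oriented chart; this is the sign between the two expressions. The reference chart
  is the same choice as in \<open>vol_form\<close>.\<close>

definition chart_sign :: "('m, 'n) chart \<Rightarrow> 'm \<Rightarrow> real" where
  "chart_sign c p = sgn (det (matrix (jacobian c (SOME c'. c' \<in> orientation M \<and> p \<in> cdom c') p)))"

lemma det_jacobian_trans:
  assumes "c \<in> charts_at M p" "c' \<in> charts_at M p" "c'' \<in> charts_at M p"
  shows "det (matrix (jacobian c c'' p)) = det (matrix (jacobian c' c'' p)) * det (matrix (jacobian c c' p))"
proof -
  have "jacobian c c'' p = jacobian c' c'' p \<circ> jacobian c c' p"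
    using jacobian_trans[OF assms] by (simp add: fun_eq_iff)
  then have "matrix (jacobian c c'' p) = matrix (jacobian c' c'' p) ** matrix (jacobian c c' p)"
    using assms by (simp add: matrix_compose jacobian_linear)
  then show ?thesis
    by (simp add: det_mul)
qed

lemma det_jacobian_nz:
  assumes "c \<in> charts_at M p" "c' \<in> charts_at M p"
  shows "det (matrix (jacobian c c' p)) \<noteq> 0"
proof -
  have "jacobian c c p = id"
    by (simp add: fun_eq_iff jacobian_self[OF assms(1)])
  then have "det (matrix (jacobian c c p)) = 1"
    by (simp add: matrix_id)
  then show ?thesis
    using det_jacobian_trans[OF assms(1,2,1)] by auto
qed

text \<open>The Jacobian between two oriented charts has positive determinant, so the chosen one can
  be replaced by any other.\<close>

lemma chart_sign_eq:
  assumes "c \<in> charts_at M p" "c' \<in> orientation M" "p \<in> cdom c'"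
  shows "chart_sign c p = sgn (det (matrix (jacobian c c' p)))"
proof -
  let ?c = "SOME c'. c' \<in> orientation M \<and> p \<in> cdom c'"
  have c0: "?c \<in> orientation M" "p \<in> cdom ?c"
    using someI_ex[OF oriented_chart_exists[of p]] by auto
  have "det (matrix (jacobian c ?c p)) = det (matrix (jacobian c' ?c p)) * det (matrix (jacobian c c' p))"
    by (rule det_jacobian_trans) (use assms c0 orientation_atlas in \<open>simp_all add: in_charts_at\<close>)
  then show ?thesis
    using jacobian_orientation[OF assms(2) c0(1) assms(3) c0(2)] by (simp add: chart_sign_def sgn_mult)
qed

lemma chart_sign_nz: "c \<in> charts_at M p \<Longrightarrow> chart_sign c p \<noteq> 0"
  using oriented_chart_exists[of p] chart_sign_eq[of c p] det_jacobian_nz[of c p] orientation_atlas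
  by (metis in_charts_at sgn_zero_iff)

text \<open>The oriented chart chosen in \<open>chart_sign\<close> may jump from point to point.
  With one oriented chart c' fixed around p, the sign is that of a continuous function without zeros
  on the overlap of c and c'.\<close>

lemma chart_sign_locally_constant:
  assumes c: "c \<in> charts_at M p"
  obtains S where "open S" "cmap c p \<in> S" "S \<subseteq> cmap c ` cdom c"
    "\<And>x. x \<in> S \<Longrightarrow> chart_sign c (cinv c x) = chart_sign c p"
proof -
  obtain c' where c': "c' \<in> orientation M" "p \<in> cdom c'"
    using oriented_chart_exists by blast
  have at: "c \<in> atlas M" "p \<in> cdom c" "c' \<in> atlas M"
    using c orientation_atlas[OF c'(1)] by (auto simp: in_charts_at)
  let ?U = "cmap c ` (cdom c \<inter> cdom c')"
  let ?f = "\<lambda>x. det (matrix (frechet_derivative (transition c c') (at x)))"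
  have U: "open ?U"
    by (rule open_overlap[OF at(1) open_cdom[OF at(3)]])
  have "smooth_on ?U (\<lambda>x. frechet_derivative (transition c c') (at x) (axis j 1) $ i)" for i j
    by (intro smooth_on_bounded_linear_compose[OF bounded_linear_vec_nth] U smooth_on_frechet_derivative
        transition_smooth at)
  then have "smooth_on ?U ?f"
    by (intro smooth_on_det U) (simp add: matrix_def)
  then have cont: "continuous_on ?U ?f"
    by (rule smooth_on_continuous_on)
  have sgn_f: "chart_sign c (cinv c x) = sgn (?f x)" if x: "x \<in> ?U" for x
  proof -
    obtain q where q: "x = cmap c q" "q \<in> cdom c" "q \<in> cdom c'"
      using x by blast
    then show ?thesis
      using chart_sign_eq[of c q c'] c'(1) at by (simp add: cinv_cmap in_charts_at jacobian_def)
  qed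
  have pU: "cmap c p \<in> ?U"
    using at c' by auto
  define s where "s = chart_sign c p"
  have s: "s = sgn (?f (cmap c p))" "s \<noteq> 0"
    using sgn_f[OF pU] chart_sign_nz[OF c] by (simp_all add: s_def cinv_cmap at)
  let ?S = "?U \<inter> (\<lambda>x. s * ?f x) -` {0<..}"
  show thesis
  proof
    show "open ?S"
      using U by (intro continuous_open_preimage continuous_on_mult_left cont) auto
    show "cmap c p \<in> ?S"
      using pU s by (simp add: sgn_if split: if_splits)
    show "?S \<subseteq> cmap c ` cdom c"
      by auto
    show "chart_sign c (cinv c x) = chart_sign c p" if "x \<in> ?S" for x
      using that s sgn_f[of x] unfolding s_def[symmetric] by (auto simp: sgn_if zero_less_mult_iff split: if_splits)
  qed
qed

text \<open>Passing to the oriented chart multiplies the frame determinant by det J; the absolute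
  value of det J is absorbed by the change of density, and its sign remains.\<close>

lemma vol_form_frame:
  assumes v: "v \<in> A" and c: "c \<in> charts_at M (fst v)"
    and Xs: "length Xs = CARD('n)" "set Xs \<subseteq> tangent_space M (fst v)"
  shows "vol_form M A L v [] Xs = chart_sign c (fst v) * vol_density c v * det (frame_matrix c Xs)"
proof -
  let ?c = "SOME c'. c' \<in> orientation M \<and> fst v \<in> cdom c'"
  let ?J = "matrix (jacobian c ?c (fst v))"
  have c0: "?c \<in> orientation M" "fst v \<in> cdom ?c"
    using someI_ex[OF oriented_chart_exists[of "fst v"]] by auto
  then have c0': "?c \<in> charts_at M (fst v)"
    by (simp add: in_charts_at orientation_atlas)
  have tan: "Xs ! to_nat_on (UNIV :: 'n set) j \<in> tangent_space M (fst v)" for j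
    using Xs enumeration_less[of j] by auto
  have "frame_matrix ?c Xs $ i $ j = (?J ** frame_matrix c Xs) $ i $ j" for i j
  proof -
    have "(Xs ! to_nat_on (UNIV :: 'n set) j) ?c = ?J *v ((Xs ! to_nat_on (UNIV :: 'n set) j) c)"
      using tangent_jacobian[OF tan c c0'] by (simp add: matrix_works jacobian_linear[OF c c0'])
    then show ?thesis
      by (simp add: frame_matrix_def matrix_matrix_mult_def matrix_vector_mult_def)
  qed
  then have "frame_matrix ?c Xs = ?J ** frame_matrix c Xs"
    by (simp add: vec_eq_iff)
  then have "det (frame_matrix ?c Xs) = det ?J * det (frame_matrix c Xs)"
    by (simp add: det_mul)
  moreover have "vol_form M A L v [] Xs = vol_density ?c v * det (frame_matrix ?c Xs)"
    using v Xs by (simp add: vol_form_def Let_def vol_density_def frame_matrix_def targs_def)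
  moreover have "a * (d * b) = sgn d * (\<bar>d\<bar> * a) * b" for a b d :: real
  proof -
    have "sgn d * (\<bar>d\<bar> * a) * b = (sgn d * \<bar>d\<bar>) * (a * b)"
      by (simp only: mult_ac)
    then show ?thesis
      unfolding sgn_mult_abs by (simp only: mult_ac)
  qed
  ultimately show ?thesis
    unfolding chart_sign_def vol_density_change[OF v c c0'] by metis
qed

end

section \<open>The Chern symbols\<close>

context finsler_manifold
begin

text \<open>Jacobi's formula in the horizontal direction, in which the matrix of g has the
  derivative with entries delta_k g_{ij}.\<close>

lemma delta_vol_density:
  assumes v: "v \<in> A" and c: "c \<in> charts_at M (fst v)"
  shows "delta M N c k (vol_density c) v =
    vol_density c v * (1/2 * (\<Sum>i\<in>UNIV. \<Sum>l\<in>UNIV. fund_inv M L c i l v * delta M N c k (fund_tensor M L c l i) v))"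
proof -
  have at: "c \<in> atlas M"
    using c by (simp add: in_charts_at)
  let ?z = "tcoord c v" and ?G = "\<lambda>z. fund_matrix M L c (tpoint M c z)"
  define f' where "f' u = (\<chi> i j. frechet_derivative (texpr M c (fund_tensor M L c i j)) (at ?z) u)" for u
  have Gv: "?G ?z = fund_matrix M L c v"
    by (simp add: tpoint_tcoord[OF v c])
  have 1: "((\<lambda>z. ?G z $ i $ j) has_derivative (\<lambda>u. f' u $ i $ j)) (at ?z)" for i j
    using texpr_has_derivative[OF fund_tensor_smooth[OF at] v c, of i j]
    by (simp add: f'_def fund_matrix_def texpr_def o_def)
  have 2: "invertible (?G ?z)"
    unfolding Gv by (rule fund_matrix_invertible[OF v c])
  have "(texpr M c (vol_density c) has_derivative
      (\<lambda>u. trace (f' u ** matrix_inv (?G ?z)) / 2 * sqrt \<bar>det (?G ?z)\<bar>)) (at ?z)"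
    using has_derivative_sqrt_abs_det[of ?G, OF 1 2] by (simp add: texpr_def o_def vol_density_def)
  then have "frechet_derivative (texpr M c (vol_density c)) (at ?z) =
      (\<lambda>u. trace (f' u ** matrix_inv (?G ?z)) / 2 * sqrt \<bar>det (?G ?z)\<bar>)"
    by (rule frechet_derivative_at[symmetric])
  then have "delta M N c k (vol_density c) v =
      trace (f' (axis k 1, - (\<chi> j. N c j k v)) ** matrix_inv (fund_matrix M L c v)) / 2 * vol_density c v"
    by (simp add: delta_frechet_derivative[OF c v vol_density_smooth[OF at]] Gv vol_density_def)
  also have "f' (axis k 1, - (\<chi> j. N c j k v)) = (\<chi> i j. delta M N c k (fund_tensor M L c i j) v)"
    by (simp add: f'_def vec_eq_iff delta_frechet_derivative[OF c v fund_tensor_smooth[OF at]])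
  also have "trace ((\<chi> i j. delta M N c k (fund_tensor M L c i j) v) ** matrix_inv (fund_matrix M L c v)) =
      (\<Sum>l\<in>UNIV. \<Sum>i\<in>UNIV. fund_inv M L c i l v * delta M N c k (fund_tensor M L c l i) v)"
    by (simp add: trace_def matrix_matrix_mult_def fund_inv_def mult.commute)
  also have "\<dots> = (\<Sum>i\<in>UNIV. \<Sum>l\<in>UNIV. fund_inv M L c i l v * delta M N c k (fund_tensor M L c l i) v)"
    by (rule sum.swap)
  finally show ?thesis
    by simp
qed

lemma chern_symbol_sym:
  assumes v: "v \<in> A" and c: "c \<in> charts_at M (fst v)"
  shows "chern_symbol M L c i j k v = chern_symbol M L c i k j v"
proof -
  have "delta M N c l (fund_tensor M L c j k) v = delta M N c l (fund_tensor M L c k j) v" for N l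
    by (rule delta_cong[OF c v fund_tensor_sym])
  then show ?thesis
    by (simp add: chern_symbol_def add.commute)
qed

text \<open>In the trace Gamma^i_{ki} the terms delta_i g_{lk} and delta_l g_{ki} are exchanged by
  swapping i and l; with the symmetric factor g^{il} they cancel, and half of g^{il} delta_k g_{li}
  remains.\<close>

lemma delta_vol_density_chern:
  assumes v: "v \<in> A" and c: "c \<in> charts_at M (fst v)"
  shows "delta M (metric_nl_conn M L) c k (vol_density c) v =
    vol_density c v * (\<Sum>i\<in>UNIV. chern_symbol M L c i k i v)"
proof -
  define d where "d l i k = delta M (metric_nl_conn M L) c k (fund_tensor M L c l i) v" for l i k
  define h where "h i l = fund_inv M L c i l v" for i l
  have h: "h i l = h l i" for i l
    by (simp add: h_def fund_inv_sym[OF v c])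
  have d: "d l i k = d i l k" for l i k
    unfolding d_def by (rule delta_cong[OF c v fund_tensor_sym])
  have "(\<Sum>i\<in>UNIV. \<Sum>l\<in>UNIV. h i l * d l k i) = (\<Sum>l\<in>UNIV. \<Sum>i\<in>UNIV. h i l * d l k i)"
    by (rule sum.swap)
  also have "\<dots> = (\<Sum>i\<in>UNIV. \<Sum>l\<in>UNIV. h i l * d k i l)"
    using h d by simp
  finally have "(\<Sum>i\<in>UNIV. chern_symbol M L c i k i v) = 1/2 * (\<Sum>i\<in>UNIV. \<Sum>l\<in>UNIV. h i l * d l i k)"
    by (simp add: chern_symbol_def d_def[symmetric] h_def[symmetric] sum_divide_distrib[symmetric]
        algebra_simps sum.distrib sum_subtractf)
  then show ?thesis
    unfolding delta_vol_density[OF v c] by (simp only: d_def h_def)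
qed

text \<open>Since delta_k g_{lj} is the x-derivative minus 2 N^m_k C_{ljm}, the Chern symbol is
  gamma minus three Cartan terms. On contraction with y^k, two of them carry y in a slot of C and
  vanish; the third becomes C_{ljm} G^m, the Cartan term in the definition of N.\<close>

lemma chern_symbol_nl_conn:
  assumes v: "v \<in> A" and c: "c \<in> charts_at M (fst v)"
  shows "(\<Sum>k\<in>UNIV. chern_symbol M L c i j k v * snd v c $ k) = metric_nl_conn M L c i j v"
proof -
  define y where "y k = snd v c $ k" for k
  define h where "h i l = fund_inv M L c i l v" for i l
  define C where "C i j k = cartan M L c i j k v" for i j k
  define \<gamma> where "\<gamma> i j k = formal_christoffel M L c i j k v" for i j k
  define N where "N i j = metric_nl_conn M L c i j v" for i j
  define G where "G m = (\<Sum>a\<in>UNIV. \<Sum>b\<in>UNIV. \<gamma> m a b * y a * y b)" for m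
  have C3: "(\<Sum>k\<in>UNIV. C i j k * y k) = 0" for i j
    using cartan_contract[OF v c] by (simp add: C_def y_def)
  have C2: "(\<Sum>k\<in>UNIV. C i k j * y k) = 0" for i j
    using C3[of i j] cartan_sym[OF v c, of i j] by (simp add: C_def)
  have N: "N i j = (\<Sum>k\<in>UNIV. \<gamma> i j k * y k) - (\<Sum>k\<in>UNIV. (\<Sum>l\<in>UNIV. h i l * C l j k) * G k)" for i j
    by (simp add: N_def metric_nl_conn_def \<gamma>_def y_def h_def C_def G_def)
  have zero: "(\<Sum>k\<in>UNIV. (\<Sum>n\<in>UNIV. (\<Sum>l\<in>UNIV. h m l * C l k n) * G n) * y k) = 0" for m
  proof -
    have "(\<Sum>k\<in>UNIV. (\<Sum>n\<in>UNIV. (\<Sum>l\<in>UNIV. h m l * C l k n) * G n) * y k) =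
        (\<Sum>k\<in>UNIV. \<Sum>n\<in>UNIV. \<Sum>l\<in>UNIV. h m l * G n * (C l k n * y k))"
      by (simp add: sum_distrib_left sum_distrib_right mult_ac)
    also have "\<dots> = (\<Sum>n\<in>UNIV. \<Sum>k\<in>UNIV. \<Sum>l\<in>UNIV. h m l * G n * (C l k n * y k))"
      by (rule sum.swap)
    also have "\<dots> = (\<Sum>n\<in>UNIV. \<Sum>l\<in>UNIV. \<Sum>k\<in>UNIV. h m l * G n * (C l k n * y k))"
      by (intro sum.cong refl sum.swap)
    also have "\<dots> = 0"
      by (simp add: sum_distrib_left[symmetric] C2)
    finally show ?thesis .
  qed
  \<comment> \<open>The Cartan term of N vanishes on y, so N applied to y is the quadratic
    expression G that occurs in the definition of N itself.\<close>
  have Ny: "(\<Sum>k\<in>UNIV. N m k * y k) = G m" for m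
  proof -
    have "(\<Sum>k\<in>UNIV. (\<Sum>b\<in>UNIV. \<gamma> m k b * y b) * y k) = G m"
      unfolding G_def sum_distrib_right by (simp only: mult_ac)
    then show ?thesis
      by (simp only: N left_diff_distrib sum_subtractf zero diff_zero)
  qed
  have dg: "delta M (metric_nl_conn M L) c k (fund_tensor M L c l j) v =
      dx_partial M c k (fund_tensor M L c l j) v - 2 * (\<Sum>m\<in>UNIV. N m k * C l j m)" for k l j
    by (simp add: delta_def N_def C_def cartan_def sum_distrib_left)
  have chern: "chern_symbol M L c i j k v = \<gamma> i j k - (\<Sum>l\<in>UNIV. h i l *
      ((\<Sum>m\<in>UNIV. N m k * C l j m) + (\<Sum>m\<in>UNIV. N m j * C l k m) - (\<Sum>m\<in>UNIV. N m l * C j k m)))" for k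
    unfolding chern_symbol_def \<gamma>_def formal_christoffel_def dg h_def[symmetric]
    by (simp add: algebra_simps sum.distrib sum_subtractf sum_distrib_left)
  have t1: "(\<Sum>k\<in>UNIV. (\<Sum>m\<in>UNIV. N m k * C l j m) * y k) = (\<Sum>m\<in>UNIV. C l j m * G m)" for l
  proof -
    have "(\<Sum>k\<in>UNIV. (\<Sum>m\<in>UNIV. N m k * C l j m) * y k) = (\<Sum>k\<in>UNIV. \<Sum>m\<in>UNIV. C l j m * (N m k * y k))"
      unfolding sum_distrib_right by (simp only: mult_ac)
    also have "\<dots> = (\<Sum>m\<in>UNIV. \<Sum>k\<in>UNIV. C l j m * (N m k * y k))"
      by (rule sum.swap)
    finally show ?thesis
      by (simp add: sum_distrib_left[symmetric] Ny)
  qed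
  have t2: "(\<Sum>k\<in>UNIV. (\<Sum>m\<in>UNIV. N m n * C l k m) * y k) = 0" for n l
  proof -
    have "(\<Sum>k\<in>UNIV. (\<Sum>m\<in>UNIV. N m n * C l k m) * y k) = (\<Sum>k\<in>UNIV. \<Sum>m\<in>UNIV. N m n * (C l k m * y k))"
      unfolding sum_distrib_right by (simp only: mult_ac)
    also have "\<dots> = (\<Sum>m\<in>UNIV. \<Sum>k\<in>UNIV. N m n * (C l k m * y k))"
      by (rule sum.swap)
    finally show ?thesis
      by (simp add: sum_distrib_left[symmetric] C2)
  qed
  have "(\<Sum>k\<in>UNIV. (\<Sum>l\<in>UNIV. h i l *
      ((\<Sum>m\<in>UNIV. N m k * C l j m) + (\<Sum>m\<in>UNIV. N m j * C l k m) - (\<Sum>m\<in>UNIV. N m l * C j k m))) * y k) =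
    (\<Sum>k\<in>UNIV. \<Sum>l\<in>UNIV. h i l *
      ((\<Sum>m\<in>UNIV. N m k * C l j m) * y k + (\<Sum>m\<in>UNIV. N m j * C l k m) * y k - (\<Sum>m\<in>UNIV. N m l * C j k m) * y k))"
    by (simp only: sum_distrib_right[of _ _ "y _"] mult.assoc distrib_right left_diff_distrib)
  also have "\<dots> = (\<Sum>l\<in>UNIV. \<Sum>k\<in>UNIV. h i l *
      ((\<Sum>m\<in>UNIV. N m k * C l j m) * y k + (\<Sum>m\<in>UNIV. N m j * C l k m) * y k - (\<Sum>m\<in>UNIV. N m l * C j k m) * y k))"
    by (rule sum.swap)
  also have "\<dots> = (\<Sum>l\<in>UNIV. h i l * (\<Sum>m\<in>UNIV. C l j m * G m))"
    by (simp only: sum_distrib_left[symmetric] sum.distrib sum_subtractf t1 t2) simp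
  also have "\<dots> = (\<Sum>k\<in>UNIV. (\<Sum>l\<in>UNIV. h i l * C l j k) * G k)"
    unfolding sum_distrib_left sum_distrib_right by (subst sum.swap) (simp only: mult_ac)
  finally show ?thesis
    unfolding N_def[symmetric] N y_def[symmetric] chern left_diff_distrib sum_subtractf by simp
qed

end

section \<open>Tensor derivations evaluated on vector fields\<close>

context conic_manifold
begin

lemma targs_iff:
  "(ws, Xs) \<in> targs M p r s \<longleftrightarrow> length ws = r \<and> set ws \<subseteq> cotangent_space M p \<and>
    length Xs = s \<and> set Xs \<subseteq> tangent_space M p"
  by (simp add: targs_def)

lemma tensors_at_outside: "t \<in> tensors_at M p r s \<Longrightarrow> (ws, Xs) \<notin> targs M p r s \<Longrightarrow> t ws Xs = 0"
  unfolding tensors_at_def by blast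

lemma tensors_at_covec:
  "t \<in> tensors_at M p r s \<Longrightarrow> (ws, Xs) \<in> targs M p r s \<Longrightarrow> \<mu> < r \<Longrightarrow>
    \<omega> \<in> cotangent_space M p \<Longrightarrow> \<eta> \<in> cotangent_space M p \<Longrightarrow>
    t (ws[\<mu> := (\<lambda>u. a * \<omega> u + b * \<eta> u)]) Xs = a * t (ws[\<mu> := \<omega>]) Xs + b * t (ws[\<mu> := \<eta>]) Xs"
  unfolding tensors_at_def by blast

lemma tensors_at_vec:
  "t \<in> tensors_at M p r s \<Longrightarrow> (ws, Xs) \<in> targs M p r s \<Longrightarrow> \<nu> < s \<Longrightarrow>
    X \<in> tangent_space M p \<Longrightarrow> Y \<in> tangent_space M p \<Longrightarrow>
    t ws (Xs[\<nu> := tcomb a X b Y]) = a * t ws (Xs[\<nu> := X]) + b * t ws (Xs[\<nu> := Y])"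
  unfolding tensors_at_def by blast

lemma tensors_atI:
  assumes "\<And>ws Xs. (ws, Xs) \<notin> targs M p r s \<Longrightarrow> t ws Xs = 0"
    and "\<And>ws Xs \<mu> \<omega> \<eta> a b. (ws, Xs) \<in> targs M p r s \<Longrightarrow> \<mu> < r \<Longrightarrow>
      \<omega> \<in> cotangent_space M p \<Longrightarrow> \<eta> \<in> cotangent_space M p \<Longrightarrow>
      t (ws[\<mu> := (\<lambda>u. a * \<omega> u + b * \<eta> u)]) Xs = a * t (ws[\<mu> := \<omega>]) Xs + b * t (ws[\<mu> := \<eta>]) Xs"
    and "\<And>ws Xs \<nu> X Y a b. (ws, Xs) \<in> targs M p r s \<Longrightarrow> \<nu> < s \<Longrightarrow>
      X \<in> tangent_space M p \<Longrightarrow> Y \<in> tangent_space M p \<Longrightarrow>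
      t ws (Xs[\<nu> := tcomb a X b Y]) = a * t ws (Xs[\<nu> := X]) + b * t ws (Xs[\<nu> := Y])"
  shows "t \<in> tensors_at M p r s"
  using assms unfolding tensors_at_def by blast

lemma aniso_tensors_at: "T \<in> aniso_tensors M A r s \<Longrightarrow> v \<in> A \<Longrightarrow> T v \<in> tensors_at M (fst v) r s"
  unfolding aniso_tensors_def by blast

lemma aniso_outside: "T \<in> aniso_tensors M A r s \<Longrightarrow> v \<notin> A \<Longrightarrow> T v = (\<lambda>ws Xs. 0)"
  unfolding aniso_tensors_def by blast

lemma aniso_smooth_comp:
  "T \<in> aniso_tensors M A r s \<Longrightarrow> c \<in> atlas M \<Longrightarrow> length is = r \<Longrightarrow> length js = s \<Longrightarrow> smooth_in c (tcomp M c T is js)"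
  unfolding aniso_tensors_def by blast

lemma aniso_tensorsI:
  assumes "\<And>v. v \<in> A \<Longrightarrow> T v \<in> tensors_at M (fst v) r s"
    and "\<And>v. v \<notin> A \<Longrightarrow> T v = (\<lambda>ws Xs. 0)"
    and "\<And>c is js. c \<in> atlas M \<Longrightarrow> length is = r \<Longrightarrow> length js = s \<Longrightarrow> smooth_in c (tcomp M c T is js)"
  shows "T \<in> aniso_tensors M A r s"
  using assms unfolding aniso_tensors_def by blast

lemma tensor_tlift_sum:
  assumes t: "t \<in> tensors_at M p r s" and Xs: "(ws, Xs) \<in> targs M p r s" and \<nu>: "\<nu> < s"
    and c: "c \<in> charts_at M p"
  shows "t ws (Xs[\<nu> := tlift M c p y]) = (\<Sum>i\<in>UNIV. y $ i * t ws (Xs[\<nu> := coord_vec M c i p]))"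
proof -
  have *: "t ws (Xs[\<nu> := tlift M c p (a *\<^sub>R y + b *\<^sub>R z)]) =
      a * t ws (Xs[\<nu> := tlift M c p y]) + b * t ws (Xs[\<nu> := tlift M c p z])" for a b y z
    unfolding tlift_lincomb[OF c] by (rule tensors_at_vec[OF t Xs \<nu> tlift_tangent[OF c] tlift_tangent[OF c]])
  have lin: "linear (\<lambda>y. t ws (Xs[\<nu> := tlift M c p y]))"
  proof (rule linearI)
    show "t ws (Xs[\<nu> := tlift M c p (y + z)]) = t ws (Xs[\<nu> := tlift M c p y]) + t ws (Xs[\<nu> := tlift M c p z])" for y z
      using *[of 1 y 1 z] by simp
    show "t ws (Xs[\<nu> := tlift M c p (a *\<^sub>R y)]) = a *\<^sub>R t ws (Xs[\<nu> := tlift M c p y])" for a y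
      using *[of a y 0 y] by simp
  qed
  have "t ws (Xs[\<nu> := tlift M c p y]) = t ws (Xs[\<nu> := tlift M c p (\<Sum>i\<in>UNIV. y $ i *\<^sub>R axis i 1)])"
    using basis_expansion[of y] by (simp add: scalar_mult_eq_scaleR)
  also have "\<dots> = (\<Sum>i\<in>UNIV. y $ i * t ws (Xs[\<nu> := coord_vec M c i p]))"
    by (simp add: linear_sum[OF lin] linear_scale[OF lin] coord_vec_def)
  finally show ?thesis .
qed

lemma tensor10_covec_sum:
  assumes t: "t \<in> tensors_at M p 1 0" and c: "c \<in> charts_at M p"
  shows "t [\<lambda>u. \<Sum>i\<in>I. a i * coord_covec M c i p u] [] = (\<Sum>i\<in>I. a i * t [coord_covec M c i p] [])"
proof -
  note dx = coord_covec_cotangent[OF c]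
  have *: "t [\<lambda>u. a * \<omega> u + b * \<eta> u] [] = a * t [\<omega>] [] + b * t [\<eta>] []"
    if "\<omega> \<in> cotangent_space M p" "\<eta> \<in> cotangent_space M p" for a b \<omega> \<eta>
    using tensors_at_covec[OF t, of "[\<omega>]" "[]" 0 \<omega> \<eta> a b] that by (simp add: targs_iff)
  \<comment> \<open>Membership is carried through the induction, since linearity of t is available
    only at covectors of the cotangent space.\<close>
  have "(\<lambda>u. \<Sum>i\<in>I. a i * coord_covec M c i p u) \<in> cotangent_space M p \<and>
    t [\<lambda>u. \<Sum>i\<in>I. a i * coord_covec M c i p u] [] = (\<Sum>i\<in>I. a i * t [coord_covec M c i p] [])"
    using finite[of I]
  proof (induction I rule: finite_induct)
    case empty
    show ?case
      \<comment> \<open>Coefficients 0 produce the zero covector.\<close>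
      using *[OF dx dx, of 0 _ 0] cotangent_lincomb[OF dx dx, of 0 _ 0] by simp
  next
    case (insert i I)
    then show ?case
      using *[OF dx conjunct1[OF insert.IH], of "a i" i 1]
        cotangent_lincomb[OF dx conjunct1[OF insert.IH], of "a i" i 1] by simp
  qed
  then show ?thesis ..
qed

text \<open>A field of type (1, 0) is a function on covectors; this is the tangent vector that
  represents it, by the identification with the bidual. The chart is chosen as in
  \<open>contract\<close>, so that a contraction unfolds to this vector.\<close>

definition vec_at :: "('m, 'n) tfield \<Rightarrow> ('m, 'n) tm \<Rightarrow> ('m, 'n) tvec" where
  "vec_at X v = (let c = (SOME c. c \<in> charts_at M (fst v)) in tlift M c (fst v) (\<chi> i. vcomp M c X i v))"

lemma vec_at_tangent: "vec_at X v \<in> tangent_space M (fst v)"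
  by (simp add: vec_at_def Let_def tlift_tangent some_chart)

text \<open>Expanding the covector in coordinate covectors reduces the claim to components. As it
  holds for all covectors, it also frees \<open>vec_at\<close> from the chosen chart.\<close>

lemma covec_vec_at:
  assumes X: "X \<in> aniso_vector_fields M A" and v: "v \<in> A" and \<omega>: "\<omega> \<in> cotangent_space M (fst v)"
  shows "X v [\<omega>] [] = \<omega> (vec_at X v)"
proof -
  let ?c = "SOME c. c \<in> charts_at M (fst v)"
  note c = some_chart[of "fst v"]
  have "X v [\<omega>] [] = X v [\<lambda>u. \<Sum>i\<in>UNIV. \<omega> (coord_vec M ?c i (fst v)) * coord_covec M ?c i (fst v) u] []"
    using cotangent_expand[OF \<omega> c] by (rule arg_cong)
  also have "\<dots> = (\<Sum>i\<in>UNIV. \<omega> (coord_vec M ?c i (fst v)) * X v [coord_covec M ?c i (fst v)] [])"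
    by (rule tensor10_covec_sum[OF aniso_tensors_at[OF X v] c])
  also have "\<dots> = \<omega> (vec_at X v)"
    by (simp add: vec_at_def Let_def cotangent_tlift_sum[OF \<omega> c] tcomp_def mult.commute)
  finally show ?thesis .
qed

lemma vec_at_chart:
  assumes "X \<in> aniso_vector_fields M A" "v \<in> A" "c \<in> charts_at M (fst v)"
  shows "vec_at X v c $ i = vcomp M c X i v"
  using covec_vec_at[OF assms(1,2) coord_covec_cotangent[OF assms(3)], of i]
  by (simp add: tcomp_def coord_covec_apply[OF vec_at_tangent])

text \<open>The interior product with X, written through tensor product and contraction because
  these are the operations that a tensor derivation has to respect.\<close>

definition insert_field :: "('m, 'n) tfield \<Rightarrow> ('m, 'n) tfield \<Rightarrow> ('m, 'n) tfield" where
  "insert_field X T = contract M 0 0 (tens_prod 1 0 X T)"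

text \<open>The laws of a tensor derivation hold for members of \<open>aniso_tensors\<close>, so
  each construction has to be kept inside this set.\<close>

lemma tens_prod_aniso:
  assumes X: "X \<in> aniso_vector_fields M A" and T: "T \<in> aniso_tensors M A 0 s"
  shows "tens_prod 1 0 X T \<in> aniso_tensors M A 1 s"
proof (rule aniso_tensorsI)
  fix v assume v: "v \<in> A"
  note Xv = aniso_tensors_at[OF X v] and Tv = aniso_tensors_at[OF T v]
  show "tens_prod 1 0 X T v \<in> tensors_at M (fst v) 1 s"
  proof (rule tensors_atI)
    fix ws Xs assume "(ws, Xs) \<notin> targs M (fst v) 1 s"
    then have "(take 1 ws, []) \<notin> targs M (fst v) 1 0 \<or> (drop 1 ws, Xs) \<notin> targs M (fst v) 0 s"
      by (cases ws) (auto simp: targs_iff simp del: split_paired_All)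
    then show "tens_prod 1 0 X T v ws Xs = 0"
      using tensors_at_outside[OF Xv, of "take 1 ws" "[]"] tensors_at_outside[OF Tv, of "drop 1 ws" Xs]
      by (auto simp: tens_prod_def)
  next
    fix ws Xs \<omega> \<eta> and \<mu> :: nat and a b :: real
    assume h: "(ws, Xs) \<in> targs M (fst v) 1 s" "\<mu> < 1" "\<omega> \<in> cotangent_space M (fst v)" "\<eta> \<in> cotangent_space M (fst v)"
    then obtain w where w: "ws = [w]" "w \<in> cotangent_space M (fst v)"
      by (cases ws) (auto simp: targs_iff)
    have "X v [\<lambda>u. a * \<omega> u + b * \<eta> u] [] = a * X v [\<omega>] [] + b * X v [\<eta>] []"
      using tensors_at_covec[OF Xv, of "[\<omega>]" "[]" 0 \<omega> \<eta> a b] h by (simp add: targs_iff)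
    then show "tens_prod 1 0 X T v (ws[\<mu> := \<lambda>u. a * \<omega> u + b * \<eta> u]) Xs =
        a * tens_prod 1 0 X T v (ws[\<mu> := \<omega>]) Xs + b * tens_prod 1 0 X T v (ws[\<mu> := \<eta>]) Xs"
      using h(2) by (simp add: tens_prod_def w algebra_simps)
  next
    fix ws Xs Y Y' and \<nu> :: nat and a b :: real
    assume h: "(ws, Xs) \<in> targs M (fst v) 1 s" "\<nu> < s" "Y \<in> tangent_space M (fst v)" "Y' \<in> tangent_space M (fst v)"
    have "T v [] (Xs[\<nu> := tcomb a Y b Y']) = a * T v [] (Xs[\<nu> := Y]) + b * T v [] (Xs[\<nu> := Y'])"
      by (rule tensors_at_vec[OF Tv _ h(2-4)]) (use h(1) in \<open>simp add: targs_iff\<close>)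
    then show "tens_prod 1 0 X T v ws (Xs[\<nu> := tcomb a Y b Y']) =
        a * tens_prod 1 0 X T v ws (Xs[\<nu> := Y]) + b * tens_prod 1 0 X T v ws (Xs[\<nu> := Y'])"
      using h(1) by (simp add: tens_prod_def targs_iff algebra_simps)
  qed
next
  fix v assume "v \<notin> A"
  then show "tens_prod 1 0 X T v = (\<lambda>ws Xs. 0)"
    using aniso_outside[OF X] by (simp add: tens_prod_def fun_eq_iff)
next
  fix c and "is" js :: "'n list"
  assume c: "c \<in> atlas M" and len: "length is = 1" "length js = s"
  obtain i where i: "is = [i]"
    using len(1) by (cases "is") auto
  have "smooth_in c (\<lambda>v. vcomp M c X i v * tcomp M c T [] js v)"
    by (intro smooth_in_mult c aniso_smooth_comp[OF X] aniso_smooth_comp[OF T]) (simp_all add: len)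
  then show "smooth_in c (tcomp M c (tens_prod 1 0 X T) is js)"
    by (simp add: tcomp_def[abs_def] tens_prod_def i)
qed

lemma insert_field_apply:
  assumes X: "X \<in> aniso_vector_fields M A" and T: "T \<in> aniso_tensors M A 0 (Suc s)" and v: "v \<in> A"
    and Xs: "length Xs = s" "set Xs \<subseteq> tangent_space M (fst v)"
  shows "insert_field X T v [] Xs = T v [] (vec_at X v # Xs)"
proof -
  let ?c = "SOME c. c \<in> charts_at M (fst v)"
  note c = some_chart[of "fst v"]
  have "([], vec_at X v # Xs) \<in> targs M (fst v) 0 (Suc s)"
    using Xs by (simp add: targs_iff vec_at_tangent)
  from tensor_tlift_sum[OF aniso_tensors_at[OF T v] this zero_less_Suc c, of "\<chi> i. vcomp M ?c X i v"]
  have "T v [] (tlift M ?c (fst v) (\<chi> i. vcomp M ?c X i v) # Xs) =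
      (\<Sum>i\<in>UNIV. vcomp M ?c X i v * T v [] (coord_vec M ?c i (fst v) # Xs))"
    by simp
  then show ?thesis
    by (simp add: insert_field_def contract_def Let_def insert_at_def tens_prod_def tcomp_def vec_at_def)
qed

lemma insert_field_aniso:
  assumes X: "X \<in> aniso_vector_fields M A" and T: "T \<in> aniso_tensors M A 0 (Suc s)"
  shows "insert_field X T \<in> aniso_tensors M A 0 s"
proof (rule aniso_tensorsI)
  fix v assume v: "v \<in> A"
  note Tv = aniso_tensors_at[OF T v]
  show "insert_field X T v \<in> tensors_at M (fst v) 0 s"
  proof (rule tensors_atI)
    fix ws Xs assume h: "(ws, Xs) \<notin> targs M (fst v) 0 s"
    have "(ws, y # Xs) \<notin> targs M (fst v) 0 (Suc s)" for y
      using h by (simp add: targs_iff)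
    then show "insert_field X T v ws Xs = 0"
      using tensors_at_outside[OF Tv] by (simp add: insert_field_def contract_def Let_def insert_at_def tens_prod_def)
  next
    fix ws Xs Y Y' and \<nu> :: nat and a b :: real
    assume h: "(ws, Xs) \<in> targs M (fst v) 0 s" "\<nu> < s" "Y \<in> tangent_space M (fst v)" "Y' \<in> tangent_space M (fst v)"
    then have ws: "ws = []" and Xs: "length Xs = s" "set Xs \<subseteq> tangent_space M (fst v)"
      by (auto simp: targs_iff)
    have upd: "set (Xs[\<nu> := y]) \<subseteq> tangent_space M (fst v)" if "y \<in> tangent_space M (fst v)" for y
      using set_update_subset_insert[of Xs \<nu> y] Xs that by blast
    have "([], vec_at X v # Xs) \<in> targs M (fst v) 0 (Suc s)"
      using Xs by (simp add: targs_iff vec_at_tangent)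
    from tensors_at_vec[OF Tv this, of "Suc \<nu>" Y Y' a b] h
    show "insert_field X T v ws (Xs[\<nu> := tcomb a Y b Y']) =
        a * insert_field X T v ws (Xs[\<nu> := Y]) + b * insert_field X T v ws (Xs[\<nu> := Y'])"
      by (simp add: ws insert_field_apply[OF X T v] upd tcomb_tangent Xs)
  qed simp
next
  fix v assume "v \<notin> A"
  then show "insert_field X T v = (\<lambda>ws Xs. 0)"
    using aniso_outside[OF X] by (simp add: insert_field_def contract_def tens_prod_def Let_def fun_eq_iff)
next
  fix c and "is" js :: "'n list"
  assume c: "c \<in> atlas M" and len: "length is = 0" "length js = s"
  \<comment> \<open>In every chart the components are X^i T_{i j ...}, whichever chart
    \<open>contract\<close> has picked at the point.\<close>
  have "smooth_in c (\<lambda>v. \<Sum>i\<in>UNIV. vcomp M c X i v * tcomp M c T [] (i # js) v)"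
    by (intro smooth_in_sum smooth_in_mult c aniso_smooth_comp[OF X] aniso_smooth_comp[OF T]) (simp_all add: len)
  also have "smooth_in c (\<lambda>v. \<Sum>i\<in>UNIV. vcomp M c X i v * tcomp M c T [] (i # js) v) =
      smooth_in c (tcomp M c (insert_field X T) is js)"
  proof (rule smooth_in_cong[OF c])
    fix v assume v: "v \<in> A" "c \<in> charts_at M (fst v)"
    let ?Xs = "map (\<lambda>j. coord_vec M c j (fst v)) js"
    have Xs: "length ?Xs = s" "set ?Xs \<subseteq> tangent_space M (fst v)"
      using len coord_vec_tangent[OF v(2)] by auto
    then have "([], vec_at X v # ?Xs) \<in> targs M (fst v) 0 (Suc s)"
      by (simp add: targs_iff vec_at_tangent)
    from tensor_tlift_sum[OF aniso_tensors_at[OF T v(1)] this zero_less_Suc v(2), of "vec_at X v c"]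
    have "T v [] (vec_at X v # ?Xs) = (\<Sum>i\<in>UNIV. vcomp M c X i v * T v [] (coord_vec M c i (fst v) # ?Xs))"
      by (simp add: tlift_tangent_eq[OF vec_at_tangent v(2)] vec_at_chart[OF X v])
    then show "(\<Sum>i\<in>UNIV. vcomp M c X i v * tcomp M c T [] (i # js) v) = tcomp M c (insert_field X T) is js v"
      using len insert_field_apply[OF X T v(1) Xs] by (simp add: tcomp_def)
  qed
  finally show "smooth_in c (tcomp M c (insert_field X T) is js)" .
qed

lemma
  assumes "tensor_derivation M A D"
  shows derivation_aniso: "T \<in> aniso_tensors M A r s \<Longrightarrow> D r s T \<in> aniso_tensors M A r s"
    and derivation_tens_prod: "T \<in> aniso_tensors M A r s \<Longrightarrow> S \<in> aniso_tensors M A r' s' \<Longrightarrow>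
        D (r + r') (s + s') (tens_prod r s T S) =
          tens_lin 1 (tens_prod r s (D r s T) S) 1 (tens_prod r s T (D r' s' S))"
    and derivation_contract: "T \<in> aniso_tensors M A (Suc r) (Suc s) \<Longrightarrow> a \<le> r \<Longrightarrow> b \<le> s \<Longrightarrow>
        D r s (contract M a b T) = contract M a b (D (Suc r) (Suc s) T)"
proof -
  note h = assms[unfolded tensor_derivation_def]
  show "T \<in> aniso_tensors M A r s \<Longrightarrow> D r s T \<in> aniso_tensors M A r s"
    by (rule conjunct1[OF h, rule_format])
  show "T \<in> aniso_tensors M A r s \<Longrightarrow> S \<in> aniso_tensors M A r' s' \<Longrightarrow>
      D (r + r') (s + s') (tens_prod r s T S) =
        tens_lin 1 (tens_prod r s (D r s T) S) 1 (tens_prod r s T (D r' s' S))"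
    by (rule conjunct1[OF conjunct2[OF conjunct2[OF h]], rule_format])
  show "T \<in> aniso_tensors M A (Suc r) (Suc s) \<Longrightarrow> a \<le> r \<Longrightarrow> b \<le> s \<Longrightarrow>
      D r s (contract M a b T) = contract M a b (D (Suc r) (Suc s) T)"
    by (rule conjunct2[OF conjunct2[OF conjunct2[OF h]], rule_format]) simp_all
qed

text \<open>Commutation with the contraction and the Leibniz rule for the tensor product of X and T
  give D(i_X T) = i_{DX} T + i_X (D T).\<close>

lemma derivation_insert_field:
  assumes D: "tensor_derivation M A D"
    and X: "X \<in> aniso_vector_fields M A" and T: "T \<in> aniso_tensors M A 0 (Suc s)" and v: "v \<in> A"
    and Xs: "length Xs = s" "set Xs \<subseteq> tangent_space M (fst v)"
  shows "D 0 s (insert_field X T) v [] Xs =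
    T v [] (vec_at (D 1 0 X) v # Xs) + D 0 (Suc s) T v [] (vec_at X v # Xs)"
proof -
  have "D 0 s (insert_field X T) = contract M 0 0 (D 1 (Suc s) (tens_prod 1 0 X T))"
    using derivation_contract[OF D, of "tens_prod 1 0 X T" 0 s 0 0] tens_prod_aniso[OF X T]
    by (simp add: insert_field_def)
  also have "D 1 (Suc s) (tens_prod 1 0 X T) =
      tens_lin 1 (tens_prod 1 0 (D 1 0 X) T) 1 (tens_prod 1 0 X (D 0 (Suc s) T))"
    using derivation_tens_prod[OF D X T] by simp
  finally have "D 0 s (insert_field X T) v [] Xs =
      insert_field (D 1 0 X) T v [] Xs + insert_field X (D 0 (Suc s) T) v [] Xs"
    by (simp add: insert_field_def contract_def tens_lin_def Let_def sum.distrib)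
  then show ?thesis
    using insert_field_apply[OF derivation_aniso[OF D X] T v Xs]
      insert_field_apply[OF X derivation_aniso[OF D T] v Xs] by simp
qed

primrec insert_fields :: "('m, 'n) tfield \<Rightarrow> ('m, 'n) tfield list \<Rightarrow> ('m, 'n) tfield" where
  "insert_fields T [] = T"
| "insert_fields T (X # XL) = insert_fields (insert_field X T) XL"

lemma insert_fields_aniso:
  "T \<in> aniso_tensors M A 0 (length XL) \<Longrightarrow> set XL \<subseteq> aniso_vector_fields M A \<Longrightarrow>
    insert_fields T XL \<in> aniso_tensors M A 0 0"
  by (induction XL arbitrary: T) (simp_all add: insert_field_aniso)

lemma insert_fields_apply:
  "T \<in> aniso_tensors M A 0 (length XL) \<Longrightarrow> set XL \<subseteq> aniso_vector_fields M A \<Longrightarrow> v \<in> A \<Longrightarrow>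
    insert_fields T XL v [] [] = T v [] (map (\<lambda>X. vec_at X v) XL)"
proof (induction XL arbitrary: T)
  case (Cons X XL)
  have "insert_fields T (X # XL) v [] [] = insert_field X T v [] (map (\<lambda>X. vec_at X v) XL)"
    using Cons by (simp add: insert_field_aniso)
  also have "\<dots> = T v [] (map (\<lambda>X. vec_at X v) (X # XL))"
    using Cons.prems by (subst insert_field_apply) (simp_all add: vec_at_tangent image_subset_iff)
  finally show ?case .
qed simp

text \<open>To be solved for the term with D T: the left side is D of a function and the sum
  contains only D of vector fields, so the action on functions and vector fields determines D on
  covariant tensors.\<close>

lemma derivation_insert_fields:
  assumes D: "tensor_derivation M A D" and v: "v \<in> A"
  shows "T \<in> aniso_tensors M A 0 (length XL) \<Longrightarrow> set XL \<subseteq> aniso_vector_fields M A \<Longrightarrow>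
    D 0 0 (insert_fields T XL) v [] [] = D 0 (length XL) T v [] (map (\<lambda>X. vec_at X v) XL) +
      (\<Sum>\<nu><length XL. T v [] ((map (\<lambda>X. vec_at X v) XL)[\<nu> := vec_at (D 1 0 (XL ! \<nu>)) v]))"
proof (induction XL arbitrary: T)
  case (Cons X XL)
  let ?V = "map (\<lambda>X. vec_at X v) XL"
  have X: "X \<in> aniso_vector_fields M A" and XL: "set XL \<subseteq> aniso_vector_fields M A"
    and T: "T \<in> aniso_tensors M A 0 (Suc (length XL))"
    using Cons.prems by auto
  have V: "length ?V = length XL" "set ?V \<subseteq> tangent_space M (fst v)"
    by (simp_all add: vec_at_tangent image_subset_iff)
  have V': "set (?V[\<nu> := vec_at Y v]) \<subseteq> tangent_space M (fst v)" for \<nu> Y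
    using set_update_subset_insert[of ?V \<nu> "vec_at Y v"] V vec_at_tangent by blast
  have "D 0 0 (insert_fields T (X # XL)) v [] [] = D 0 (length XL) (insert_field X T) v [] ?V +
      (\<Sum>\<nu><length XL. insert_field X T v [] (?V[\<nu> := vec_at (D 1 0 (XL ! \<nu>)) v]))"
    using Cons.IH[OF insert_field_aniso[OF X T] XL] by simp
  also have "\<dots> = D 0 (Suc (length XL)) T v [] (vec_at X v # ?V) + (T v [] (vec_at (D 1 0 X) v # ?V) +
      (\<Sum>\<nu><length XL. T v [] (vec_at X v # ?V[\<nu> := vec_at (D 1 0 (XL ! \<nu>)) v])))"
    by (simp add: derivation_insert_field[OF D X T v V] insert_field_apply[OF X T v] V')
  \<comment> \<open>The term with D applied to the first field becomes the summand of slot 0, and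
    the other slots move up by one.\<close>
  also have "T v [] (vec_at (D 1 0 X) v # ?V) +
      (\<Sum>\<nu><length XL. T v [] (vec_at X v # ?V[\<nu> := vec_at (D 1 0 (XL ! \<nu>)) v])) =
      (\<Sum>\<nu><Suc (length XL). T v [] ((vec_at X v # ?V)[\<nu> := vec_at (D 1 0 ((X # XL) ! \<nu>)) v]))"
    by (simp add: sum.lessThan_Suc_shift del: sum.lessThan_Suc)
  finally show ?case
    by simp
qed simp

text \<open>The constant vector is multiplied by a bump function and extended by zero. In another
  chart it is smooth above the domain of c, by the transition maps, and it is zero above the
  complement of the image of K; these open sets cover M because that image lies in the domain of
  c.\<close>

lemma constant_field_extension:
  assumes c: "c \<in> charts_at M p"
  obtains X S where "X \<in> aniso_vector_fields M A" "open S" "cmap c p \<in> S"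
    "\<And>u i. u \<in> A \<Longrightarrow> c \<in> charts_at M (fst u) \<Longrightarrow> cmap c (fst u) \<in> S \<Longrightarrow> vcomp M c X i u = w $ i"
proof -
  have at: "c \<in> atlas M" "p \<in> cdom c"
    using c by (auto simp: in_charts_at)
  obtain \<beta> :: "real^'n \<Rightarrow> real" and K V where \<beta>: "smooth_on UNIV \<beta>" "compact K" "K \<subseteq> cmap c ` cdom c"
    "\<And>x. x \<notin> K \<Longrightarrow> \<beta> x = 0" "open V" "cmap c p \<in> V" "\<And>x. x \<in> V \<Longrightarrow> \<beta> x = 1"
    using smooth_bump_exists[OF open_cmap[OF at(1)] imageI[OF at(2)]] by metis
  define b where "b q = (if q \<in> cdom c then \<beta> (cmap c q) else 0)" for q
  \<comment> \<open>The vector depends on the base point only. It is entered as a function on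
    covectors, with the value 0 at inadmissible arguments that tensor fields must have.\<close>
  define X :: "('m, 'n) tfield" where
    "X u ws Xs = (if u \<in> A \<and> (ws, Xs) \<in> targs M (fst u) 1 0 then b (fst u) * hd ws (tlift M c (fst u) w) else 0)"
    for u ws Xs
  have comp: "vcomp M c' X i u = b (fst u) * coord_covec M c' i (fst u) (tlift M c (fst u) w)"
    if "u \<in> A" "c' \<in> charts_at M (fst u)" for c' u i
    using that coord_covec_cotangent[OF that(2)] by (simp add: tcomp_def X_def targs_iff)
  \<comment> \<open>The image of K is compact, hence closed in the Hausdorff space M; being closed
    in the chart domain alone would not make its complement open in M.\<close>
  have "compact (cinv c ` K)"
    using homeomorphism_cont2[OF chart_homeomorphism[OF at(1)]] \<beta>(2,3)
    by (intro compact_continuous_image) (auto intro: continuous_on_subset)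
  then have K: "open (- (cinv c ` K))"
    by (simp add: compact_imp_closed open_Compl)
  have b0: "b q = 0" if "q \<notin> cinv c ` K" for q
    using that \<beta>(4)[of "cmap c q"] cinv_cmap[OF at(1), of q] by (force simp: b_def)
  have X: "X \<in> aniso_vector_fields M A"
  proof (rule aniso_tensorsI)
    fix u assume u: "u \<in> A"
    show "X u \<in> tensors_at M (fst u) 1 0"
    proof (rule tensors_atI)
      fix ws Xs \<omega> \<eta> and \<mu> :: nat and a b :: real
      assume h: "(ws, Xs) \<in> targs M (fst u) 1 0" "\<mu> < 1" "\<omega> \<in> cotangent_space M (fst u)" "\<eta> \<in> cotangent_space M (fst u)"
      then obtain w' where "ws = [w']" "Xs = []"
        by (cases ws) (auto simp: targs_iff)
      then show "X u (ws[\<mu> := \<lambda>u. a * \<omega> u + b * \<eta> u]) Xs = a * X u (ws[\<mu> := \<omega>]) Xs + b * X u (ws[\<mu> := \<eta>]) Xs"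
        using h u by (simp add: X_def targs_iff cotangent_lincomb algebra_simps)
    qed (auto simp: X_def)
  next
    fix u assume "u \<notin> A"
    then show "X u = (\<lambda>ws Xs. 0)"
      by (simp add: X_def fun_eq_iff)
  next
    fix c' and "is" js :: "'n list"
    assume c': "c' \<in> atlas M" and len: "length is = 1" "length js = 0"
    obtain i where i: "is = [i]" "js = []"
      using len by (cases "is") auto
    let ?U = "\<lambda>W. tdom c' A \<inter> fst -` (cmap c' ` (cdom c' \<inter> W))"
    have U: "open (?U W)" if "open W" for W
      using open_overlap[OF c' that] by (intro open_Int open_tdom c' open_vimage_fst[unfolded vimage_def[symmetric]])
        (simp add: open_vimage continuous_on_fst continuous_on_id)
    have "smooth_in c' (vcomp M c' X i)"
    proof (rule smooth_on_local)
      fix z assume z: "z \<in> tdom c' A"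
      then obtain u where u: "u \<in> A" "c' \<in> charts_at M (fst u)" "z = tcoord c' u"
        by (rule tdomE[OF c'])
      then have fz: "fst z = cmap c' (fst u)" "fst u \<in> cdom c'"
        by (auto simp: tcoord_def in_charts_at)
      show "\<exists>U. open U \<and> z \<in> U \<and> smooth_on U (texpr M c' (vcomp M c' X i))"
      proof (cases "fst u \<in> cdom c")
        case True
        let ?t = "\<lambda>z. transition c' c (fst z)"
        let ?O = "?U (cdom c)"
        have O: "open ?O"
          by (rule U[OF open_cdom[OF at(1)]])
        have fst: "smooth_on ?O (fst :: (real^'n) \<times> (real^'n) \<Rightarrow> real^'n)"
          by (rule smooth_on_bounded_linear[OF bounded_linear_fst])
        have t: "smooth_on ?O ?t"
          by (rule smooth_on_compose[OF O open_overlap[OF c' open_cdom[OF at(1)]] _ fst transition_smooth[OF c' at(1)]]) auto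
        have tO: "?t ` ?O \<subseteq> cmap c ` (cdom c \<inter> cdom c')"
          by (auto simp: transition_cmap c')
        have \<beta>t: "smooth_on ?O (\<lambda>z. \<beta> (?t z))"
          by (rule smooth_on_compose[OF O open_UNIV subset_UNIV t \<beta>(1)])
        have "smooth_on (cmap c ` (cdom c \<inter> cdom c')) (\<lambda>x. frechet_derivative (transition c c') (at x) w $ i)"
          by (intro smooth_on_bounded_linear_compose[OF bounded_linear_vec_nth] open_overlap open_cdom
              smooth_on_frechet_derivative transition_smooth at c')
        from smooth_on_compose[OF O open_overlap[OF at(1) open_cdom[OF c']] tO t this]
        have "smooth_on ?O (\<lambda>z. \<beta> (?t z) * frechet_derivative (transition c c') (at (?t z)) w $ i)"
          by (rule smooth_on_mult[OF O \<beta>t])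
        also have "smooth_on ?O (\<lambda>z. \<beta> (?t z) * frechet_derivative (transition c c') (at (?t z)) w $ i) =
            smooth_on ?O (texpr M c' (vcomp M c' X i))"
        proof (rule smooth_on_cong[OF O])
          fix z' assume z': "z' \<in> ?O"
          then have "z' \<in> tdom c' A" by blast
          then obtain u' where u': "u' \<in> A" "c' \<in> charts_at M (fst u')" "z' = tcoord c' u'"
            by (rule tdomE[OF c'])
          obtain q where q: "q \<in> cdom c'" "q \<in> cdom c" "fst z' = cmap c' q"
            using z' by blast
          have "cmap c' (fst u') = cmap c' q" "fst u' \<in> cdom c'"
            using u' q by (auto simp: tcoord_def in_charts_at)
          then have q': "fst u' = q"
            using cinv_cmap[OF c'] q(1) by metis
          then have cq: "c \<in> charts_at M (fst u')"
            using at q by (simp add: in_charts_at)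
          have t: "?t z' = cmap c q"
            using q by (simp add: transition_cmap c')
          have eq: "texpr M c' (vcomp M c' X i) z' = b q * (jacobian c c' q w $ i)"
            unfolding u'(3) texpr_tcoord[OF u'(1,2)] comp[OF u'(1,2)]
              q'
              coord_covec_apply[OF tlift_tangent[OF cq[unfolded q']]] tlift_apply[OF u'(2)[unfolded q']] ..
          have "b q = \<beta> (cmap c q)"
            using q(2) by (simp only: b_def if_True)
          then show "\<beta> (?t z') * frechet_derivative (transition c c') (at (?t z')) w $ i = texpr M c' (vcomp M c' X i) z'"
            unfolding eq t jacobian_def by (simp only:)
        qed
        finally show ?thesis
          using O z fz True by (intro exI[of _ ?O]) auto
      next
        case False
        let ?O = "?U (- (cinv c ` K))"
        have O: "open ?O"
          by (rule U[OF K])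
        have "fst u \<notin> cinv c ` K"
        proof
          assume "fst u \<in> cinv c ` K"
          then obtain x where x: "x \<in> K" "fst u = cinv c x"
            by (rule imageE) simp
          then show False
            using False cinv_cdom[OF at(1) subsetD[OF \<beta>(3) x(1)]] by simp
        qed
        moreover have "smooth_on ?O (\<lambda>z. 0::real)"
          by (rule smooth_on_const)
        moreover have "smooth_on ?O (\<lambda>z. 0::real) = smooth_on ?O (texpr M c' (vcomp M c' X i))"
        proof (rule smooth_on_cong[OF O])
          fix z' assume z': "z' \<in> ?O"
          then have "z' \<in> tdom c' A" by blast
          then obtain u' where u': "u' \<in> A" "c' \<in> charts_at M (fst u')" "z' = tcoord c' u'"
            by (rule tdomE[OF c'])
          obtain q where q: "q \<in> cdom c'" "q \<notin> cinv c ` K" "fst z' = cmap c' q"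
            using z' by blast
          have "cmap c' (fst u') = cmap c' q" "fst u' \<in> cdom c'"
            using u' q by (auto simp: tcoord_def in_charts_at)
          then have q': "fst u' = q"
            using cinv_cmap[OF c'] q(1) by metis
          show "0 = texpr M c' (vcomp M c' X i) z'"
            unfolding u'(3) texpr_tcoord[OF u'(1,2)] comp[OF u'(1,2)] q' b0[OF q(2)] by simp
        qed
        ultimately show ?thesis
          using O z fz by (intro exI[of _ ?O]) auto
      qed
    qed
    then show "smooth_in c' (tcomp M c' X is js)"
      by (simp add: i)
  qed
  show thesis
  proof
    show "X \<in> aniso_vector_fields M A" "open V" "cmap c p \<in> V"
      by (fact X \<beta>)+
    show "vcomp M c X i u = w $ i" if "u \<in> A" "c \<in> charts_at M (fst u)" "cmap c (fst u) \<in> V" for u i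
      using that comp[OF that(1,2), of i] \<beta>(7)[OF that(3)]
      by (simp add: b_def in_charts_at coord_covec_apply tlift_tangent tlift_self)
  qed
qed

end

section \<open>Divergence of the metric volume form\<close>

context finsler_manifold
begin

lemma vol_form_update:
  assumes v: "v \<in> A" and c: "c \<in> charts_at M (fst v)"
    and Xs: "length Xs = CARD('n)" "set Xs \<subseteq> tangent_space M (fst v)" and Y: "Y \<in> tangent_space M (fst v)"
  shows "vol_form M A L v [] (Xs[to_nat_on (UNIV :: 'n set) k := Y]) =
    chart_sign c (fst v) * vol_density c v * det (replace_col (frame_matrix c Xs) k (Y c))"
proof -
  have "set (Xs[to_nat_on (UNIV :: 'n set) k := Y]) \<subseteq> tangent_space M (fst v)"
    using set_update_subset_insert[of Xs _ Y] Xs(2) Y by blast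
  then show ?thesis
    using vol_form_frame[OF v c] Xs(1) by (simp add: frame_matrix_update)
qed

lemma vol_form_component:
  assumes v: "v \<in> A" and c: "c \<in> charts_at M (fst v)" and js: "length js = CARD('n)"
  shows "tcomp M c (vol_form M A L) [] js v = chart_sign c (fst v) * vol_density c v *
    det (\<chi> i j. axis (js ! to_nat_on (UNIV :: 'n set) j) 1 $ i)"
proof -
  let ?Xs = "map (\<lambda>j. coord_vec M c j (fst v)) js"
  have "frame_matrix c ?Xs = (\<chi> i j. axis (js ! to_nat_on (UNIV :: 'n set) j) 1 $ i)"
    by (simp add: frame_matrix_def js enumeration_less coord_vec_self[OF c])
  moreover have "set ?Xs \<subseteq> tangent_space M (fst v)"
    using coord_vec_tangent[OF c] by auto
  ultimately show ?thesis
    using vol_form_frame[OF v c, of ?Xs] js by (simp add: tcomp_def)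
qed

text \<open>Needed before the derivation laws can be applied to the volume form. A component is a
  fixed determinant times the sign times the density; as the sign is only locally constant,
  smoothness is obtained neighbourhood by neighbourhood.\<close>

lemma vol_form_aniso: "vol_form M A L \<in> aniso_tensors M A 0 CARD('n)"
proof (rule aniso_tensorsI)
  fix v assume v: "v \<in> A"
  show "vol_form M A L v \<in> tensors_at M (fst v) 0 CARD('n)"
  proof (rule tensors_atI)
    fix ws Xs Y Y' and \<nu> :: nat and a b :: real
    assume h: "(ws, Xs) \<in> targs M (fst v) 0 CARD('n)" "\<nu> < CARD('n)"
      "Y \<in> tangent_space M (fst v)" "Y' \<in> tangent_space M (fst v)"
    then have ws: "ws = []" and Xs: "length Xs = CARD('n)" "set Xs \<subseteq> tangent_space M (fst v)"
      by (auto simp: targs_iff)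
    obtain k where k: "\<nu> = to_nat_on (UNIV :: 'n set) k"
      using enumerationE[OF h(2)] .
    obtain c where c: "c \<in> charts_at M (fst v)"
      using charts_at_nonempty by blast
    note lin = linear_det_replace_col[of "frame_matrix c Xs" k]
    show "vol_form M A L v ws (Xs[\<nu> := tcomb a Y b Y']) =
        a * vol_form M A L v ws (Xs[\<nu> := Y]) + b * vol_form M A L v ws (Xs[\<nu> := Y'])"
      unfolding ws k vol_form_update[OF v c Xs h(3)] vol_form_update[OF v c Xs h(4)]
        vol_form_update[OF v c Xs tcomb_tangent[OF h(3,4)]]
      by (simp add: tcomb_def linear_add[OF lin] linear_scale[OF lin] algebra_simps)
  qed (simp_all add: vol_form_def)
next
  fix v assume "v \<notin> A"
  then show "vol_form M A L v = (\<lambda>ws Xs. 0)"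
    by (simp add: vol_form_def fun_eq_iff)
next
  fix c and "is" js :: "'n list"
  assume c: "c \<in> atlas M" and len: "length is = 0" "length js = CARD('n)"
  have "smooth_in c (tcomp M c (vol_form M A L) [] js)"
  proof (rule smooth_on_local)
    fix z assume z: "z \<in> tdom c A"
    then obtain v where v: "v \<in> A" "c \<in> charts_at M (fst v)" "z = tcoord c v"
      by (rule tdomE[OF c])
    obtain S where S: "open S" "cmap c (fst v) \<in> S" "S \<subseteq> cmap c ` cdom c"
      "\<And>x. x \<in> S \<Longrightarrow> chart_sign c (cinv c x) = chart_sign c (fst v)"
      using chart_sign_locally_constant[OF v(2)] by blast
    let ?O = "tdom c A \<inter> fst -` S"
    let ?a = "chart_sign c (fst v) * det (\<chi> i j. axis (js ! to_nat_on (UNIV :: 'n set) j) 1 $ i)"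
    have O: "open ?O"
      by (intro open_Int open_tdom[OF c] open_vimage[OF S(1)] continuous_on_fst continuous_on_id)
    have "smooth_on ?O (\<lambda>z. ?a * texpr M c (vol_density c) z)"
      by (intro smooth_on_mult[OF O] smooth_on_const smooth_on_subset[OF vol_density_smooth[OF c]]) auto
    also have "smooth_on ?O (\<lambda>z. ?a * texpr M c (vol_density c) z) =
        smooth_on ?O (texpr M c (tcomp M c (vol_form M A L) [] js))"
    proof (rule smooth_on_cong[OF O])
      fix z' assume z': "z' \<in> ?O"
      then have "z' \<in> tdom c A" by blast
      then obtain u where u: "u \<in> A" "c \<in> charts_at M (fst u)" "z' = tcoord c u"
        by (rule tdomE[OF c])
      then have "cmap c (fst u) \<in> S" "fst u \<in> cdom c"
        using z' by (simp_all add: tcoord_def in_charts_at)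
      then have "chart_sign c (fst u) = chart_sign c (fst v)"
        using S(4)[of "cmap c (fst u)"] cinv_cmap[OF c] by simp
      then show "?a * texpr M c (vol_density c) z' = texpr M c (tcomp M c (vol_form M A L) [] js) z'"
        unfolding u(3) texpr_tcoord[OF u(1,2)] vol_form_component[OF u(1,2) len(2)] by (simp only: mult_ac)
    qed
    finally show "\<exists>U. open U \<and> z \<in> U \<and> smooth_on U (texpr M c (tcomp M c (vol_form M A L) [] js))"
      using O z v S(2) by (intro exI[of _ ?O]) (simp add: tcoord_def)
  qed
  then show "smooth_in c (tcomp M c (vol_form M A L) is js)"
    using len by simp
qed

text \<open>The function dVol(E_1, ..., E_n) of the extended fields is differentiated in two ways:
  as a function, equal near the point to a constant times the density, and by the derivation rule.
  Solving for the bracket of dVol leaves a multiple of dVol, since every term contains the sign and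
  the frame determinant.\<close>

lemma lie_vol_form:
  assumes Z: "Z \<in> aniso_vector_fields M A" and lie: "aniso_lie_bracket M A N Z lie"
    and v: "v \<in> A" and c: "c \<in> charts_at M (fst v)"
    and Xs: "length Xs = CARD('n)" "set Xs \<subseteq> tangent_space M (fst v)"
  shows "lie 0 CARD('n) (vol_form M A L) v [] Xs =
    ((\<Sum>k\<in>UNIV. vcomp M c Z k v * delta M N c k (vol_density c) v) / vol_density c v +
      (\<Sum>i\<in>UNIV. delta M N c i (vcomp M c Z i) v)) * vol_form M A L v [] Xs"
proof -
  have at: "c \<in> atlas M" "fst v \<in> cdom c"
    using c by (auto simp: in_charts_at)
  have D: "tensor_derivation M A lie"
    using lie unfolding aniso_lie_bracket_def by blast
  \<comment> \<open>An extension and its neighbourhood are chosen for every natural number, so that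
    the choice carries no bound; \<open>XL\<close> keeps those of the n slots.\<close>
  let ?P = "\<lambda>\<nu> X S. X \<in> aniso_vector_fields M A \<and> open S \<and> cmap c (fst v) \<in> S \<and>
      (\<forall>u i. u \<in> A \<longrightarrow> c \<in> charts_at M (fst u) \<longrightarrow> cmap c (fst u) \<in> S \<longrightarrow> vcomp M c X i u = (Xs ! \<nu>) c $ i)"
  have "\<exists>X S. ?P \<nu> X S" for \<nu>
    by (rule constant_field_extension[OF c, of "(Xs ! \<nu>) c"]) blast
  then obtain E S where ES: "\<And>\<nu>. ?P \<nu> (E \<nu>) (S \<nu>)"
    by metis
  then have E: "E \<nu> \<in> aniso_vector_fields M A" and S: "open (S \<nu>)" "cmap c (fst v) \<in> S \<nu>"
    and Ecomp: "u \<in> A \<Longrightarrow> c \<in> charts_at M (fst u) \<Longrightarrow> cmap c (fst u) \<in> S \<nu> \<Longrightarrow> vcomp M c (E \<nu>) i u = (Xs ! \<nu>) c $ i"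
    for \<nu> u i
    by blast+
  obtain S0 where S0: "open S0" "cmap c (fst v) \<in> S0"
    "\<And>x. x \<in> S0 \<Longrightarrow> chart_sign c (cinv c x) = chart_sign c (fst v)"
    using chart_sign_locally_constant[OF c] by metis
  define XL where "XL = map E [0..<CARD('n)]"
  define s where "s = chart_sign c (fst v)"
  define W where "W = frame_matrix c Xs"
  define F where "F = vol_density c v"
  define B where "B = (\<chi> i l. delta M N c l (vcomp M c Z i) v)"
  have XL: "length XL = CARD('n)" "set XL \<subseteq> aniso_vector_fields M A"
    using E by (auto simp: XL_def simp del: split_paired_All)
  let ?T = "vol_form M A L" and ?f = "insert_fields (vol_form M A L) XL"
  have T: "?T \<in> aniso_tensors M A 0 (length XL)"
    using vol_form_aniso XL by simp
  \<comment> \<open>Above this finite intersection all the extended fields have constant components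
    and the orientation sign is constant.\<close>
  let ?S = "S0 \<inter> (\<Inter>\<nu><CARD('n). S \<nu>)"
  have near: "open ?S" "cmap c (fst v) \<in> ?S"
    using S0 S by (simp_all add: open_INT open_Int)
  have f: "tcomp M c ?f [] [] u = (s * det W) * vol_density c u"
    if u: "u \<in> A" "c \<in> charts_at M (fst u)" "cmap c (fst u) \<in> ?S" for u
  proof -
    let ?V = "map (\<lambda>X. vec_at X u) XL"
    have "frame_matrix c ?V = W"
    proof -
      have "vec_at (E (to_nat_on (UNIV :: 'n set) j)) u c $ i = (Xs ! to_nat_on (UNIV :: 'n set) j) c $ i" for i j
        using u(3) enumeration_less[of j] unfolding vec_at_chart[OF E u(1,2)] by (intro Ecomp u) auto
      then show ?thesis
        by (simp add: W_def frame_matrix_def XL_def enumeration_less vec_eq_iff)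
    qed
    moreover have "chart_sign c (fst u) = s"
      using S0(3)[of "cmap c (fst u)"] u(2,3) by (simp add: s_def cinv_cmap in_charts_at)
    moreover have "set ?V \<subseteq> tangent_space M (fst u)"
      by (simp add: vec_at_tangent image_subset_iff)
    ultimately show ?thesis
      using insert_fields_apply[OF T XL(2) u(1)] vol_form_frame[OF u(1,2), of ?V] XL(1)
      by (simp add: tcomp_def)
  qed
  have "tcomp M c (lie 0 0 ?f) [] [] v = (\<Sum>k\<in>UNIV. vcomp M c Z k v * delta M N c k (tcomp M c ?f [] []) v)"
    using lie insert_fields_aniso[OF T XL(2)] v c unfolding aniso_lie_bracket_def by blast
  also have "\<dots> = (\<Sum>k\<in>UNIV. vcomp M c Z k v * (s * det W * delta M N c k (vol_density c) v))"
  proof -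
    have "delta M N c k (tcomp M c ?f [] []) v = delta M N c k (\<lambda>u. (s * det W) * vol_density c u) v" for k
      by (rule delta_local_cong[OF c v near f])
    then show ?thesis
      by (simp add: delta_cmult[OF c v vol_density_smooth[OF at(1)]])
  qed
  also have "\<dots> = s * det W * (\<Sum>k\<in>UNIV. vcomp M c Z k v * delta M N c k (vol_density c) v)"
    by (simp add: sum_distrib_left mult_ac)
  finally have lie_f: "lie 0 0 ?f v [] [] = s * det W * (\<Sum>k\<in>UNIV. vcomp M c Z k v * delta M N c k (vol_density c) v)"
    by (simp add: tcomp_def)
  have V: "map (\<lambda>X. vec_at X v) XL = Xs"
  proof (rule nth_equalityI)
    fix \<nu> assume "\<nu> < length (map (\<lambda>X. vec_at X v) XL)"
    then have \<nu>: "\<nu> < CARD('n)" by (simp add: XL)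
    then have "Xs ! \<nu> \<in> tangent_space M (fst v)"
      using Xs by auto
    then have "vec_at (E \<nu>) v = Xs ! \<nu>"
      using vec_at_chart[OF E v c] Ecomp[OF v c S(2)]
      by (intro tangent_eqI[OF vec_at_tangent _ c]) (simp_all add: vec_eq_iff)
    then show "map (\<lambda>X. vec_at X v) XL ! \<nu> = Xs ! \<nu>"
      using \<nu> by (simp add: XL_def)
  qed (simp add: XL Xs)
  \<comment> \<open>As the components of the extended field are constant near the point, only the
    derivatives of Z survive in the bracket, which form the matrix -B.\<close>
  have lieE: "vec_at (lie 1 0 (E \<nu>)) v c = - B *v ((Xs ! \<nu>) c)" for \<nu>
  proof -
    have "vcomp M c (lie 1 0 (E \<nu>)) i v = (\<Sum>l\<in>UNIV. vcomp M c Z l v * delta M N c l (vcomp M c (E \<nu>) i) v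
        - vcomp M c (E \<nu>) l v * delta M N c l (vcomp M c Z i) v)" for i
      using lie E v c unfolding aniso_lie_bracket_def by blast
    moreover have "delta M N c l (vcomp M c (E \<nu>) i) v = 0" for l i
    proof -
      have "delta M N c l (vcomp M c (E \<nu>) i) v = delta M N c l (\<lambda>u. (Xs ! \<nu>) c $ i) v"
        by (rule delta_local_cong[OF c v S Ecomp])
      then show ?thesis
        by (simp add: delta_const)
    qed
    ultimately have "vec_at (lie 1 0 (E \<nu>)) v c $ i = (- B *v ((Xs ! \<nu>) c)) $ i" for i
      unfolding vec_at_chart[OF derivation_aniso[OF D E] v c]
      by (simp add: Ecomp[OF v c S(2)] B_def matrix_vector_mult_def sum_negf mult.commute)
    then show ?thesis
      by (simp add: vec_eq_iff)
  qed
  have "(\<Sum>\<nu><length XL. ?T v [] (Xs[\<nu> := vec_at (lie 1 0 (XL ! \<nu>)) v])) =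
      (\<Sum>k\<in>UNIV. s * F * det (replace_col W k (- B *v column k W)))"
    unfolding XL sum_enumeration
  proof (rule sum.cong[OF refl])
    fix k
    have "column k W = (Xs ! to_nat_on (UNIV :: 'n set) k) c"
      by (simp add: column_def W_def frame_matrix_def vec_eq_iff)
    then show "?T v [] (Xs[to_nat_on (UNIV :: 'n set) k := vec_at (lie 1 0 (XL ! to_nat_on (UNIV :: 'n set) k)) v]) =
        s * F * det (replace_col W k (- B *v column k W))"
      unfolding vol_form_update[OF v c Xs vec_at_tangent]
      using lieE[of "to_nat_on (UNIV :: 'n set) k"] by (simp add: XL_def enumeration_less s_def F_def W_def)
  qed
  also have "\<dots> = s * F * (trace (- B) * det W)"
    by (simp only: sum_distrib_left[symmetric] sum_det_replace_col)
  also have "trace (- B) = - trace B"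
    by (simp add: trace_def sum_negf)
  finally have "lie 0 0 ?f v [] [] = lie 0 CARD('n) ?T v [] Xs + s * F * (- trace B * det W)"
    using derivation_insert_fields[OF D v T XL(2)] by (simp add: V XL)
  moreover have "?T v [] Xs = s * F * det W"
    by (simp add: vol_form_frame[OF v c Xs] s_def F_def W_def)
  moreover have "(\<Sum>i\<in>UNIV. delta M N c i (vcomp M c Z i) v) = trace B"
    by (simp add: trace_def B_def)
  moreover have "F \<noteq> 0"
    using vol_density_pos[OF v c] by (simp add: F_def)
  ultimately show ?thesis
    unfolding lie_f F_def[symmetric] by (simp add: field_simps)
qed

text \<open>The factor in the definite description is unique because the volume form does not vanish
  on the coordinate frame, whose matrix is the identity.\<close>

lemma divergence_eq:
  assumes Z: "Z \<in> aniso_vector_fields M A" and lie: "aniso_lie_bracket M A N Z lie"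
    and v: "v \<in> A" and c: "c \<in> charts_at M (fst v)"
  shows "divergence M A L lie v =
    (\<Sum>k\<in>UNIV. vcomp M c Z k v * delta M N c k (vol_density c) v) / vol_density c v +
      (\<Sum>i\<in>UNIV. delta M N c i (vcomp M c Z i) v)" (is "_ = ?a")
  unfolding divergence_def
proof (rule the_equality)
  have D: "tensor_derivation M A lie"
    using lie unfolding aniso_lie_bracket_def by blast
  note lieT = aniso_tensors_at[OF derivation_aniso[OF D vol_form_aniso] v]
  show "lie 0 CARD('n) (vol_form M A L) v = (\<lambda>ws Xs. ?a * vol_form M A L v ws Xs)"
  proof (intro ext)
    fix ws Xs
    show "lie 0 CARD('n) (vol_form M A L) v ws Xs = ?a * vol_form M A L v ws Xs"
    proof (cases "(ws, Xs) \<in> targs M (fst v) 0 CARD('n)")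
      case True
      then show ?thesis
        using lie_vol_form[OF Z lie v c, of Xs] by (simp add: targs_iff)
    next
      case False
      then show ?thesis
        using tensors_at_outside[OF lieT] by (simp add: vol_form_def)
    qed
  qed
  fix a
  assume a: "lie 0 CARD('n) (vol_form M A L) v = (\<lambda>ws Xs. a * vol_form M A L v ws Xs)"
  obtain js :: "'n list" where js: "length js = CARD('n)" "\<And>j. js ! to_nat_on UNIV j = j"
    using enumeration_list by blast
  let ?Xs = "map (\<lambda>j. coord_vec M c j (fst v)) js"
  have Xs: "length ?Xs = CARD('n)" "set ?Xs \<subseteq> tangent_space M (fst v)"
    using js(1) coord_vec_tangent[OF c] by auto
  have "frame_matrix c ?Xs = mat 1"
    by (simp add: frame_matrix_def vec_eq_iff js enumeration_less coord_vec_self[OF c] mat_def axis_def)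
  then have "vol_form M A L v [] ?Xs \<noteq> 0"
    using vol_form_frame[OF v c Xs] vol_density_pos[OF v c] chart_sign_nz[OF c] by simp
  moreover have "a * vol_form M A L v [] ?Xs = ?a * vol_form M A L v [] ?Xs"
    using lie_vol_form[OF Z lie v c Xs] a by simp
  ultimately show "a = ?a"
    by simp
qed

text \<open>The correction terms replace one column at a time by the matrix Gamma^i_{kj}, k fixed,
  whose trace is Gamma^i_{ki}. N is a parameter so that the metric nonlinear connection can stand in
  for the underlying one; agreement at v suffices since \<open>delta\<close> takes the coefficients
  only there.\<close>

lemma nabla_vol_form:
  assumes v: "v \<in> A" and c: "c \<in> charts_at M (fst v)" and js: "length js = CARD('n)"
    and N: "\<And>i j. underlying_nl_conn M D c i j v = N c i j v"
  shows "nabla_comp M D c k (vol_form M A L) [] js v =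
    chart_sign c (fst v) * det (\<chi> i j. axis (js ! to_nat_on (UNIV :: 'n set) j) 1 $ i) *
      (delta M N c k (vol_density c) v - vol_density c v * (\<Sum>i\<in>UNIV. christoffel M D c i k i v))"
proof -
  have at: "c \<in> atlas M" "fst v \<in> cdom c"
    using c by (auto simp: in_charts_at)
  define W :: "'n list \<Rightarrow> real^'n^'n" where "W js = (\<chi> i j. axis (js ! to_nat_on (UNIV :: 'n set) j) 1 $ i)" for js
  define \<Gamma> where "\<Gamma> = (\<chi> i j. christoffel M D c i k j v)"
  define s where "s = chart_sign c (fst v)"
  define F where "F = vol_density c v"
  let ?T = "vol_form M A L"
  obtain S where S: "open S" "cmap c (fst v) \<in> S"
    "\<And>x. x \<in> S \<Longrightarrow> chart_sign c (cinv c x) = chart_sign c (fst v)"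
    using chart_sign_locally_constant[OF c] by metis
  have "delta M (underlying_nl_conn M D) c k (tcomp M c ?T [] js) v = delta M N c k (tcomp M c ?T [] js) v"
    by (simp add: delta_def N)
  also have "\<dots> = delta M N c k (\<lambda>u. (s * det (W js)) * vol_density c u) v"
  proof (rule delta_local_cong[OF c v S(1,2)])
    fix u assume u: "u \<in> A" "c \<in> charts_at M (fst u)" "cmap c (fst u) \<in> S"
    then have "chart_sign c (fst u) = s"
      using S(3)[OF u(3)] by (simp add: s_def cinv_cmap in_charts_at)
    then show "tcomp M c ?T [] js u = (s * det (W js)) * vol_density c u"
      by (simp add: vol_form_component[OF u(1,2) js] W_def)
  qed
  also have "\<dots> = s * det (W js) * delta M N c k (vol_density c) v"
    by (rule delta_cmult[OF c v vol_density_smooth[OF at(1)]])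
  finally have 1: "delta M (underlying_nl_conn M D) c k (tcomp M c ?T [] js) v =
      s * det (W js) * delta M N c k (vol_density c) v" .
  have upd: "W (js[to_nat_on (UNIV :: 'n set) m := l]) = replace_col (W js) m (axis l 1)" for m l
    using js enumeration_less[of m]
    by (simp add: W_def replace_col_def vec_eq_iff nth_list_update enumeration_eq_iff)
  have "(\<Sum>l\<in>UNIV. christoffel M D c l k (js ! to_nat_on UNIV m) v * tcomp M c ?T [] (js[to_nat_on UNIV m := l]) v) =
      s * F * det (replace_col (W js) m (\<Gamma> *v column m (W js)))" for m
  proof -
    note lin = linear_det_replace_col[of "W js" m]
    \<comment> \<open>Column m of \<open>W js\<close> is the basis vector of the m-th lower index,
      so the product is the column of Christoffel symbols that belongs to this index.\<close>
    have "\<Gamma> *v column m (W js) = (\<Sum>l\<in>UNIV. christoffel M D c l k (js ! to_nat_on UNIV m) v *\<^sub>R axis l 1)"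
      by (simp add: vec_eq_iff matrix_vector_mult_def \<Gamma>_def column_def W_def axis_def
          if_distrib[of "\<lambda>x. _ * x"] cong: if_cong)
    then have "det (replace_col (W js) m (\<Gamma> *v column m (W js))) =
        (\<Sum>l\<in>UNIV. christoffel M D c l k (js ! to_nat_on UNIV m) v * det (replace_col (W js) m (axis l 1)))"
      by (simp add: linear_sum[OF lin] linear_scale[OF lin])
    moreover have "tcomp M c ?T [] (js[to_nat_on UNIV m := l]) v = s * F * det (replace_col (W js) m (axis l 1))" for l
      using vol_form_component[OF v c, of "js[to_nat_on UNIV m := l]"] js
      by (simp add: upd W_def[symmetric] s_def F_def)
    ultimately show ?thesis
      by (simp add: sum_distrib_left mult_ac)
  qed
  then have "(\<Sum>\<nu><length js. \<Sum>l\<in>UNIV. christoffel M D c l k (js ! \<nu>) v * tcomp M c ?T [] (js[\<nu> := l]) v) =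
      (\<Sum>m\<in>UNIV. s * F * det (replace_col (W js) m (\<Gamma> *v column m (W js))))"
    unfolding js sum_enumeration by simp
  also have "\<dots> = s * F * (trace \<Gamma> * det (W js))"
    by (simp only: sum_distrib_left[symmetric] sum_det_replace_col)
  finally have 2: "(\<Sum>\<nu><length js. \<Sum>l\<in>UNIV. christoffel M D c l k (js ! \<nu>) v * tcomp M c ?T [] (js[\<nu> := l]) v) =
      s * F * (trace \<Gamma> * det (W js))" .
  have 3: "(\<Sum>i\<in>UNIV. christoffel M D c i k i v) = trace \<Gamma>"
    by (simp add: trace_def \<Gamma>_def)
  show ?thesis
    unfolding nabla_comp_def 1 2 3 W_def[symmetric] s_def[symmetric] F_def[symmetric]
    by (simp add: algebra_simps)
qed

end

theorem proposition4p11: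
  fixes M :: "('m::{t2_space,second_countable_topology}, 'n::finite) mfd"
    and A :: "('m, 'n) tm set"
    and L :: "('m, 'n) tm \<Rightarrow> real"
    and Z :: "('m, 'n) tfield"
    and lie :: "('m, 'n) toper"
  assumes dim: "CARD('n) \<ge> 2"
    and M: "connected_oriented_manifold M"
    and A: "conic_domain M A"
    and L: "pseudo_Finsler M A L"
    and Z: "Z \<in> aniso_vector_fields M A"
    and lie: "aniso_lie_bracket M A (metric_nl_conn M L) Z lie"
  shows
    "(\<forall>D. aniso_connection M A D \<and> torsion_free M A D \<and>
          same_nl_conn M A (underlying_nl_conn M D) (metric_nl_conn M L) \<and>
          nabla_along_vanishes M A D Z 0 CARD('n) (vol_form M A L) \<longrightarrow>
        (\<forall>v\<in>A. divergence M A L lie v = trace_nabla M D Z v \<and>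
          (\<forall>c\<in>charts_at M (fst v). divergence M A L lie v =
             (\<Sum>i\<in>UNIV. delta M (metric_nl_conn M L) c i (vcomp M c Z i) v
                       + (\<Sum>k\<in>UNIV. christoffel M D c i i k v * vcomp M c Z k v)))))
     \<and> (\<forall>D. chern_connection M A L D \<longrightarrow>
          torsion_free M A D \<and>
          same_nl_conn M A (underlying_nl_conn M D) (metric_nl_conn M L) \<and>
          nabla_along_vanishes M A D Z 0 CARD('n) (vol_form M A L) \<and>
          (\<forall>v\<in>A. divergence M A L lie v = trace_nabla M D Z v))
     \<and> (\<forall>v\<in>A. \<forall>c\<in>charts_at M (fst v). divergence M A L lie v =
          (\<Sum>i\<in>UNIV. delta M (metric_nl_conn M L) c i (vcomp M c Z i) v
                    + (\<Sum>k\<in>UNIV. chern_symbol M L c i i k v * vcomp M c Z k v)))"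
proof -
  interpret finsler_manifold M A L
    by unfold_locales (fact M A L)+
  let ?N = "metric_nl_conn M L" and ?T = "vol_form M A L"
  \<comment> \<open>Stated for an arbitrary symmetric array at one point, so as to cover the
    Christoffel symbols of a connection as well as the Chern symbols alone.\<close>
  have div: "divergence M A L lie v = (\<Sum>i\<in>UNIV. delta M ?N c i (vcomp M c Z i) v
      + (\<Sum>k\<in>UNIV. \<Gamma> i i k * vcomp M c Z k v))"
    if v: "v \<in> A" and c: "c \<in> charts_at M (fst v)"
      and vol: "(\<Sum>k\<in>UNIV. vcomp M c Z k v * delta M ?N c k (vol_density c) v) =
        vol_density c v * (\<Sum>k\<in>UNIV. vcomp M c Z k v * (\<Sum>i\<in>UNIV. \<Gamma> i k i))"
      and sym: "\<And>i j k. \<Gamma> i j k = \<Gamma> i k j"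
    for v c and \<Gamma> :: "'n \<Rightarrow> 'n \<Rightarrow> 'n \<Rightarrow> real"
  proof -
    have "(\<Sum>k\<in>UNIV. vcomp M c Z k v * (\<Sum>i\<in>UNIV. \<Gamma> i k i)) = (\<Sum>k\<in>UNIV. \<Sum>i\<in>UNIV. \<Gamma> i i k * vcomp M c Z k v)"
      unfolding sum_distrib_left by (simp only: sym[of _ _ _] mult.commute)
    also have "\<dots> = (\<Sum>i\<in>UNIV. \<Sum>k\<in>UNIV. \<Gamma> i i k * vcomp M c Z k v)"
      by (rule sum.swap)
    finally show ?thesis
      using vol_density_pos[OF v c] unfolding divergence_eq[OF Z lie v c] vol by (simp add: sum.distrib)
  qed
  \<comment> \<open>\<open>trace_nabla\<close> is evaluated in a chosen chart, so its formula is
    established there and matched with the divergence, whose formula holds in every chart.\<close>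
  have trace: "trace_nabla M D Z v = (\<Sum>i\<in>UNIV. delta M ?N c i (vcomp M c Z i) v
      + (\<Sum>k\<in>UNIV. christoffel M D c i i k v * vcomp M c Z k v))"
    if "same_nl_conn M A (underlying_nl_conn M D) ?N" "v \<in> A" "c = (SOME c. c \<in> charts_at M (fst v))" for D v c
  proof -
    have "c \<in> charts_at M (fst v)"
      unfolding that(3) by (rule some_chart)
    then have "underlying_nl_conn M D c i j v = ?N c i j v" for i j
      using that(1,2) unfolding same_nl_conn_def by blast
    then show ?thesis
      by (simp add: trace_nabla_def that(3)[symmetric] nabla_comp_def delta_def)
  qed
  have general: "divergence M A L lie v = trace_nabla M D Z v \<and>
      (\<forall>c\<in>charts_at M (fst v). divergence M A L lie v = (\<Sum>i\<in>UNIV. delta M ?N c i (vcomp M c Z i) v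
        + (\<Sum>k\<in>UNIV. christoffel M D c i i k v * vcomp M c Z k v)))"
    if D: "torsion_free M A D" "same_nl_conn M A (underlying_nl_conn M D) ?N" "nabla_along_vanishes M A D Z 0 CARD('n) ?T"
      and v: "v \<in> A" for D v
  proof -
    have formula: "divergence M A L lie v = (\<Sum>i\<in>UNIV. delta M ?N c i (vcomp M c Z i) v
        + (\<Sum>k\<in>UNIV. christoffel M D c i i k v * vcomp M c Z k v))" if c: "c \<in> charts_at M (fst v)" for c
    proof (rule div[where \<Gamma> = "\<lambda>i j k. christoffel M D c i j k v", OF v c])
      have N: "underlying_nl_conn M D c i j v = ?N c i j v" for i j
        using D(2) v c unfolding same_nl_conn_def by blast
      \<comment> \<open>On the coordinate frame the determinant is 1, and the nonzero orientation
        sign can then be cancelled from the hypothesis on nabla.\<close>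
      obtain js :: "'n list" where js: "length js = CARD('n)" "\<And>j. js ! to_nat_on UNIV j = j"
        using enumeration_list by blast
      have W: "(\<chi> i j. axis (js ! to_nat_on (UNIV :: 'n set) j) (1::real) $ i) = mat 1"
        by (simp add: js vec_eq_iff mat_def axis_def)
      have "(\<Sum>k\<in>UNIV. vcomp M c Z k v * nabla_comp M D c k ?T [] js v) = 0"
        using D(3) v c js(1) unfolding nabla_along_vanishes_def by blast
      then have "chart_sign c (fst v) * (\<Sum>k\<in>UNIV. vcomp M c Z k v * (delta M ?N c k (vol_density c) v
          - vol_density c v * (\<Sum>i\<in>UNIV. christoffel M D c i k i v))) = 0"
        unfolding nabla_vol_form[where N = ?N, OF v c js(1) N] W by (simp add: sum_distrib_left mult_ac)
      then have "(\<Sum>k\<in>UNIV. vcomp M c Z k v * (delta M ?N c k (vol_density c) v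
          - vol_density c v * (\<Sum>i\<in>UNIV. christoffel M D c i k i v))) = 0"
        using chart_sign_nz[OF c] by simp
      moreover have "(\<Sum>k\<in>UNIV. z k * (d k - F * G k)) = (\<Sum>k\<in>UNIV. z k * d k) - F * (\<Sum>k\<in>UNIV. z k * G k)"
        for z d G :: "'n \<Rightarrow> real" and F
        unfolding right_diff_distrib sum_subtractf sum_distrib_left by (simp only: mult_ac)
      ultimately show "(\<Sum>k\<in>UNIV. vcomp M c Z k v * delta M ?N c k (vol_density c) v) =
          vol_density c v * (\<Sum>k\<in>UNIV. vcomp M c Z k v * (\<Sum>i\<in>UNIV. christoffel M D c i k i v))"
        by simp
      show "christoffel M D c i j k v = christoffel M D c i k j v" for i j k
        using D(1) v c unfolding torsion_free_def by (meson eq_iff_diff_eq_0)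
    qed
    then show ?thesis
      using trace[OF D(2) v refl] some_chart by simp
  qed
  \<comment> \<open>The Chern connection is reduced to the general case; nabla_k dVol vanishes for
    each k separately, hence along Z.\<close>
  have chern: "torsion_free M A D \<and> same_nl_conn M A (underlying_nl_conn M D) ?N \<and>
      nabla_along_vanishes M A D Z 0 CARD('n) ?T" if D: "chern_connection M A L D" for D
  proof (intro conjI)
    have \<Gamma>: "christoffel M D c i j k v = chern_symbol M L c i j k v" if "v \<in> A" "c \<in> charts_at M (fst v)" for v c i j k
      using D that unfolding chern_connection_def by blast
    show "torsion_free M A D"
      unfolding torsion_free_def
    proof (intro ballI allI)
      fix v c i j k assume vc: "v \<in> A" "c \<in> charts_at M (fst v)"
      show "christoffel M D c i j k v - christoffel M D c i k j v = 0"
        unfolding \<Gamma>[OF vc] using chern_symbol_sym[OF vc] by simp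
    qed
    have N: "underlying_nl_conn M D c i j v = ?N c i j v" if vc: "v \<in> A" "c \<in> charts_at M (fst v)" for v c i j
      unfolding underlying_nl_conn_def \<Gamma>[OF vc] by (rule chern_symbol_nl_conn[OF vc])
    then show "same_nl_conn M A (underlying_nl_conn M D) ?N"
      unfolding same_nl_conn_def by blast
    show "nabla_along_vanishes M A D Z 0 CARD('n) ?T"
      unfolding nabla_along_vanishes_def
    proof (intro ballI allI impI)
      fix v c and "is" js :: "'n list"
      assume vc: "v \<in> A" "c \<in> charts_at M (fst v)" and len: "length is = 0 \<and> length js = CARD('n)"
      have "nabla_comp M D c k ?T [] js v = 0" for k
        using nabla_vol_form[where D = D and N = ?N, OF vc conjunct2[OF len] N[OF vc]]
          delta_vol_density_chern[OF vc] by (simp add: \<Gamma>[OF vc])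
      then show "(\<Sum>k\<in>UNIV. vcomp M c Z k v * nabla_comp M D c k ?T is js v) = 0"
        using len by simp
    qed
  qed
  \<comment> \<open>The last claim concerns the Chern symbols alone and is read off from
    \<open>div\<close>, without passing through a connection.\<close>
  have "divergence M A L lie v = (\<Sum>i\<in>UNIV. delta M ?N c i (vcomp M c Z i) v
      + (\<Sum>k\<in>UNIV. chern_symbol M L c i i k v * vcomp M c Z k v))" if vc: "v \<in> A" "c \<in> charts_at M (fst v)" for v c
    by (rule div[where \<Gamma> = "\<lambda>i j k. chern_symbol M L c i j k v", OF vc]) (simp_all add: delta_vol_density_chern[OF vc] sum_distrib_left mult_ac chern_symbol_sym[OF vc])
  then show ?thesis
    using general chern by blast
qed

end
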